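(* Let $\Omega\subset\mathbb{C}$ be the unit disc with boundary $\Gamma$, and let $p\geq0$ be an integer. Let $\mathbf{w}\in l^{2,\frac p2+1}(\mathbb{N};L^2(\Omega))$. If $\mathbf{v}\in l^{2,\frac{p+1}2}(\mathbb{N};H^1(\Omega))$ solves $$\overline\partial\mathbf{v}+L^2\partial\mathbf{v}=\mathbf{w}\quad\text{in }\Omega,$$ then $$\|\mathbf{v}\|^2_{\frac p2,1}\leq C\left(\|\mathbf{w}\|^2_{\frac p2+1,0}+\|\mathbf{v}|_\Gamma\|^2_{\frac{p+1}2,\frac12}\right),$$ with a constant $C>0$ independent of $\mathbf{v}$ and $\mathbf{w}$.
   Context: $\overline\partial=\frac12(\partial_{x_1}+\mathrm{i}\partial_{x_2})$ and $\partial=\frac12(\partial_{x_1}-\mathrm{i}\partial_{x_2})$ act componentwise on sequence valued maps $\mathbf{u}=\langle u_0,u_{-1},u_{-2},\dots\rangle$. $L$ is the left translation $L\langle u_0,u_{-1},u_{-2},\dots\rangle=\langle u_{-1},u_{-2},\dots\rangle$, and $L^2=L\circ L$. Interior norms: $l^{2,\frac p2}(\mathbb{N};H^q(\Omega))$ is the space of sequences $\mathbf{u}=\langle u_0,u_{-1},\dots\rangle$ with $\|\mathbf{u}\|^2_{\frac p2,q}:=\sum_{j=0}^\infty(1+j)^p\|u_{-j}\|^2_{H^q(\Omega)}<\infty$ (with $H^0=L^2$). Boundary norms: for $\mathbf{g}=\langle g_0,g_{-1},\dots\rangle$ on $\Gamma$, $\|\mathbf{g}\|^2_{\frac p2,q-\frac12}:=\sum_{j=0}^\infty\sum_{n=-\infty}^\infty(1+j)^p(1+|n|)^{2q-1}|g_{-j,n}|^2$,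 where $g_{-j,n}=\frac1{2\pi}\int_0^{2\pi}g_{-j}(e^{\mathrm{i}\beta})e^{-\mathrm{i}n\beta}\,d\beta$. *)

theory Defs
  imports "HOL-Analysis.Analysis"
begin

section \<open>Sobolev spaces on the unit disc\<close>

text \<open>Elements of the function spaces are represented by functions \<open>complex \<Rightarrow> complex\<close>, of which
  only the values almost everywhere on the disc (on the circle, for boundary functions) matter.
  Squared norms take values in \<open>[0,\<infinity>]\<close>, so that no convention is needed for divergent
  integrals and series.\<close>

abbreviation disc :: "complex set" where
  "disc \<equiv> ball 0 1"

definition L2_norm_sq :: "(complex \<Rightarrow> complex) \<Rightarrow> ennreal" where
  "L2_norm_sq u = (\<integral>\<^sup>+ z. ennreal ((cmod (u z))\<^sup>2) \<partial>lebesgue_on disc)"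

definition L2_space :: "(complex \<Rightarrow> complex) set" where
  "L2_space = {u \<in> borel_measurable (lebesgue_on disc). L2_norm_sq u < \<infinity>}"

text \<open>Real differentiability is meant: directional derivatives are taken along vectors of
  \<open>\<complex> = \<real>\<^sup>2\<close>, so that \<open>\<partial>\<^sub>x\<^sub>1\<close> is the direction \<open>1\<close> and
  \<open>\<partial>\<^sub>x\<^sub>2\<close> the direction \<open>\<i>\<close>.\<close>

definition dir_deriv :: "complex \<Rightarrow> (complex \<Rightarrow> complex) \<Rightarrow> complex \<Rightarrow> complex" where
  "dir_deriv e f z = frechet_derivative f (at z) e"

primrec C_k :: "nat \<Rightarrow> (complex \<Rightarrow> complex) \<Rightarrow> bool" where
  "C_k 0 f \<longleftrightarrow> continuous_on UNIV f"
| "C_k (Suc k) f \<longleftrightarrow> (\<forall>z. f differentiable (at z)) \<and> (\<forall>e. C_k k (dir_deriv e f))"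

definition smooth :: "(complex \<Rightarrow> complex) \<Rightarrow> bool" where
  "smooth f \<longleftrightarrow> (\<forall>k. C_k k f)"

definition test_function :: "(complex \<Rightarrow> complex) \<Rightarrow> bool" where
  "test_function \<phi> \<longleftrightarrow> smooth \<phi> \<and>
     compact (closure {z. \<phi> z \<noteq> 0}) \<and> closure {z. \<phi> z \<noteq> 0} \<subseteq> disc"

definition has_weak_deriv ::
    "complex \<Rightarrow> (complex \<Rightarrow> complex) \<Rightarrow> (complex \<Rightarrow> complex) \<Rightarrow> bool" where
  "has_weak_deriv e u g \<longleftrightarrow> u \<in> L2_space \<and> g \<in> L2_space \<and>
     (\<forall>\<phi>. test_function \<phi> \<longrightarrow>
        (LINT z|lebesgue_on disc. u z * dir_deriv e \<phi> z) =
        - (LINT z|lebesgue_on disc. g z * \<phi> z))"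

text \<open>The weak derivative is unique up to null sets.\<close>

definition weak_deriv :: "complex \<Rightarrow> (complex \<Rightarrow> complex) \<Rightarrow> complex \<Rightarrow> complex" where
  "weak_deriv e u = (SOME g. has_weak_deriv e u g)"

definition H1_space :: "(complex \<Rightarrow> complex) set" where
  "H1_space = {u \<in> L2_space. (\<exists>g. has_weak_deriv 1 u g) \<and> (\<exists>g. has_weak_deriv \<i> u g)}"

definition H1_norm_sq :: "(complex \<Rightarrow> complex) \<Rightarrow> ennreal" where
  "H1_norm_sq u =
     L2_norm_sq u + L2_norm_sq (weak_deriv 1 u) + L2_norm_sq (weak_deriv \<i> u)"

definition weak_dbar :: "(complex \<Rightarrow> complex) \<Rightarrow> complex \<Rightarrow> complex" where
  "weak_dbar u z = (weak_deriv 1 u z + \<i> * weak_deriv \<i> u z) / 2"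

definition weak_d :: "(complex \<Rightarrow> complex) \<Rightarrow> complex \<Rightarrow> complex" where
  "weak_d u z = (weak_deriv 1 u z - \<i> * weak_deriv \<i> u z) / 2"

section \<open>Boundary values\<close>

definition circle_L2_norm_sq :: "(complex \<Rightarrow> complex) \<Rightarrow> ennreal" where
  "circle_L2_norm_sq g =
     (\<integral>\<^sup>+ \<beta>. ennreal ((cmod (g (cis \<beta>)))\<^sup>2) \<partial>lebesgue_on {0..2 * pi})"

definition circle_L2_space :: "(complex \<Rightarrow> complex) set" where
  "circle_L2_space =
     {g. (\<lambda>\<beta>. g (cis \<beta>)) \<in> borel_measurable (lebesgue_on {0..2 * pi}) \<and>
         circle_L2_norm_sq g < \<infinity>}"

text \<open>The trace operator is the continuous extension, from \<open>H\<^sup>1\<close> of the disc to \<open>L\<^sup>2\<close> of the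
  circle, of the restriction map on functions smooth up to the boundary.  The graph of
  that extension is the closure of the graph of the restriction map.\<close>

definition has_bdry_trace :: "(complex \<Rightarrow> complex) \<Rightarrow> (complex \<Rightarrow> complex) \<Rightarrow> bool" where
  "has_bdry_trace u g \<longleftrightarrow> u \<in> H1_space \<and> g \<in> circle_L2_space \<and>
     (\<exists>\<phi> :: nat \<Rightarrow> complex \<Rightarrow> complex. (\<forall>k. smooth (\<phi> k)) \<and>
        (\<lambda>k. H1_norm_sq (\<lambda>z. \<phi> k z - u z)) \<longlonglongrightarrow> 0 \<and>
        (\<lambda>k. circle_L2_norm_sq (\<lambda>z. \<phi> k z - g z)) \<longlonglongrightarrow> 0)"

text \<open>By the trace theorem such a function exists for every element of \<open>H\<^sup>1\<close>, and it is unique up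
  to null sets of the circle.\<close>

definition bdry_trace :: "(complex \<Rightarrow> complex) \<Rightarrow> complex \<Rightarrow> complex" where
  "bdry_trace u = (SOME g. has_bdry_trace u g)"

definition fourier_coeff :: "(complex \<Rightarrow> complex) \<Rightarrow> int \<Rightarrow> complex" where
  "fourier_coeff g n =
     (1 / (2 * pi)) * (LINT \<beta>|lebesgue_on {0..2 * pi}. g (cis \<beta>) * exp (- (\<i> * of_int n * of_real \<beta>)))"

text \<open>The order \<open>s\<close> is \<open>q - 1/2\<close>, so the weight exponent \<open>2q - 1\<close> is \<open>2s\<close>.\<close>

definition Hs_circle_norm_sq :: "real \<Rightarrow> (complex \<Rightarrow> complex) \<Rightarrow> ennreal" where
  "Hs_circle_norm_sq s g =
     (\<Sum>\<^sub>\<infinity>n\<in>(UNIV :: int set).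
        ennreal ((1 + \<bar>real_of_int n\<bar>) powr (2 * s) * (cmod (fourier_coeff g n))\<^sup>2))"

section \<open>Sequence valued maps\<close>

text \<open>The sequence \<open>\<langle>u\<^sub>0, u\<^sub>-\<^sub>1, u\<^sub>-\<^sub>2, \<dots>\<rangle>\<close> is represented by
  \<open>u :: nat \<Rightarrow> _\<close> with \<open>u j\<close> standing for the component of index \<open>-j\<close>.
  The parameter \<open>p\<close> is the exponent of the weight \<open>(1+j)\<close>; the corresponding
  space is written with superscript \<open>2, p/2\<close> in the literature.\<close>

definition seq_norm_sq ::
    "nat \<Rightarrow> ((complex \<Rightarrow> complex) \<Rightarrow> ennreal) \<Rightarrow> (nat \<Rightarrow> complex \<Rightarrow> complex) \<Rightarrow> ennreal" where
  "seq_norm_sq p N u = (\<Sum>j. ennreal ((1 + real j) ^ p) * N (u j))"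

definition l2_L2 :: "nat \<Rightarrow> (nat \<Rightarrow> complex \<Rightarrow> complex) set" where
  "l2_L2 p = {u. (\<forall>j. u j \<in> L2_space) \<and> seq_norm_sq p L2_norm_sq u < \<infinity>}"

definition l2_H1 :: "nat \<Rightarrow> (nat \<Rightarrow> complex \<Rightarrow> complex) set" where
  "l2_H1 p = {u. (\<forall>j. u j \<in> H1_space) \<and> seq_norm_sq p H1_norm_sq u < \<infinity>}"

definition left_shift :: "(nat \<Rightarrow> 'a) \<Rightarrow> nat \<Rightarrow> 'a" where
  "left_shift u j = u (Suc j)"

definition solves_beltrami ::
    "(nat \<Rightarrow> complex \<Rightarrow> complex) \<Rightarrow> (nat \<Rightarrow> complex \<Rightarrow> complex) \<Rightarrow> bool" where
  "solves_beltrami v w \<longleftrightarrow>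
     (\<forall>j. AE z in lebesgue_on disc.
        weak_dbar (v j) z + (left_shift ^^ 2) (\<lambda>i. weak_d (v i)) j z = w j z)"

end

theory Submission imports Defs begin

text \<open>For a scalar function \<open>u\<close> with boundary Fourier coefficients \<open>g\<^sub>n\<close>, Stokes' theorem shows that
  the squared \<open>L\<^sup>2\<close> norms of \<open>d u\<close> and \<open>dbar u\<close> differ exactly by \<open>\<pi> \<Sum> n |g\<^sub>n|\<^sup>2\<close>, which is at most
  \<open>\<pi>\<close> times the squared \<open>H\<^sup>1\<^sup>/\<^sup>2\<close> norm of the trace. Inserting \<open>dbar v\<^sub>j = w\<^sub>j - d v\<^sub>j\<^sub>+\<^sub>2\<close> and applying
  Young's inequality with parameter \<open>1/(1+j)\<close> bounds \<open>\<parallel>d v\<^sub>j\<parallel>\<^sup>2\<close> by \<open>(1 + 1/(1+j)) \<parallel>d v\<^sub>j\<^sub>+\<^sub>2\<parallel>\<^sup>2\<close> plus data.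
  Multiplied by \<open>(1+j)\<^sup>p\<^sup>+\<^sup>1\<close> and summed over \<open>j\<close>, this telescopes, because the weights grow by enough
  from \<open>j\<close> to \<open>j + 2\<close> to leave \<open>\<Sum> (1+j)\<^sup>p \<parallel>d v\<^sub>j\<parallel>\<^sup>2\<close> on the left. The function itself is controlled by a
  Poincare inequality with boundary term.

  The scalar inequalities are proved for smooth functions and passed to the limit along the
  sequence defining the trace. The limit of the boundary term is the delicate point: it is
  controlled by Bessel's inequality for the orthogonal system \<open>z\<^sup>n\<^sup>-\<^sup>1\<close>, which is the trace theorem into \<open>H\<^sup>1\<^sup>/\<^sup>2\<close>.\<close>

section \<open>Calculus of \<open>C\<^sup>k\<close> functions and Stokes' theorem on the disc\<close>

text \<open>The weights of the theorem come from one exchange. Young's parameter 1/(1+j) costs the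
  factor 2+j on \<open>w\<close>, hence the exponent p+2 there. The telescoping carries the weight
  (1+j)^(p+1), which stays on the boundary term, but its gain from j to j+2 is one power smaller, so
  only the exponent p survives on the left. The telescoping also cancels an infinite tail with
  exponent p+1; the hypothesis on \<open>v\<close> makes this tail finite.

  Squared norms take values in [0, infinity], where subtraction is delicate. Approximation errors
  therefore enter through (x + y)^2 <= (1+t) x^2 + (1 + 1/t) y^2, and they are sent to 0 before t
  is.

  The trace is defined by functions that are smooth on the whole plane and approximate in H^1 up to
  the boundary. Plain convolution would ask for values outside the disc; the dilation in the
  mollifier keeps the kernels inside. As these kernels are test functions, they also yield the
  uniqueness of weak derivatives, which identifies the choice made by
  \<open>weak_deriv\<close>.\<close>

lemma dir_deriv_eqI:
  assumes "(f has_derivative D) (at z)"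
  shows "dir_deriv e f z = D e"
  using frechet_derivative_at[OF assms] by (simp add: dir_deriv_def)

lemma has_derivative_dir_deriv:
  assumes "f differentiable (at z)"
  shows "(f has_derivative (\<lambda>e. dir_deriv e f z)) (at z)"
  using assms frechet_derivative_works[of f "at z"] by (simp add: dir_deriv_def)

text \<open>Continuity does not occur in the successor clause of \<open>C_k\<close>; it is recovered
  from differentiability at the bottom of the recursion, for all directional derivatives at
  once.\<close>

lemma C_k_SucD: "C_k (Suc k) f \<Longrightarrow> C_k k f"
proof (induction k arbitrary: f)
  case 0
  then show ?case
    by (auto intro!: differentiable_imp_continuous_on simp: differentiable_on_def)
next
  case (Suc k)
  then show ?case by (metis C_k.simps(2))
qed

lemma C_k_continuous: "C_k k f \<Longrightarrow> continuous_on UNIV f"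
  by (induction k) (auto dest: C_k_SucD simp del: C_k.simps(2))

lemma C_k_differentiable: "C_k (Suc k) f \<Longrightarrow> f differentiable (at z)"
  by simp

lemma C_k_has_derivative:
  "C_k (Suc k) f \<Longrightarrow> (f has_derivative (\<lambda>e. dir_deriv e f z)) (at z)"
  by (simp add: has_derivative_dir_deriv)

lemma C_k_dir_deriv: "C_k (Suc k) f \<Longrightarrow> C_k k (dir_deriv e f)"
  by simp

lemma C_k_const: "C_k k (\<lambda>_. c)"
proof (induction k arbitrary: c)
  case (Suc k)
  have "dir_deriv e (\<lambda>_. c) = (\<lambda>_. 0)" for e
    by (rule ext, rule dir_deriv_eqI) simp
  then show ?case using Suc by simp
qed simp

lemma C_k_add: "C_k k f \<Longrightarrow> C_k k g \<Longrightarrow> C_k k (\<lambda>z. f z + g z)"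
proof (induction k arbitrary: f g)
  case 0
  then show ?case by (auto intro: continuous_intros)
next
  case (Suc k)
  have "dir_deriv e (\<lambda>z. f z + g z) = (\<lambda>z. dir_deriv e f z + dir_deriv e g z)" for e
    by (rule ext, rule dir_deriv_eqI)
      (intro has_derivative_add C_k_has_derivative[OF Suc.prems(1)] C_k_has_derivative[OF Suc.prems(2)])
  moreover have "C_k k (\<lambda>z. dir_deriv e f z + dir_deriv e g z)" for e
    by (rule Suc.IH[OF C_k_dir_deriv[OF Suc.prems(1)] C_k_dir_deriv[OF Suc.prems(2)]])
  ultimately show ?case using Suc.prems by simp
qed

lemma C_k_bounded_linear:
  assumes L: "bounded_linear L"
  shows "C_k k f \<Longrightarrow> C_k k (\<lambda>z. L (f z))"
proof (induction k arbitrary: f)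
  case 0
  then show ?case using L by (simp add: bounded_linear.continuous_on)
next
  case (Suc k)
  have D: "((\<lambda>z. L (f z)) has_derivative (\<lambda>e. L (dir_deriv e f z))) (at z)" for z
    by (rule bounded_linear.has_derivative[OF L C_k_has_derivative[OF Suc.prems]])
  have "dir_deriv e (\<lambda>z. L (f z)) = (\<lambda>z. L (dir_deriv e f z))" for e
    by (rule ext, rule dir_deriv_eqI[OF D])
  moreover have "C_k k (\<lambda>z. L (dir_deriv e f z))" for e
    by (rule Suc.IH[OF C_k_dir_deriv[OF Suc.prems]])
  moreover have "(\<lambda>z. L (f z)) differentiable (at z)" for z
    by (rule differentiableI[OF D])
  ultimately show ?case by simp
qed

lemma C_k_cmult: "C_k k f \<Longrightarrow> C_k k (\<lambda>z. c * f z)"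
  by (rule C_k_bounded_linear[OF bounded_linear_mult_right])

lemma C_k_cnj: "C_k k f \<Longrightarrow> C_k k (\<lambda>z. cnj (f z))"
  by (rule C_k_bounded_linear[OF bounded_linear_cnj])

lemma C_k_diff: "C_k k f \<Longrightarrow> C_k k g \<Longrightarrow> C_k k (\<lambda>z. f z - g z)"
  using C_k_add[of k f "\<lambda>z. (-1) * g z"] C_k_cmult[of k g "-1"] by simp

lemma C_k_mult: "C_k k f \<Longrightarrow> C_k k g \<Longrightarrow> C_k k (\<lambda>z. f z * g z)"
proof (induction k arbitrary: f g)
  case 0
  then show ?case by (auto intro: continuous_intros)
next
  case (Suc k)
  have D: "((\<lambda>z. f z * g z) has_derivative (\<lambda>e. f z * dir_deriv e g z + dir_deriv e f z * g z)) (at z)" for z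
    by (intro has_derivative_mult C_k_has_derivative[OF Suc.prems(1)] C_k_has_derivative[OF Suc.prems(2)])
  have "dir_deriv e (\<lambda>z. f z * g z) = (\<lambda>z. f z * dir_deriv e g z + dir_deriv e f z * g z)" for e
    by (rule ext, rule dir_deriv_eqI[OF D])
  moreover have "C_k k (\<lambda>z. f z * dir_deriv e g z + dir_deriv e f z * g z)" for e
    by (rule C_k_add[OF Suc.IH[OF C_k_SucD[OF Suc.prems(1)] C_k_dir_deriv[OF Suc.prems(2)]]
          Suc.IH[OF C_k_dir_deriv[OF Suc.prems(1)] C_k_SucD[OF Suc.prems(2)]]])
  moreover have "(\<lambda>z. f z * g z) differentiable (at z)" for z
    by (rule differentiableI[OF D])
  ultimately show ?case by simp
qed

lemma C_k_ident: "C_k k (\<lambda>z. z)"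
proof (cases k)
  case (Suc n)
  have "dir_deriv e (\<lambda>z. z) = (\<lambda>_. e)" for e
    by (rule ext, rule dir_deriv_eqI) simp
  then show ?thesis using Suc by (simp add: C_k_const)
qed simp

lemma C_k_power: "C_k k f \<Longrightarrow> C_k k (\<lambda>z. f z ^ n)"
  by (induction n) (simp_all add: C_k_const C_k_mult)

lemma C_k_affine: "C_k k f \<Longrightarrow> C_k k (\<lambda>z. f (a + c * z))"
proof (induction k arbitrary: f)
  case 0
  then have "continuous_on UNIV (\<lambda>z. f (a + c * z))"
    by (intro continuous_on_compose2[of UNIV f UNIV "\<lambda>z. a + c * z"] continuous_intros) auto
  then show ?case by simp
next
  case (Suc k)
  have D: "((\<lambda>z. f (a + c * z)) has_derivative (\<lambda>e. dir_deriv (c * e) f (a + c * z))) (at z)" for z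
    by (rule has_derivative_compose[where g=f and f="\<lambda>z. a + c * z" and f'="\<lambda>e. c * e"])
      (auto intro!: derivative_eq_intros C_k_has_derivative[OF Suc.prems])
  have "dir_deriv e (\<lambda>z. f (a + c * z)) = (\<lambda>z. dir_deriv (c * e) f (a + c * z))" for e
    by (rule ext, rule dir_deriv_eqI[OF D])
  moreover have "C_k k (\<lambda>z. dir_deriv (c * e) f (a + c * z))" for e
    by (rule Suc.IH[OF C_k_dir_deriv[OF Suc.prems]])
  moreover have "(\<lambda>z. f (a + c * z)) differentiable (at z)" for z
    by (rule differentiableI[OF D])
  ultimately show ?case by simp
qed

section \<open>Fubini's theorem on the plane, integrals over the disc and the circle\<close>

lemma lborel_complex:
  "(lborel :: complex measure) = distr (lborel \<Otimes>\<^sub>M lborel) borel (\<lambda>(x, y). Complex x y)"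
proof (rule lborel_eqI)
  fix l u :: complex
  assume le: "\<And>b. b \<in> Basis \<Longrightarrow> l \<bullet> b \<le> u \<bullet> b"
  have le': "Re l \<le> Re u" "Im l \<le> Im u"
    using le[of 1] le[of \<i>] by (auto simp: Basis_complex_def)
  have m: "(\<lambda>(x, y). Complex x y) \<in> borel_measurable (lborel \<Otimes>\<^sub>M lborel)"
    unfolding lborel_prod
    by (simp add: case_prod_beta' Complex_eq) (intro borel_measurable_continuous_onI continuous_intros)
  have vim: "(\<lambda>(x, y). Complex x y) -` box l u = {Re l<..<Re u} \<times> {Im l<..<Im u}"
    by (auto simp: in_box_complex_iff)
  show "emeasure (distr (lborel \<Otimes>\<^sub>M lborel) borel (\<lambda>(x, y). Complex x y)) (box l u)
      = ennreal (\<Prod>b\<in>Basis. (u - l) \<bullet> b)"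
    using le' by (subst emeasure_distr[OF m])
      (auto simp: vim space_pair_measure lborel.emeasure_pair_measure_Times Basis_complex_def
        ennreal_mult[symmetric])
qed simp

lemma Complex_measurable [measurable]:
  "(\<lambda>p. Complex (fst p) (snd p)) \<in> borel_measurable (lborel \<Otimes>\<^sub>M lborel)"
  unfolding lborel_prod
  by (simp add: Complex_eq) (intro borel_measurable_continuous_onI continuous_intros)

text \<open>Both orders of iteration are wanted: the derivative in x is integrated along horizontal
  chords first, the derivative in y along vertical ones.\<close>

lemma
  fixes f :: "complex \<Rightarrow> 'a::{banach, second_countable_topology}"
  assumes f: "integrable lborel f"
  shows lborel_complex_integral_Re_Im: "(LINT z|lborel. f z) = (LINT x|lborel. (LINT y|lborel. f (Complex x y)))"
    and lborel_complex_integral_Im_Re: "(LINT z|lborel. f z) = (LINT y|lborel. (LINT x|lborel. f (Complex x y)))"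
proof -
  have [measurable]: "f \<in> borel_measurable borel" using f by auto
  have i: "integrable (lborel \<Otimes>\<^sub>M lborel) (\<lambda>(x, y). f (Complex x y))"
    using f unfolding lborel_complex
    by (subst (asm) integrable_distr_eq) (auto simp: case_prod_beta case_prod_beta')
  have "(LINT z|lborel. f z) = (LINT p|(lborel \<Otimes>\<^sub>M lborel). f (Complex (fst p) (snd p)))"
    by (subst lborel_complex, subst integral_distr) (auto simp: case_prod_beta)
  then have e: "(LINT z|lborel. f z) = (LINT p|(lborel \<Otimes>\<^sub>M lborel). case_prod (\<lambda>x y. f (Complex x y)) p)"
    by (simp add: case_prod_beta)
  show "(LINT z|lborel. f z) = (LINT x|lborel. (LINT y|lborel. f (Complex x y)))"
    unfolding e by (rule lborel_pair.integral_fst'[OF i, symmetric, simplified])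
  show "(LINT z|lborel. f z) = (LINT y|lborel. (LINT x|lborel. f (Complex x y)))"
    unfolding e by (rule lborel_pair.integral_snd[OF i, symmetric])
qed

lemma disc_integrable_continuous:
  fixes f :: "complex \<Rightarrow> 'a::{banach, second_countable_topology}"
  assumes "continuous_on UNIV f"
  shows "integrable (lebesgue_on disc) f" and "integrable lborel (\<lambda>z. indicator disc z *\<^sub>R f z)"
proof -
  have "set_integrable lborel (cball 0 1) f"
    unfolding set_integrable_def
    by (rule borel_integrable_compact) (auto intro: continuous_on_subset[OF assms])
  then have s: "set_integrable lborel disc f"
    by (rule set_integrable_subset) auto
  then show "integrable lborel (\<lambda>z. indicator disc z *\<^sub>R f z)"
    by (simp add: set_integrable_def)
  with s show "integrable (lebesgue_on disc) f"
    by (subst integrable_restrict_space) (auto simp: set_integrable_def simp: integrable_completion)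
qed

lemma disc_integral_lborel:
  fixes f :: "complex \<Rightarrow> 'a::{banach, second_countable_topology}"
  assumes [measurable]: "f \<in> borel_measurable borel"
  shows "(LINT z|lebesgue_on disc. f z) = (LINT z|lborel. indicator disc z *\<^sub>R f z)"
proof -
  have "(LINT z|lebesgue_on disc. f z) = (LINT z|lebesgue. indicator disc z *\<^sub>R f z)"
    by (rule integral_restrict_space) simp
  also have "\<dots> = (LINT z|lborel. indicator disc z *\<^sub>R f z)"
    by (intro integral_completion borel_measurable_scaleR borel_measurable_indicator) (use assms in auto)
  finally show ?thesis .
qed

lemma disc_nn_integral_lborel:
  "(\<integral>\<^sup>+z. f z \<partial>lebesgue_on disc) = (\<integral>\<^sup>+z. f z * indicator disc z \<partial>lborel)"
  by (subst nn_integral_restrict_space) (auto simp: nn_integral_completion)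

lemma circle_integral_interval:
  fixes f :: "real \<Rightarrow> 'a::{banach, second_countable_topology}"
  assumes "continuous_on UNIV f"
  shows "(LINT t|lebesgue_on {0..2 * pi}. f t) = (LBINT t=0..2 * pi. f t)"
proof -
  have "f \<in> borel_measurable borel"
    using assms by (rule borel_measurable_continuous_onI)
  then have "(LINT t|lebesgue_on {0..2 * pi}. f t) = (LINT t|lborel. indicator {0..2 * pi} t *\<^sub>R f t)"
    by (subst integral_restrict_space) (auto intro!: integral_completion)
  also have "\<dots> = (LBINT t=0..2 * pi. f t)"
    by (simp add: zero_ereal_def interval_integral_Icc set_lebesgue_integral_def)
  finally show ?thesis .
qed

text \<open>The chord \<open>S\<close> is given by inequalities on its points because this is how
  \<open>Complex_in_disc_iff\<close> describes a slice of the disc.\<close>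

lemma LBINT_ftc_indicator:
  fixes G :: "real \<Rightarrow> complex"
  assumes s: "0 \<le> s" and S: "\<And>y. y \<in> S \<longleftrightarrow> -s < y \<and> y < s"
    and G: "\<And>y. (G has_vector_derivative g y) (at y)" and g: "continuous_on UNIV g"
  shows "(LINT y|lborel. indicator S y *\<^sub>R g y) = G s - G (-s)"
proof -
  have "S = {-s<..<s}" unfolding set_eq_iff S by simp
  then have "(LINT y|lborel. indicator S y *\<^sub>R g y) = (LBINT y=-s..s. g y)"
    using s by (simp add: interval_lebesgue_integral_def set_lebesgue_integral_def)
  also have "\<dots> = G s - G (-s)"
    by (rule interval_integral_FTC_finite)
      (simp_all add: continuous_on_subset[OF g] has_vector_derivative_at_within[OF G])
  finally show ?thesis .
qed

text \<open>Splitting off the range of the outer variable turns the outer integral into one over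
  (-1, 1); the remaining factor is the indicator of a chord.\<close>

lemma disc_indicator_Complex:
  "indicator disc (Complex x y) = indicator {-1<..<1} x * (indicator {y. Complex x y \<in> disc} y :: real)"
  "indicator disc (Complex x y) = indicator {-1<..<1} y * (indicator {x. Complex x y \<in> disc} x :: real)"
proof -
  have "\<bar>x\<bar> < 1 \<and> \<bar>y\<bar> < 1" if "Complex x y \<in> disc"
    using that abs_Re_le_cmod[of "Complex x y"] abs_Im_le_cmod[of "Complex x y"] by auto
  then show "indicator disc (Complex x y) = indicator {-1<..<1} x * (indicator {y. Complex x y \<in> disc} y :: real)"
    "indicator disc (Complex x y) = indicator {-1<..<1} y * (indicator {x. Complex x y \<in> disc} x :: real)"
    by (auto simp: indicator_def abs_less_iff split: if_splits)
qed

text \<open>No restriction on x or y is needed to make this true: \<open>sqrt\<close> is odd, so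
  outside [-1, 1] the half-length is negative and the inequalities describe the empty slice.\<close>

lemma Complex_in_disc_iff:
  "Complex x y \<in> disc \<longleftrightarrow> - sqrt (1 - x\<^sup>2) < y \<and> y < sqrt (1 - x\<^sup>2)"
  "Complex x y \<in> disc \<longleftrightarrow> - sqrt (1 - y\<^sup>2) < x \<and> x < sqrt (1 - y\<^sup>2)"
proof -
  have "Complex x y \<in> disc \<longleftrightarrow> x\<^sup>2 + y\<^sup>2 < 1"
    by (simp add: cmod_def)
  moreover have "x\<^sup>2 + y\<^sup>2 < 1 \<longleftrightarrow> \<bar>y\<bar> < sqrt (1 - x\<^sup>2)"
    using real_less_rsqrt[of "\<bar>y\<bar>" "1 - x\<^sup>2"] real_sqrt_less_iff[of "y\<^sup>2" "1 - x\<^sup>2"] by auto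
  moreover have "x\<^sup>2 + y\<^sup>2 < 1 \<longleftrightarrow> \<bar>x\<bar> < sqrt (1 - y\<^sup>2)"
    using real_less_rsqrt[of "\<bar>x\<bar>" "1 - y\<^sup>2"] real_sqrt_less_iff[of "x\<^sup>2" "1 - y\<^sup>2"] by auto
  ultimately show "Complex x y \<in> disc \<longleftrightarrow> - sqrt (1 - x\<^sup>2) < y \<and> y < sqrt (1 - x\<^sup>2)"
     "Complex x y \<in> disc \<longleftrightarrow> - sqrt (1 - y\<^sup>2) < x \<and> x < sqrt (1 - y\<^sup>2)"
    by (auto simp: abs_less_iff)
qed

section \<open>Stokes' theorem by slicing the disc into chords\<close>

lemma has_vector_derivative_dir_deriv:
  assumes "f differentiable (at (g t))" and "(g has_vector_derivative e) (at t)"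
  shows "((\<lambda>t. f (g t)) has_vector_derivative dir_deriv e f (g t)) (at t)"
proof -
  have D: "(f has_derivative (\<lambda>e. dir_deriv e f (g t))) (at (g t))"
    by (rule has_derivative_dir_deriv[OF assms(1)])
  then have "linear (\<lambda>e. dir_deriv e f (g t))"
    using has_derivative_linear by blast
  then show ?thesis
    using has_derivative_compose[OF assms(2)[unfolded has_vector_derivative_def] D]
    by (simp add: has_vector_derivative_def linear_scale[of "\<lambda>e. dir_deriv e f (g t)"])
qed

text \<open>On each vertical chord the fundamental theorem of calculus leaves the value at the upper
  end minus the value at the lower end, that is, on the two half circles.\<close>

lemma disc_integral_deriv_y:
  assumes F: "C_k 1 F"
  shows "(LINT z|lebesgue_on disc. dir_deriv \<i> F z) =
    (LBINT x=-1..1. F (Complex x (sqrt (1 - x\<^sup>2)))) - (LBINT x=-1..1. F (Complex x (- sqrt (1 - x\<^sup>2))))"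
proof -
  have cd: "continuous_on UNIV (dir_deriv \<i> F)" and cF: "continuous_on UNIV F"
    using F C_k_continuous[OF F] by auto
  have vd: "((\<lambda>y. F (Complex x y)) has_vector_derivative dir_deriv \<i> F (Complex x y)) (at y)" for x y
    by (rule has_vector_derivative_dir_deriv)
      (use F in \<open>auto simp: Complex_eq has_vector_derivative_def scaleR_conv_of_real mult.commute intro!: derivative_eq_intros\<close>)
  have cdy: "continuous_on UNIV (\<lambda>y. dir_deriv \<i> F (Complex x y))" for x
    by (rule continuous_on_compose2[OF cd]) (auto simp: Complex_eq intro!: continuous_intros)
  have inner: "(LINT y|lborel. indicator disc (Complex x y) *\<^sub>R dir_deriv \<i> F (Complex x y)) =
     indicator {-1<..<1} x *\<^sub>R (F (Complex x (sqrt (1 - x\<^sup>2))) - F (Complex x (- sqrt (1 - x\<^sup>2))))" for x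
  proof (cases "x \<in> {-1<..<1}")
    case True
    then have "0 \<le> 1 - x\<^sup>2" by (simp add: abs_square_le_1 abs_le_iff)
    then have "(LINT y|lborel. indicator {y. Complex x y \<in> disc} y *\<^sub>R dir_deriv \<i> F (Complex x y))
       = F (Complex x (sqrt (1 - x\<^sup>2))) - F (Complex x (- sqrt (1 - x\<^sup>2)))"
      by (intro LBINT_ftc_indicator vd cdy) (auto simp only: mem_Collect_eq Complex_in_disc_iff(1) real_sqrt_ge_zero)
    with True show ?thesis by (simp only: disc_indicator_Complex(1)) simp
  qed (simp only: disc_indicator_Complex(1), simp)
  have cb: "continuous_on UNIV (\<lambda>x. F (Complex x (sqrt (1 - x\<^sup>2))))"
    "continuous_on UNIV (\<lambda>x. F (Complex x (- sqrt (1 - x\<^sup>2))))"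
    by (auto intro!: continuous_on_compose2[OF cF] simp: Complex_eq intro!: continuous_intros)
  then have ii: "interval_lebesgue_integrable lborel (-1) 1 (\<lambda>x. F (Complex x (sqrt (1 - x\<^sup>2))))"
    "interval_lebesgue_integrable lborel (-1) 1 (\<lambda>x. F (Complex x (- sqrt (1 - x\<^sup>2))))"
    using interval_integrable_continuous_on[of "-1" 1] by (auto simp: one_ereal_def intro: continuous_on_subset)
  have "(LINT z|lebesgue_on disc. dir_deriv \<i> F z) =
      (LINT x|lborel. indicator {-1<..<1} x *\<^sub>R (F (Complex x (sqrt (1 - x\<^sup>2))) - F (Complex x (- sqrt (1 - x\<^sup>2)))))"
    by (subst disc_integral_lborel[OF borel_measurable_continuous_onI[OF cd]],
      subst lborel_complex_integral_Re_Im[OF disc_integrable_continuous(2)[OF cd]], subst inner) (rule refl)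
  also have "\<dots> = (LBINT x=-1..1. F (Complex x (sqrt (1 - x\<^sup>2))) - F (Complex x (- sqrt (1 - x\<^sup>2))))"
    by (simp add: interval_lebesgue_integral_def set_lebesgue_integral_def one_ereal_def)
  also have "\<dots> = (LBINT x=-1..1. F (Complex x (sqrt (1 - x\<^sup>2)))) - (LBINT x=-1..1. F (Complex x (- sqrt (1 - x\<^sup>2))))"
    by (rule interval_lebesgue_integral_diff(2)[OF ii])
  finally show ?thesis .
qed

lemma disc_integral_deriv_x:
  assumes F: "C_k 1 F"
  shows "(LINT z|lebesgue_on disc. dir_deriv 1 F z) =
    (LBINT y=-1..1. F (Complex (sqrt (1 - y\<^sup>2)) y)) - (LBINT y=-1..1. F (Complex (- sqrt (1 - y\<^sup>2)) y))"
proof -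
  have cd: "continuous_on UNIV (dir_deriv 1 F)" and cF: "continuous_on UNIV F"
    using F C_k_continuous[OF F] by auto
  have vd: "((\<lambda>x. F (Complex x y)) has_vector_derivative dir_deriv 1 F (Complex x y)) (at x)" for x y
    by (rule has_vector_derivative_dir_deriv)
      (use F in \<open>auto simp: Complex_eq has_vector_derivative_def scaleR_conv_of_real intro!: derivative_eq_intros\<close>)
  have cdy: "continuous_on UNIV (\<lambda>x. dir_deriv 1 F (Complex x y))" for y
    by (rule continuous_on_compose2[OF cd]) (auto simp: Complex_eq intro!: continuous_intros)
  have inner: "(LINT x|lborel. indicator disc (Complex x y) *\<^sub>R dir_deriv 1 F (Complex x y)) =
     indicator {-1<..<1} y *\<^sub>R (F (Complex (sqrt (1 - y\<^sup>2)) y) - F (Complex (- sqrt (1 - y\<^sup>2)) y))" for y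
  proof (cases "y \<in> {-1<..<1}")
    case True
    then have "0 \<le> 1 - y\<^sup>2" by (simp add: abs_square_le_1 abs_le_iff)
    then have "(LINT x|lborel. indicator {x. Complex x y \<in> disc} x *\<^sub>R dir_deriv 1 F (Complex x y))
       = F (Complex (sqrt (1 - y\<^sup>2)) y) - F (Complex (- sqrt (1 - y\<^sup>2)) y)"
      by (intro LBINT_ftc_indicator vd cdy) (auto simp only: mem_Collect_eq Complex_in_disc_iff(2) real_sqrt_ge_zero)
    with True show ?thesis by (simp only: disc_indicator_Complex(2)) simp
  qed (simp only: disc_indicator_Complex(2), simp)
  have cb: "continuous_on UNIV (\<lambda>y. F (Complex (sqrt (1 - y\<^sup>2)) y))"
    "continuous_on UNIV (\<lambda>y. F (Complex (- sqrt (1 - y\<^sup>2)) y))"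
    by (auto intro!: continuous_on_compose2[OF cF] simp: Complex_eq intro!: continuous_intros)
  then have ii: "interval_lebesgue_integrable lborel (-1) 1 (\<lambda>y. F (Complex (sqrt (1 - y\<^sup>2)) y))"
    "interval_lebesgue_integrable lborel (-1) 1 (\<lambda>y. F (Complex (- sqrt (1 - y\<^sup>2)) y))"
    using interval_integrable_continuous_on[of "-1" 1] by (auto simp: one_ereal_def intro: continuous_on_subset)
  have "(LINT z|lebesgue_on disc. dir_deriv 1 F z) =
      (LINT y|lborel. indicator {-1<..<1} y *\<^sub>R (F (Complex (sqrt (1 - y\<^sup>2)) y) - F (Complex (- sqrt (1 - y\<^sup>2)) y)))"
    by (subst disc_integral_lborel[OF borel_measurable_continuous_onI[OF cd]],
      subst lborel_complex_integral_Im_Re[OF disc_integrable_continuous(2)[OF cd]], subst inner) (rule refl)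
  also have "\<dots> = (LBINT y=-1..1. F (Complex (sqrt (1 - y\<^sup>2)) y) - F (Complex (- sqrt (1 - y\<^sup>2)) y))"
    by (simp add: interval_lebesgue_integral_def set_lebesgue_integral_def one_ereal_def)
  also have "\<dots> = (LBINT y=-1..1. F (Complex (sqrt (1 - y\<^sup>2)) y)) - (LBINT y=-1..1. F (Complex (- sqrt (1 - y\<^sup>2)) y))"
    by (rule interval_lebesgue_integral_diff(2)[OF ii])
  finally show ?thesis .
qed

text \<open>Both halves of the circle are traversed with the substitution \<open>x = cos t\<close>
  (\<open>y = sin t\<close> in the other direction), whose orientation produces the sign.\<close>

lemma stokes_y:
  assumes F: "C_k 1 F"
  shows "(LINT z|lebesgue_on disc. dir_deriv \<i> F z) = (LINT t|lebesgue_on {0..2 * pi}. F (cis t) * sin t)"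
proof -
  have cF: "continuous_on UNIV F" using C_k_continuous[OF F] .
  have cc: "continuous_on UNIV (\<lambda>t. F (cis t) * sin t)"
    by (intro continuous_intros continuous_on_compose2[OF cF]) auto
  have cb: "continuous_on UNIV (\<lambda>x. F (Complex x (sqrt (1 - x\<^sup>2))))"
    "continuous_on UNIV (\<lambda>x. F (Complex x (- sqrt (1 - x\<^sup>2))))"
    by (auto intro!: continuous_on_compose2[OF cF] simp: Complex_eq intro!: continuous_intros)
  have u: "(LBINT t=0..pi. (- sin t) *\<^sub>R F (Complex (cos t) (sqrt (1 - (cos t)\<^sup>2)))) =
      (LBINT x=cos 0..cos pi. F (Complex x (sqrt (1 - x\<^sup>2))))"
    unfolding zero_ereal_def
    by (rule interval_integral_substitution_finite)
     (auto intro!: derivative_eq_intros continuous_intros continuous_on_subset[OF cb(1)])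
  have l: "(LBINT t=pi..2*pi. (- sin t) *\<^sub>R F (Complex (cos t) (- sqrt (1 - (cos t)\<^sup>2)))) =
      (LBINT x=cos pi..cos (2*pi). F (Complex x (- sqrt (1 - x\<^sup>2))))"
    by (rule interval_integral_substitution_finite)
     (auto intro!: derivative_eq_intros continuous_intros continuous_on_subset[OF cb(2)])
  have u': "(LBINT t=0..pi. (- sin t) *\<^sub>R F (Complex (cos t) (sqrt (1 - (cos t)\<^sup>2)))) =
      - (LBINT t=0..pi. F (cis t) * sin t)"
    unfolding interval_lebesgue_integral_uminus[symmetric] zero_ereal_def
    by (rule interval_integral_cong)
      (auto simp: einterval_def sin_squared_eq[symmetric] sin_ge_zero cis.code scaleR_conv_of_real)
  have l': "(LBINT t=pi..2*pi. (- sin t) *\<^sub>R F (Complex (cos t) (- sqrt (1 - (cos t)\<^sup>2)))) =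
      - (LBINT t=pi..2*pi. F (cis t) * sin t)"
    unfolding interval_lebesgue_integral_uminus[symmetric]
    by (rule interval_integral_cong)
      (auto simp: einterval_def sin_squared_eq[symmetric] sin_le_zero cis.code scaleR_conv_of_real)
  have "(LBINT t=0..pi. F (cis t) * sin t) + (LBINT t=pi..2*pi. F (cis t) * sin t) = (LBINT t=0..2*pi. F (cis t) * sin t)"
    unfolding zero_ereal_def
    by (rule interval_integral_sum) (auto intro!: interval_integrable_continuous_on continuous_on_subset[OF cc])
  moreover have "(LBINT x=1..-1. F (Complex x (sqrt (1 - x\<^sup>2)))) = - (LBINT x=-1..1. F (Complex x (sqrt (1 - x\<^sup>2))))"
    by (rule interval_integral_endpoints_reverse)
  ultimately show ?thesis
    unfolding disc_integral_deriv_y[OF F] circle_integral_interval[OF cc]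
    using u l u' l' by (simp add: one_ereal_def algebra_simps)
qed

lemma stokes_x:
  assumes F: "C_k 1 F"
  shows "(LINT z|lebesgue_on disc. dir_deriv 1 F z) = (LINT t|lebesgue_on {0..2 * pi}. F (cis t) * cos t)"
proof -
  have cF: "continuous_on UNIV F" using C_k_continuous[OF F] .
  have cc: "continuous_on UNIV (\<lambda>t. F (cis t) * cos t)"
    by (intro continuous_intros continuous_on_compose2[OF cF]) auto
  have cb: "continuous_on UNIV (\<lambda>y. F (Complex (sqrt (1 - y\<^sup>2)) y))"
    "continuous_on UNIV (\<lambda>y. F (Complex (- sqrt (1 - y\<^sup>2)) y))"
    by (auto intro!: continuous_on_compose2[OF cF] simp: Complex_eq intro!: continuous_intros)
  have sub: "(LBINT t=a..b. cos t *\<^sub>R g (sin t)) = (LBINT y=sin a..sin b. g y)"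
    if "a \<le> b" "continuous_on UNIV g" for a b :: real and g :: "real \<Rightarrow> complex"
    by (rule interval_integral_substitution_finite)
     (auto intro!: derivative_eq_intros continuous_intros continuous_on_subset[OF that(2)] that(1))
  \<comment> \<open>\<sigma> is the sign of cos on the arc; it turns the nonnegative root of 1 -
    sin^2 back into cos.\<close>
  have cong: "(LBINT t=a..b. cos t *\<^sub>R F (Complex (\<sigma> * sqrt (1 - (sin t)\<^sup>2)) (sin t))) = (LBINT t=a..b. F (cis t) * cos t)"
    if "\<And>t. a < t \<Longrightarrow> t < b \<Longrightarrow> \<sigma> * \<bar>cos t\<bar> = cos t" "a \<le> b" for a b \<sigma> :: real
    by (rule interval_integral_cong)
      (use that in \<open>auto simp: einterval_def cos_squared_eq[symmetric] cis.code scaleR_conv_of_real\<close>)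
  have s1: "sin (3 * pi / 2) = -1"
    using sin_periodic_pi[of "pi / 2"] by (simp add: field_simps)
  have cos_neg: "cos t < 0" if "pi / 2 < t" "t < 3 * pi / 2" for t
    using cos_gt_zero_pi[of "t - pi"] that by (simp add: cos_diff field_simps)
  have cos_pos: "cos t > 0" if "3 * pi / 2 < t" "t < 2 * pi" for t
    using cos_gt_zero_pi[of "t - 2 * pi"] that by (simp add: cos_diff field_simps)
  have c1: "1 * \<bar>cos t\<bar> = cos t" if "0 < t" "t < pi / 2" for t
    using cos_gt_zero[OF that] by simp
  have c2: "- 1 * \<bar>cos t\<bar> = cos t" if "pi / 2 < t" "t < 3 * pi / 2" for t
    using cos_neg[OF that] by simp
  have c3: "1 * \<bar>cos t\<bar> = cos t" if "3 * pi / 2 < t" "t < 2 * pi" for t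
    using cos_pos[OF that] by simp
  \<comment> \<open>The right half circle contains the starting angle 0 in its interior, so it
    appears as two arcs, [0, pi/2] and [3pi/2, 2pi], around the left half.\<close>
  have r1: "(LBINT t=0..pi/2. F (cis t) * cos t) = (LBINT y=0..1. F (Complex (sqrt (1 - y\<^sup>2)) y))"
    using sub[OF _ cb(1), of 0 "pi / 2"] cong[of 0 "pi / 2" 1, OF c1]
    by (simp add: zero_ereal_def one_ereal_def)
  have l: "(LBINT t=pi/2..3*pi/2. F (cis t) * cos t) = (LBINT y=1..-1. F (Complex (- sqrt (1 - y\<^sup>2)) y))"
    using sub[OF _ cb(2), of "pi / 2" "3 * pi / 2"] cong[of "pi / 2" "3 * pi / 2" "- 1", OF c2]
    by (simp add: s1 one_ereal_def)
  have r2: "(LBINT t=3*pi/2..2*pi. F (cis t) * cos t) = (LBINT y=-1..0. F (Complex (sqrt (1 - y\<^sup>2)) y))"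
    using sub[OF _ cb(1), of "3 * pi / 2" "2 * pi"] cong[of "3 * pi / 2" "2 * pi" 1, OF c3]
    by (simp add: s1 zero_ereal_def one_ereal_def)
  have t1: "(LBINT t=0..pi/2. F (cis t) * cos t) + (LBINT t=pi/2..3*pi/2. F (cis t) * cos t) = (LBINT t=0..3*pi/2. F (cis t) * cos t)"
    unfolding zero_ereal_def
    by (rule interval_integral_sum) (auto intro!: interval_integrable_continuous_on continuous_on_subset[OF cc])
  have t2: "(LBINT t=0..3*pi/2. F (cis t) * cos t) + (LBINT t=3*pi/2..2*pi. F (cis t) * cos t) = (LBINT t=0..2*pi. F (cis t) * cos t)"
    unfolding zero_ereal_def
    by (rule interval_integral_sum) (auto intro!: interval_integrable_continuous_on continuous_on_subset[OF cc])
  have t3: "(LBINT y=-1..0. F (Complex (sqrt (1 - y\<^sup>2)) y)) + (LBINT y=0..1. F (Complex (sqrt (1 - y\<^sup>2)) y)) =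
     (LBINT y=-1..1. F (Complex (sqrt (1 - y\<^sup>2)) y))"
    using interval_integrable_continuous_on[OF _ continuous_on_subset[OF cb(1)], of "-1" 1]
    by (intro interval_integral_sum) (auto simp: zero_ereal_def one_ereal_def)
  have "(LBINT x=1..-1. F (Complex (- sqrt (1 - x\<^sup>2)) x)) = - (LBINT x=-1..1. F (Complex (- sqrt (1 - x\<^sup>2)) x))"
    by (rule interval_integral_endpoints_reverse)
  then show ?thesis
    unfolding disc_integral_deriv_x[OF F] circle_integral_interval[OF cc] t2[symmetric] t1[symmetric] r1 l r2
    using t3 by (simp add: algebra_simps)
qed

section \<open>Linearity in the direction and symmetry of second derivatives\<close>

lemma dir_deriv_linear:
  assumes "f differentiable (at z)"
  shows "linear (\<lambda>e. dir_deriv e f z)"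
  using has_derivative_linear[OF has_derivative_dir_deriv[OF assms]] .

lemma dir_deriv_Complex:
  assumes "f differentiable (at z)"
  shows "dir_deriv (Complex a b) f z = a * dir_deriv 1 f z + b * dir_deriv \<i> f z"
proof -
  interpret linear "\<lambda>e. dir_deriv e f z" by (rule dir_deriv_linear[OF assms])
  have "Complex a b = a *\<^sub>R 1 + b *\<^sub>R \<i>" by (simp add: complex_eq_iff)
  then show ?thesis by (simp only: add scale) (simp add: scaleR_conv_of_real)
qed

text \<open>Schwarz's theorem. Write f(x, y) as f(x, y0) plus the integral over [y0, y] of its
  derivative in y, differentiate in x under the integral sign, then differentiate the result in
  y.\<close>

lemma dir_deriv_commute:
  assumes f: "C_k 2 f"
  shows "dir_deriv 1 (dir_deriv \<i> f) z = dir_deriv \<i> (dir_deriv 1 f) z"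
proof -
  have f2: "C_k (Suc (Suc 0)) f" and f1: "C_k (Suc 0) f"
    using f C_k_SucD[of 1 f] by (auto simp: numeral_2_eq_2)
  have fi: "C_k (Suc 0) (dir_deriv \<i> f)" "C_k (Suc 0) (dir_deriv 1 f)"
    using f2 by (auto intro: C_k_dir_deriv)
  define x0 y0 where "x0 = Re z" and "y0 = Im z"
  have z: "z = Complex x0 y0" by (simp add: x0_def y0_def)
  define h where "h = dir_deriv 1 (dir_deriv \<i> f)"
  have ch: "continuous_on UNIV h"
    unfolding h_def using fi(1) C_k_continuous[of 0] by auto
  have ci: "continuous_on UNIV (dir_deriv \<i> f)"
    using C_k_continuous[OF fi(1)] .
  have ci': "continuous_on A (\<lambda>y. dir_deriv \<i> f (Complex x y))" for x A
    by (rule continuous_on_compose2[OF ci]) (auto simp: Complex_eq intro!: continuous_intros)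
  have ch': "continuous_on A (\<lambda>y. h (Complex x y))" for x A
    by (rule continuous_on_compose2[OF ch]) (auto simp: Complex_eq intro!: continuous_intros)
  have vy: "((\<lambda>y. Complex x y) has_vector_derivative \<i>) (at y)" for x y
    by (auto simp: Complex_eq has_vector_derivative_def scaleR_conv_of_real mult.commute intro!: derivative_eq_intros)
  have vx: "((\<lambda>x. Complex x y) has_vector_derivative 1) (at x)" for x y
    by (auto simp: Complex_eq has_vector_derivative_def scaleR_conv_of_real intro!: derivative_eq_intros)
  have ftc: "f (Complex x y) = f (Complex x y0) + integral (cbox y0 y) (\<lambda>t. dir_deriv \<i> f (Complex x t))"
    if "y0 \<le> y" for x y
  proof -
    have "((\<lambda>t. dir_deriv \<i> f (Complex x t)) has_integral f (Complex x y) - f (Complex x y0)) {y0..y}"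
      using that
      by (rule fundamental_theorem_of_calculus)
       (rule has_vector_derivative_at_within, rule has_vector_derivative_dir_deriv[OF C_k_differentiable[OF f1] vy])
    then have "integral (cbox y0 y) (\<lambda>t. dir_deriv \<i> f (Complex x t)) = f (Complex x y) - f (Complex x y0)"
      by (simp add: integral_unique)
    then show ?thesis by simp
  qed
  have dx: "dir_deriv 1 f (Complex x0 y) = dir_deriv 1 f (Complex x0 y0) + integral {y0..y} (\<lambda>t. h (Complex x0 t))"
    if y: "y0 \<le> y" for y
  proof -
    have "((\<lambda>x. integral (cbox y0 y) (\<lambda>t. dir_deriv \<i> f (Complex x t))) has_vector_derivative
       integral (cbox y0 y) (\<lambda>t. h (Complex x0 t))) (at x0)"
    proof (rule leibniz_rule_vector_derivative[where U=UNIV])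
      show "((\<lambda>x. dir_deriv \<i> f (Complex x t)) has_vector_derivative h (Complex x t)) (at x)" for x t
        unfolding h_def by (rule has_vector_derivative_dir_deriv[OF C_k_differentiable[OF fi(1)] vx])
      show "(\<lambda>t. dir_deriv \<i> f (Complex x t)) integrable_on cbox y0 y" for x
        by (simp add: integrable_continuous_interval[OF ci'])
      show "continuous_on (UNIV \<times> cbox y0 y) (\<lambda>(x, t). h (Complex x t))"
        unfolding case_prod_beta
        by (rule continuous_on_compose2[OF ch]) (auto simp: Complex_eq intro!: continuous_intros)
    qed auto
    moreover have "((\<lambda>x. f (Complex x y0)) has_vector_derivative dir_deriv 1 f (Complex x0 y0)) (at x0)"
      by (rule has_vector_derivative_dir_deriv[OF C_k_differentiable[OF f1] vx])
    ultimately have "((\<lambda>x. f (Complex x y)) has_vector_derivative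
         dir_deriv 1 f (Complex x0 y0) + integral (cbox y0 y) (\<lambda>t. h (Complex x0 t))) (at x0)"
      unfolding ftc[OF y] by (intro has_vector_derivative_add)
    moreover have "((\<lambda>x. f (Complex x y)) has_vector_derivative dir_deriv 1 f (Complex x0 y)) (at x0)"
      by (rule has_vector_derivative_dir_deriv[OF C_k_differentiable[OF f1] vx])
    ultimately show ?thesis
      using vector_derivative_unique_at by fastforce
  qed
  \<comment> \<open>The integral formula is available only for y >= y0, so the derivative at y0 is
    taken from the right. One-sided derivatives are unique too, and here they agree with the
    two-sided ones.\<close>
  have "((\<lambda>y. dir_deriv 1 f (Complex x0 y0) + integral {y0..y} (\<lambda>t. h (Complex x0 t)))
      has_vector_derivative 0 + h (Complex x0 y0)) (at y0 within {y0..y0+1})"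
    by (intro has_vector_derivative_add has_vector_derivative_const integral_has_vector_derivative ch') auto
  then have "((\<lambda>y. dir_deriv 1 f (Complex x0 y)) has_vector_derivative 0 + h (Complex x0 y0)) (at y0 within {y0..y0+1})"
    by (rule has_vector_derivative_transform[OF _ dx, rotated 2]) auto
  moreover have "((\<lambda>y. dir_deriv 1 f (Complex x0 y)) has_vector_derivative dir_deriv \<i> (dir_deriv 1 f) (Complex x0 y0))
      (at y0 within {y0..y0+1})"
    by (rule has_vector_derivative_at_within, rule has_vector_derivative_dir_deriv[OF C_k_differentiable[OF fi(2)] vy])
  moreover have "at y0 within {y0..y0+1} \<noteq> bot"
    by (simp add: trivial_limit_within islimpt_greaterThanLessThan1 islimpt_Icc)
  ultimately have "0 + h (Complex x0 y0) = dir_deriv \<i> (dir_deriv 1 f) (Complex x0 y0)"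
    using vector_derivative_unique_within by blast
  then show ?thesis by (simp add: h_def z)
qed

section \<open>Fourier series on the circle\<close>

abbreviation circle_measure :: "real measure" where
  "circle_measure \<equiv> lebesgue_on {0..2 * pi}"

lemma circle_integrable_continuous:
  fixes f :: "real \<Rightarrow> 'a::euclidean_space"
  assumes "continuous_on UNIV f"
  shows "integrable circle_measure f"
  by (rule continuous_imp_integrable_real) (rule continuous_on_subset[OF assms], simp)

lemma circle_integral_derivative:
  fixes f :: "real \<Rightarrow> complex"
  assumes f: "\<And>t. (f has_vector_derivative f' t) (at t)" and c: "continuous_on UNIV f'"
  shows "(LINT t|circle_measure. f' t) = f (2 * pi) - f 0"
proof -
  have "(LINT t|circle_measure. f' t) = (LBINT t=ereal 0..ereal (2*pi). f' t)"
    using circle_integral_interval[OF c] by (simp add: zero_ereal_def)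
  also have "\<dots> = f (2 * pi) - f 0"
    by (rule interval_integral_FTC_finite)
      (simp_all add: continuous_on_subset[OF c] has_vector_derivative_at_within[OF f])
  finally show ?thesis .
qed

definition circle_char :: "int \<Rightarrow> real \<Rightarrow> complex" where
  "circle_char n t = cis (of_int n * t)"

lemma circle_char_mult: "circle_char m t * circle_char n t = circle_char (m + n) t"
  by (simp add: circle_char_def cis_mult algebra_simps)

lemma cnj_char: "cnj (circle_char n t) = circle_char (- n) t"
  by (simp add: circle_char_def cis_cnj)

lemma circle_char_0 [simp]: "circle_char 0 t = 1"
  by (simp add: circle_char_def)

lemma cmod_char [simp]: "cmod (circle_char n t) = 1"
  by (simp add: circle_char_def)

lemma continuous_on_char [continuous_intros]: "continuous_on A (circle_char n)"
  unfolding circle_char_def by (intro continuous_intros)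

lemma circle_char_2pi [simp]: "circle_char n (2 * pi) = 1"
  by (simp add: circle_char_def cis.ctr complex_eq_iff mult.commute[of "of_int n"])

lemma circle_char_has_vector_derivative:
  "(circle_char n has_vector_derivative \<i> * of_int n * circle_char n t) (at t)"
proof -
  have "((\<lambda>t. exp (\<i> * of_int n * of_real t)) has_vector_derivative
      \<i> * of_int n * exp (\<i> * of_int n * of_real t)) (at t)"
    by (rule has_vector_derivative_real_field[where f="\<lambda>z. exp (\<i> * of_int n * z)"])
      (auto intro!: derivative_eq_intros)
  moreover have "circle_char n = (\<lambda>t. exp (\<i> * of_int n * of_real t))"
    by (simp add: circle_char_def cis_conv_exp fun_eq_iff mult.assoc)
  ultimately show ?thesis by simp
qed

lemma integral_char: "(LINT t|circle_measure. circle_char n t) = (if n = 0 then 2 * pi else 0)"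
proof (cases "n = 0")
  case False
  have "(LINT t|circle_measure. \<i> * of_int n * circle_char n t) = circle_char n (2 * pi) - circle_char n 0"
    by (rule circle_integral_derivative[OF circle_char_has_vector_derivative]) (intro continuous_intros)
  also have "\<dots> = 0" by (simp, simp add: circle_char_def)
  finally show ?thesis using False by simp
qed (simp add: measure_restrict_space scaleR_conv_of_real)

text \<open>Coefficients of a function of the angle rather than of a point of the plane: the
  tangential derivative on the circle arises only in this form.\<close>

definition fcoeff :: "(real \<Rightarrow> complex) \<Rightarrow> int \<Rightarrow> complex" where
  "fcoeff f n = (1 / (2 * pi)) * (LINT t|circle_measure. f t * circle_char (- n) t)"

lemma fourier_coeff_eq: "fourier_coeff g n = fcoeff (\<lambda>t. g (cis t)) n"
  unfolding fourier_coeff_def fcoeff_def circle_char_def cis_conv_exp by (simp add: mult.assoc)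

lemma integral_mult_char:
  "(LINT t|circle_measure. f t * circle_char (- n) t) = 2 * pi * fcoeff f n"
  by (simp add: fcoeff_def)

definition trig :: "int set \<Rightarrow> (int \<Rightarrow> complex) \<Rightarrow> real \<Rightarrow> complex" where
  "trig A c t = (\<Sum>n\<in>A. c n * circle_char n t)"

lemma continuous_on_trig [continuous_intros]: "continuous_on S (trig A c)"
  unfolding trig_def by (intro continuous_intros)

lemma integral_mult_cnj_trig:
  assumes f: "continuous_on UNIV f" and A: "finite A"
  shows "(LINT t|circle_measure. f t * cnj (trig A c t)) = 2 * pi * (\<Sum>n\<in>A. fcoeff f n * cnj (c n))"
proof -
  have i: "integrable circle_measure (\<lambda>t. cnj (c n) * (f t * circle_char (- n) t))" for n
    by (rule circle_integrable_continuous) (intro continuous_intros f)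
  have "(LINT t|circle_measure. f t * cnj (trig A c t)) =
      (LINT t|circle_measure. (\<Sum>n\<in>A. cnj (c n) * (f t * circle_char (- n) t)))"
    by (simp add: trig_def cnj_char sum_distrib_left algebra_simps)
  also have "\<dots> = (\<Sum>n\<in>A. (LINT t|circle_measure. cnj (c n) * (f t * circle_char (- n) t)))"
    by (rule Bochner_Integration.integral_sum[OF i])
  also have "\<dots> = (\<Sum>n\<in>A. cnj (c n) * (2 * pi * fcoeff f n))"
    by (simp add: integral_mult_char)
  finally show ?thesis by (simp add: sum_distrib_left algebra_simps)
qed

lemma fcoeff_trig:
  assumes A: "finite A" and m: "m \<in> A"
  shows "fcoeff (trig A c) m = c m"
proof -
  have i: "integrable circle_measure (\<lambda>t. c n * circle_char (n - m) t)" for n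
    by (rule circle_integrable_continuous) (intro continuous_intros)
  have "(LINT t|circle_measure. trig A c t * circle_char (- m) t) = (LINT t|circle_measure. (\<Sum>n\<in>A. c n * circle_char (n - m) t))"
    by (simp add: trig_def sum_distrib_right mult.assoc circle_char_mult)
  also have "\<dots> = (\<Sum>n\<in>A. (LINT t|circle_measure. c n * circle_char (n - m) t))"
    by (rule Bochner_Integration.integral_sum[OF i])
  also have "\<dots> = (\<Sum>n\<in>A. if n = m then c n * (2 * pi) else 0)"
    by (intro sum.cong refl) (simp add: integral_char)
  also have "\<dots> = 2 * pi * c m" using A m by (simp add: sum.delta)
  finally show ?thesis by (simp add: fcoeff_def)
qed

lemma integral_cmod_sq:
  assumes f: "continuous_on UNIV f"
  shows "(LINT t|circle_measure. f t * cnj (f t)) = of_real (LINT t|circle_measure. (cmod (f t))\<^sup>2)"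
  unfolding complex_norm_square[symmetric] by (rule integral_complex_of_real)

text \<open>Expanding the square and completing it in the coefficients. The choice c = Fourier
  coefficients gives Bessel's inequality, and the last sum shows that this choice is the best
  approximation with frequencies in \<open>A\<close>.\<close>

lemma trig_approx_identity:
  assumes f: "continuous_on UNIV f" and A: "finite A"
  shows "(LINT t|circle_measure. (cmod (f t - trig A c t))\<^sup>2) =
    (LINT t|circle_measure. (cmod (f t))\<^sup>2) - 2 * pi * (\<Sum>n\<in>A. (cmod (fcoeff f n))\<^sup>2)
      + 2 * pi * (\<Sum>n\<in>A. (cmod (fcoeff f n - c n))\<^sup>2)"
proof -
  let ?T = "trig A c"
  have fT: "continuous_on UNIV (\<lambda>t. f t - ?T t)" by (intro continuous_intros f)
  have i: "integrable circle_measure (\<lambda>t. f t * cnj (f t))" "integrable circle_measure (\<lambda>t. f t * cnj (?T t))"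
     "integrable circle_measure (\<lambda>t. cnj (f t * cnj (?T t)))" "integrable circle_measure (\<lambda>t. ?T t * cnj (?T t))"
    by (rule circle_integrable_continuous, intro continuous_intros f)+
  have "complex_of_real (LINT t|circle_measure. (cmod (f t - ?T t))\<^sup>2) =
    (LINT t|circle_measure. (f t - ?T t) * cnj (f t - ?T t))"
    by (rule integral_cmod_sq[OF fT, symmetric])
  also have "\<dots> = (LINT t|circle_measure. f t * cnj (f t) - f t * cnj (?T t) - cnj (f t * cnj (?T t)) + ?T t * cnj (?T t))"
    by (simp add: algebra_simps)
  also have "\<dots> = (LINT t|circle_measure. f t * cnj (f t)) - (LINT t|circle_measure. f t * cnj (?T t))
      - (LINT t|circle_measure. cnj (f t * cnj (?T t))) + (LINT t|circle_measure. ?T t * cnj (?T t))"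
    using i by (simp only: Bochner_Integration.integral_add Bochner_Integration.integral_diff
        Bochner_Integration.integrable_diff)
  also have "(LINT t|circle_measure. ?T t * cnj (?T t)) = 2 * pi * (\<Sum>n\<in>A. c n * cnj (c n))"
    by (subst integral_mult_cnj_trig[OF continuous_on_trig A]) (simp add: fcoeff_trig[OF A])
  also have "(LINT t|circle_measure. cnj (f t * cnj (?T t))) = cnj (LINT t|circle_measure. f t * cnj (?T t))"
    by (rule Bochner_Integration.integral_cnj)
  also have "(LINT t|circle_measure. f t * cnj (?T t)) = 2 * pi * (\<Sum>n\<in>A. fcoeff f n * cnj (c n))"
    by (rule integral_mult_cnj_trig[OF f A])
  also have "(LINT t|circle_measure. f t * cnj (f t)) = of_real (LINT t|circle_measure. (cmod (f t))\<^sup>2)"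
    by (rule integral_cmod_sq[OF f])
  also have "of_real (LINT t|circle_measure. (cmod (f t))\<^sup>2) - 2 * pi * (\<Sum>n\<in>A. fcoeff f n * cnj (c n))
       - cnj (2 * pi * (\<Sum>n\<in>A. fcoeff f n * cnj (c n))) + 2 * pi * (\<Sum>n\<in>A. c n * cnj (c n)) =
      complex_of_real ((LINT t|circle_measure. (cmod (f t))\<^sup>2) - 2 * pi * (\<Sum>n\<in>A. (cmod (fcoeff f n))\<^sup>2)
      + 2 * pi * (\<Sum>n\<in>A. (cmod (fcoeff f n - c n))\<^sup>2))"
    by (simp add: complex_norm_square sum_distrib_left sum_subtractf[symmetric] sum.distrib[symmetric] algebra_simps del: of_real_power)
  finally show ?thesis by (simp only: of_real_eq_iff)
qed

lemma bessel:
  assumes "continuous_on UNIV f" and "finite A"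
  shows "2 * pi * (\<Sum>n\<in>A. (cmod (fcoeff f n))\<^sup>2) \<le> (LINT t|circle_measure. (cmod (f t))\<^sup>2)"
proof -
  have "0 \<le> (LINT t|circle_measure. (cmod (f t - trig A (fcoeff f) t))\<^sup>2)" by simp
  then show ?thesis by (simp add: trig_approx_identity[OF assms])
qed

section \<open>Density of trigonometric polynomials and convergence of Fourier sums\<close>

inductive trig_poly :: "(real \<Rightarrow> complex) \<Rightarrow> bool" where
  circle_char: "trig_poly (\<lambda>t. c * circle_char n t)"
| add: "trig_poly f \<Longrightarrow> trig_poly g \<Longrightarrow> trig_poly (\<lambda>t. f t + g t)"

lemma trig_poly_cmult_char: "trig_poly f \<Longrightarrow> trig_poly (\<lambda>t. f t * (c * circle_char n t))"
proof (induction rule: trig_poly.induct)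
  case (circle_char d m)
  then show ?case using trig_poly.circle_char[of "d * c" "m + n"] by (simp add: circle_char_mult[symmetric] algebra_simps)
next
  case (add f g)
  then show ?case using trig_poly.add by (simp add: distrib_right)
qed

lemma trig_poly_mult: "trig_poly g \<Longrightarrow> trig_poly f \<Longrightarrow> trig_poly (\<lambda>t. f t * g t)"
proof (induction rule: trig_poly.induct)
  case (circle_char d m)
  then show ?case by (rule trig_poly_cmult_char)
next
  case (add f g)
  then show ?case using trig_poly.add by (simp add: distrib_left)
qed

lemma trig_poly_const: "trig_poly (\<lambda>t. c)"
  using trig_poly.circle_char[of c 0] by simp

lemma trig_poly_eq_trig: "trig_poly f \<Longrightarrow> \<exists>A c. finite A \<and> f = trig A c"
proof (induction rule: trig_poly.induct)
  case (circle_char c n)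
  have "(\<lambda>t. c * circle_char n t) = trig {n} (\<lambda>_. c)" by (simp add: trig_def fun_eq_iff)
  then show ?case by blast
next
  case (add f g)
  then obtain A c B d where "finite A" "f = trig A c" "finite B" "g = trig B d" by blast
  \<comment> \<open>The frequency sets may overlap: each coefficient is extended by 0 to the union,
    and the two extensions are added.\<close>
  moreover from this have "(\<lambda>t. f t + g t) =
      trig (A \<union> B) (\<lambda>n. (if n \<in> A then c n else 0) + (if n \<in> B then d n else 0))"
    by (auto simp: trig_def fun_eq_iff distrib_right sum.distrib if_distrib[of "\<lambda>x. x * _"]
        sum.If_cases Int_absorb1 Int_absorb2 cong: if_cong)
  ultimately show ?case by blast
qed

lemma trig_poly_real_polynomial:
  assumes "real_polynomial_function (p :: complex \<Rightarrow> real)"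
  shows "trig_poly (\<lambda>t. of_real (p (cis t)))"
  using assms
proof (induction rule: real_polynomial_function.induct)
  case (linear p)
  interpret bounded_linear p by fact
  have "cis t = cos t *\<^sub>R 1 + sin t *\<^sub>R \<i>" for t by (simp add: complex_eq_iff)
  then have "p (cis t) = cos t * p 1 + sin t * p \<i>" for t by (simp only: add scale) simp
  \<comment> \<open>Euler's formulas for cos and sin turn p(1) cos t + p(i) sin t into the
    characters 1 and -1 with coefficients (p(1) - i p(i))/2 and its conjugate.\<close>
  then have "(\<lambda>t. complex_of_real (p (cis t))) =
      (\<lambda>t. Complex (p 1 / 2) (- p \<i> / 2) * circle_char 1 t + Complex (p 1 / 2) (p \<i> / 2) * circle_char (- 1) t)"
    by (simp add: fun_eq_iff complex_eq_iff circle_char_def algebra_simps)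
  then show ?case by (simp only:) (intro trig_poly.intros)
next
  case (const c)
  then show ?case by (rule trig_poly_const)
next
  case (add f g)
  then show ?case using trig_poly.add by simp
next
  case (mult f g)
  then show ?case using trig_poly_mult by simp
qed

text \<open>Stone-Weierstrass supplies real polynomials for the real and the imaginary part on the
  circle, and a real polynomial restricted to the circle is a trigonometric polynomial.\<close>

lemma trig_dense:
  fixes \<phi> :: "complex \<Rightarrow> complex"
  assumes \<phi>: "continuous_on UNIV \<phi>" and e: "0 < e"
  obtains A c where "finite A" "\<And>t. cmod (\<phi> (cis t) - trig A c t) < e"
proof -
  have "continuous_on (sphere 0 1) (\<lambda>z. Re (\<phi> z))" "continuous_on (sphere 0 1) (\<lambda>z. Im (\<phi> z))"
    by (auto intro!: continuous_intros continuous_on_subset[OF \<phi>])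
  then obtain p q where p: "real_polynomial_function p" "\<And>z. z \<in> sphere 0 1 \<Longrightarrow> \<bar>Re (\<phi> z) - p z\<bar> < e / 2"
    and q: "real_polynomial_function q" "\<And>z. z \<in> sphere 0 1 \<Longrightarrow> \<bar>Im (\<phi> z) - q z\<bar> < e / 2"
    using Stone_Weierstrass_real_polynomial_function[of "sphere 0 1" _ "e / 2"] e by (metis compact_sphere half_gt_zero)
  have "trig_poly (\<lambda>t. of_real (p (cis t)) + (\<lambda>t. \<i>) t * of_real (q (cis t)))"
    by (intro trig_poly.add trig_poly_mult trig_poly_const trig_poly_real_polynomial p q)
  then obtain A c where A: "finite A" and T: "(\<lambda>t. of_real (p (cis t)) + \<i> * of_real (q (cis t))) = trig A c"
    using trig_poly_eq_trig by blast
  have "cmod (\<phi> (cis t) - trig A c t) < e" for t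
  proof -
    have "cmod (\<phi> (cis t) - trig A c t) \<le> \<bar>Re (\<phi> (cis t)) - p (cis t)\<bar> + \<bar>Im (\<phi> (cis t)) - q (cis t)\<bar>"
      unfolding T[symmetric]
      by (rule order_trans[OF cmod_le]) simp
    also have "\<dots> < e / 2 + e / 2" by (intro add_strict_mono p q) auto
    finally show ?thesis by simp
  qed
  with A show ?thesis by (rule that)
qed

lemma fourier_sum_converges:
  fixes \<phi> :: "complex \<Rightarrow> complex"
  assumes \<phi>: "continuous_on UNIV \<phi>" and e: "0 < e"
  obtains A where "finite A"
    "(LINT t|circle_measure. (cmod (\<phi> (cis t) - trig A (fcoeff (\<lambda>t. \<phi> (cis t))) t))\<^sup>2) \<le> e"
proof -
  let ?f = "\<lambda>t. \<phi> (cis t)"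
  have f: "continuous_on UNIV ?f"
    by (intro continuous_on_compose2[OF \<phi>] continuous_intros) auto
  \<comment> \<open>The circle has length 2 pi, so a uniform error \<open>d\<close> has squared L^2
    norm at most 2 pi d^2 = e.\<close>
  define d where "d = sqrt (e / (2 * pi))"
  have d: "0 < d" "d\<^sup>2 = e / (2 * pi)" using e by (auto simp: d_def)
  obtain A c where A: "finite A" and c: "\<And>t. cmod (?f t - trig A c t) < d"
    using trig_dense[OF \<phi> d(1)] by blast
  \<comment> \<open>Best approximation: over the same frequencies, the Fourier sum does no worse
    than the Stone-Weierstrass approximant.\<close>
  have "(LINT t|circle_measure. (cmod (?f t - trig A (fcoeff ?f) t))\<^sup>2) \<le> (LINT t|circle_measure. (cmod (?f t - trig A c t))\<^sup>2)"
    by (simp add: trig_approx_identity[OF f A] sum_nonneg)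
  also have "\<dots> \<le> (LINT t|circle_measure. d\<^sup>2)"
    by (intro integral_mono circle_integrable_continuous continuous_intros f power_mono less_imp_le[OF c]) simp
  also have "\<dots> = e" by (simp add: d(2) measure_restrict_space)
  finally show ?thesis using A that by blast
qed

section \<open>Energy identities for smooth functions\<close>

definition dz :: "(complex \<Rightarrow> complex) \<Rightarrow> complex \<Rightarrow> complex" where
  "dz f z = (dir_deriv 1 f z - \<i> * dir_deriv \<i> f z) / 2"

definition dzbar :: "(complex \<Rightarrow> complex) \<Rightarrow> complex \<Rightarrow> complex" where
  "dzbar f z = (dir_deriv 1 f z + \<i> * dir_deriv \<i> f z) / 2"

lemma continuous_on_dz [continuous_intros]:
  assumes "C_k 1 f" shows "continuous_on A (dz f)" "continuous_on A (dzbar f)"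
proof -
  have "continuous_on A (dir_deriv e f)" for e
    using assms continuous_on_subset[OF _ subset_UNIV] by auto
  then show "continuous_on A (dz f)" "continuous_on A (dzbar f)"
    unfolding dz_def dzbar_def by (intro continuous_intros; simp)+
qed

lemma C_k_dz:
  assumes "C_k (Suc k) f" shows "C_k k (dz f)" "C_k k (dzbar f)"
proof -
  have "C_k k (\<lambda>z. (1/2) * (dir_deriv 1 f z - \<i> * dir_deriv \<i> f z))" "C_k k (\<lambda>z. (1/2) * (dir_deriv 1 f z + \<i> * dir_deriv \<i> f z))"
    by (intro C_k_cmult C_k_diff C_k_add C_k_dir_deriv assms)+
  then show "C_k k (dz f)" "C_k k (dzbar f)" by (simp_all add: dz_def[abs_def] dzbar_def[abs_def])
qed

lemma dir_deriv_mult: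
  "f differentiable (at z) \<Longrightarrow> g differentiable (at z) \<Longrightarrow>
    dir_deriv e (\<lambda>z. f z * g z) z = f z * dir_deriv e g z + dir_deriv e f z * g z"
  by (rule dir_deriv_eqI) (intro has_derivative_mult has_derivative_dir_deriv)

lemma differentiable_cnj: "f differentiable F \<Longrightarrow> (\<lambda>z. cnj (f z)) differentiable F"
  unfolding differentiable_def by (blast intro: has_derivative_cnj)

lemma dir_deriv_cnj:
  "f differentiable (at z) \<Longrightarrow> dir_deriv e (\<lambda>z. cnj (f z)) z = cnj (dir_deriv e f z)"
  by (rule dir_deriv_eqI) (intro has_derivative_cnj has_derivative_dir_deriv)

lemma dz_mult:
  assumes "f differentiable (at z)" "g differentiable (at z)"
  shows "dz (\<lambda>z. f z * g z) z = f z * dz g z + dz f z * g z"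
    "dzbar (\<lambda>z. f z * g z) z = f z * dzbar g z + dzbar f z * g z"
  by (simp_all add: dz_def dzbar_def dir_deriv_mult[OF assms] field_simps)

lemma dz_cnj:
  assumes "f differentiable (at z)"
  shows "dz (\<lambda>z. cnj (f z)) z = cnj (dzbar f z)" "dzbar (\<lambda>z. cnj (f z)) z = cnj (dz f z)"
  by (simp_all add: dz_def dzbar_def dir_deriv_cnj[OF assms])

lemma dz_holomorphic:
  assumes "(f has_field_derivative f') (at z)"
  shows "dz f z = f'" "dzbar f z = 0"
proof -
  have "dir_deriv e f z = f' * e" for e
    by (rule dir_deriv_eqI[OF assms[unfolded has_field_derivative_def]])
  then show "dz f z = f'" "dzbar f z = 0"
    by (simp_all add: dz_def dzbar_def algebra_simps flip: mult.assoc)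
qed

lemma dz_dzbar_commute:
  assumes f: "C_k 2 f" shows "dz (dzbar f) z = dzbar (dz f) z"
proof -
  have d: "dir_deriv e f differentiable (at z)" "f differentiable (at z)" for e
    using f by (auto simp: numeral_2_eq_2)
  have "dir_deriv e (dzbar f) z = (dir_deriv e (dir_deriv 1 f) z + \<i> * dir_deriv e (dir_deriv \<i> f) z) / 2" for e
    unfolding dzbar_def[abs_def]
    by (rule dir_deriv_eqI) (auto intro!: derivative_eq_intros has_derivative_dir_deriv d)
  moreover have "dir_deriv e (dz f) z = (dir_deriv e (dir_deriv 1 f) z - \<i> * dir_deriv e (dir_deriv \<i> f) z) / 2" for e
    unfolding dz_def[abs_def]
    by (rule dir_deriv_eqI) (auto intro!: derivative_eq_intros has_derivative_dir_deriv d)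
  ultimately show ?thesis
    by (simp only: dz_def[of "dzbar f"] dzbar_def[of "dz f"] dir_deriv_commute[OF f]) (simp add: field_simps)
qed

text \<open>The outward normal (cos t, sin t) combines with the coefficients of \<open>dz\<close> to
  exp(-it)/2 and with those of \<open>dzbar\<close> to exp(it)/2.\<close>

lemma stokes:
  assumes F: "C_k 1 F"
  shows "(LINT z|lebesgue_on disc. dz F z) = (LINT t|circle_measure. F (cis t) * circle_char (- 1) t) / 2"
    "(LINT z|lebesgue_on disc. dzbar F z) = (LINT t|circle_measure. F (cis t) * circle_char 1 t) / 2"
proof -
  have c: "continuous_on UNIV (dir_deriv e F)" for e using F by auto
  have cF: "continuous_on UNIV (\<lambda>t. F (cis t))"
    by (intro continuous_on_compose2[OF C_k_continuous[OF F]] continuous_intros) auto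
  note i = disc_integrable_continuous(1)[OF c] integrable_mult_right[OF disc_integrable_continuous(1)[OF c]]
  have j: "integrable circle_measure (\<lambda>t. F (cis t) * cos t)" "integrable circle_measure (\<lambda>t. F (cis t) * sin t)"
    by (rule circle_integrable_continuous, intro continuous_intros cF)+
  have "(LINT z|lebesgue_on disc. dz F z) =
     ((LINT z|lebesgue_on disc. dir_deriv 1 F z) - \<i> * (LINT z|lebesgue_on disc. dir_deriv \<i> F z)) / 2"
    unfolding dz_def by (simp add: i Bochner_Integration.integral_diff)
  also have "\<dots> = ((LINT t|circle_measure. F (cis t) * cos t - \<i> * (F (cis t) * sin t))) / 2"
    unfolding stokes_x[OF F] stokes_y[OF F]
    by (subst Bochner_Integration.integral_diff) (use j in auto)
  also have "(\<lambda>t. F (cis t) * cos t - \<i> * (F (cis t) * sin t)) = (\<lambda>t. F (cis t) * circle_char (- 1) t)"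
    by (simp add: fun_eq_iff circle_char_def cis_conv_exp[symmetric] complex_eq_iff algebra_simps)
  finally show "(LINT z|lebesgue_on disc. dz F z) = (LINT t|circle_measure. F (cis t) * circle_char (- 1) t) / 2" .
  have "(LINT z|lebesgue_on disc. dzbar F z) =
     ((LINT z|lebesgue_on disc. dir_deriv 1 F z) + \<i> * (LINT z|lebesgue_on disc. dir_deriv \<i> F z)) / 2"
    unfolding dzbar_def by (simp add: i Bochner_Integration.integral_add)
  also have "\<dots> = ((LINT t|circle_measure. F (cis t) * cos t + \<i> * (F (cis t) * sin t))) / 2"
    unfolding stokes_x[OF F] stokes_y[OF F]
    by (subst Bochner_Integration.integral_add) (use j in auto)
  also have "(\<lambda>t. F (cis t) * cos t + \<i> * (F (cis t) * sin t)) = (\<lambda>t. F (cis t) * circle_char 1 t)"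
    by (simp add: fun_eq_iff circle_char_def cis_conv_exp[symmetric] complex_eq_iff algebra_simps)
  finally show "(LINT z|lebesgue_on disc. dzbar F z) = (LINT t|circle_measure. F (cis t) * circle_char 1 t) / 2" .
qed

section \<open>Square norms on the disc and on the circle\<close>

definition disc_sq :: "(complex \<Rightarrow> complex) \<Rightarrow> real" where
  "disc_sq f = (LINT z|lebesgue_on disc. (cmod (f z))\<^sup>2)"

definition circle_sq :: "(complex \<Rightarrow> complex) \<Rightarrow> real" where
  "circle_sq f = (LINT t|circle_measure. (cmod (f (cis t)))\<^sup>2)"

lemma disc_sq_nonneg: "0 \<le> disc_sq f"
  by (simp add: disc_sq_def)

lemma disc_integral_mult_cnj:
  "(LINT z|lebesgue_on disc. f z * cnj (f z)) = of_real (disc_sq f)"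
  unfolding disc_sq_def complex_norm_square[symmetric] by (rule integral_complex_of_real)

lemma C_k_mono: "C_k k f \<Longrightarrow> j \<le> k \<Longrightarrow> C_k j f"
  by (induction k) (auto simp: le_Suc_eq dest: C_k_SucD simp del: C_k.simps(2))

text \<open>Both bounds come from Stokes' theorem for z |f|^2. On the circle the factor z cancels
  \<open>circle_char (- 1)\<close> and leaves the boundary norm; inside, \<open>dz\<close> produces
  |f|^2 plus a product of f with its derivatives, which is estimated by absolute value. The first
  bound is the Poincare inequality with boundary term, the second the trace inequality into
  L^2.\<close>

lemma
  assumes f: "C_k 1 f"
  shows disc_sq_le: "disc_sq f \<le> circle_sq f + 2 * disc_sq (dz f) + 2 * disc_sq (dzbar f)"
    and circle_sq_le: "circle_sq f \<le> 3 * disc_sq f + 2 * disc_sq (dz f) + 2 * disc_sq (dzbar f)"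
proof -
  have df: "f differentiable (at z)" for z using f by simp
  have cf: "continuous_on A f" for A using C_k_continuous[OF f] continuous_on_subset by blast
  let ?F = "\<lambda>z. z * (f z * cnj (f z))"
  let ?G = "\<lambda>z. z * (f z * cnj (dzbar f z) + dz f z * cnj (f z))"
  have F: "C_k 1 ?F" by (intro C_k_mult C_k_ident C_k_cnj f)
  have dF: "dz ?F z = ?G z + f z * cnj (f z)" for z
  proof -
    have "dz ?F z = z * dz (\<lambda>z. f z * cnj (f z)) z + dz (\<lambda>z. z) z * (f z * cnj (f z))"
      by (rule dz_mult) (auto intro!: differentiable_mult differentiable_cnj df)
    also have "dz (\<lambda>z. f z * cnj (f z)) z = f z * dz (\<lambda>z. cnj (f z)) z + dz f z * cnj (f z)"
      by (rule dz_mult) (auto intro!: differentiable_cnj df)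
    also have "dz (\<lambda>z. z) z = 1"
      by (rule dz_holomorphic) (auto intro!: derivative_eq_intros)
    finally show ?thesis by (simp add: dz_cnj[OF df])
  qed
  have iG: "integrable (lebesgue_on disc) ?G" "integrable (lebesgue_on disc) (\<lambda>z. f z * cnj (f z))"
    by (rule disc_integrable_continuous, intro continuous_intros cf f)+
  have "of_real (circle_sq f) / 2 = (LINT t|circle_measure. ?F (cis t) * circle_char (- 1) t) / 2"
  proof -
    have "?F (cis t) * circle_char (- 1) t = (cis t * cis (- t)) * (f (cis t) * cnj (f (cis t)))" for t
      by (simp add: circle_char_def)
    then have "(\<lambda>t. ?F (cis t) * circle_char (- 1) t) = (\<lambda>t. f (cis t) * cnj (f (cis t)))"
      by (simp only: cis_mult) simp
    then show ?thesis
      unfolding circle_sq_def integral_complex_of_real[symmetric] complex_norm_square by simp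
  qed
  also have "\<dots> = (LINT z|lebesgue_on disc. ?G z + f z * cnj (f z))"
    by (simp only: dF[symmetric] stokes(1)[OF F])
  also have "\<dots> = (LINT z|lebesgue_on disc. ?G z) + of_real (disc_sq f)"
    by (subst Bochner_Integration.integral_add) (use iG in \<open>simp_all only: disc_integral_mult_cnj\<close>)
  finally have e: "of_real (circle_sq f / 2 - disc_sq f) = (LINT z|lebesgue_on disc. ?G z)"
    by (simp add: algebra_simps)
  have ij: "integrable (lebesgue_on disc) (\<lambda>z. (cmod (f z))\<^sup>2 / 2)"
     "integrable (lebesgue_on disc) (\<lambda>z. (cmod (dz f z))\<^sup>2)"
     "integrable (lebesgue_on disc) (\<lambda>z. (cmod (dzbar f z))\<^sup>2)"
    by (rule disc_integrable_continuous, intro continuous_intros cf f, simp?)+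
  have "\<bar>circle_sq f / 2 - disc_sq f\<bar> = cmod (LINT z|lebesgue_on disc. ?G z)"
    unfolding e[symmetric] norm_of_real ..
  also have "\<dots> \<le> (LINT z|lebesgue_on disc. (cmod (f z))\<^sup>2 / 2 + (cmod (dz f z))\<^sup>2 + (cmod (dzbar f z))\<^sup>2)"
  proof (rule order_trans[OF integral_norm_bound integral_mono])
    show "integrable (lebesgue_on disc) (\<lambda>z. cmod (?G z))" using iG by simp
    show "integrable (lebesgue_on disc) (\<lambda>z. (cmod (f z))\<^sup>2 / 2 + (cmod (dz f z))\<^sup>2 + (cmod (dzbar f z))\<^sup>2)"
      using ij by auto
    fix z assume "z \<in> space (lebesgue_on disc)"
    then have z: "cmod z \<le> 1" by auto
    have "cmod (?G z) \<le> 1 * (cmod (f z * cnj (dzbar f z)) + cmod (dz f z * cnj (f z)))"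
      unfolding norm_mult[of z] by (intro mult_mono z norm_triangle_ineq) auto
    also have "\<dots> = cmod (f z) * cmod (dzbar f z) + cmod (f z) * cmod (dz f z)"
      by (simp add: norm_mult)
    also have "\<dots> \<le> (cmod (f z))\<^sup>2 / 2 + (cmod (dz f z))\<^sup>2 + (cmod (dzbar f z))\<^sup>2"
    proof -
      \<comment> \<open>The weight 1/2 on the square of a leaves half of \<open>disc_sq f\<close>
        after absorption into the left-hand side.\<close>
      have *: "a * b + a * c \<le> a\<^sup>2 / 2 + c\<^sup>2 + b\<^sup>2" for a b c :: real
        using sum_squares_ge_zero[of "a / 2 - b" "a / 2 - c"] by (simp add: power2_eq_square algebra_simps)
      show ?thesis by (rule *)
    qed
    finally show "cmod (?G z) \<le> (cmod (f z))\<^sup>2 / 2 + (cmod (dz f z))\<^sup>2 + (cmod (dzbar f z))\<^sup>2" .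
  qed
  also have "\<dots> = disc_sq f / 2 + disc_sq (dz f) + disc_sq (dzbar f)"
    using ij by (simp add: disc_sq_def)
  finally have "\<bar>circle_sq f / 2 - disc_sq f\<bar> \<le> disc_sq f / 2 + disc_sq (dz f) + disc_sq (dzbar f)" .
  then show "disc_sq f \<le> circle_sq f + 2 * disc_sq (dz f) + 2 * disc_sq (dzbar f)"
    and "circle_sq f \<le> 3 * disc_sq f + 2 * disc_sq (dz f) + 2 * disc_sq (dzbar f)"
    by linarith+
qed

text \<open>\<open>dz\<close> annihilates antiholomorphic functions, so the integrand equals
  \<open>dz\<close> of f times the conjugate of z^(n-1). Stokes' theorem then leaves, on the circle,
  the character of frequency -(n-1) - 1 = -n.\<close>

lemma disc_integral_dz_power:
  assumes f: "C_k 1 f" and n: "1 \<le> (n :: nat)"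
  shows "(LINT z|lebesgue_on disc. dz f z * cnj (z ^ (n - 1))) = pi * fcoeff (\<lambda>t. f (cis t)) (int n)"
proof -
  have df: "f differentiable (at z)" for z using f by simp
  let ?h = "\<lambda>z. cnj (z ^ (n - 1))"
  have hh: "dz ?h z = 0" for z
  proof -
    have p: "((\<lambda>z. z ^ (n - 1)) has_field_derivative of_nat (n - 1) * z ^ (n - 1 - 1)) (at z)"
      by (auto intro!: derivative_eq_intros)
    then have "(\<lambda>z::complex. z ^ (n - 1)) differentiable (at z)"
      using field_differentiable_def field_differentiable_imp_differentiable by blast
    then show ?thesis by (simp only: dz_cnj dz_holomorphic(2)[OF p] complex_cnj_zero)
  qed
  have "(LINT z|lebesgue_on disc. dz f z * ?h z) = (LINT z|lebesgue_on disc. dz (\<lambda>z. f z * ?h z) z)"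
  proof -
    have "dz (\<lambda>z. f z * ?h z) z = f z * dz ?h z + dz f z * ?h z" for z
      by (intro dz_mult df differentiable_cnj) auto
    then show ?thesis by (simp only: hh) simp
  qed
  also have "\<dots> = (LINT t|circle_measure. (f (cis t) * ?h (cis t)) * circle_char (- 1) t) / 2"
    by (rule stokes) (intro C_k_mult C_k_cnj C_k_power C_k_ident f)
  also have "(\<lambda>t. (f (cis t) * ?h (cis t)) * circle_char (- 1) t) = (\<lambda>t. f (cis t) * circle_char (- int n) t)"
    using n by (simp add: fun_eq_iff circle_char_def cis_cnj Complex.DeMoivre cis_mult of_nat_diff algebra_simps)
  finally show ?thesis by (simp add: fcoeff_def)
qed

text \<open>Bessel's inequality for the orthogonal system \<open>z\<^sup>n\<^sup>-\<^sup>1\<close> of the Bergman space.\<close>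

lemma sum_pos_fourier_le_dz:
  assumes f: "C_k 1 f" and A: "finite A" "\<And>n. n \<in> A \<Longrightarrow> 1 \<le> (n :: nat)"
  shows "pi * (\<Sum>n\<in>A. n * (cmod (fcoeff (\<lambda>t. f (cis t)) (int n)))\<^sup>2) \<le> disc_sq (dz f)"
proof -
  define c where "c n = fcoeff (\<lambda>t. f (cis t)) (int n)" for n
  define S where "S = (\<Sum>n\<in>A. n * (cmod (c n))\<^sup>2)"
  \<comment> \<open>\<open>P\<close> is the derivative of the polynomial \<open>p\<close> that has
    the same coefficients as f on \<open>A\<close>, and it will turn out to be the orthogonal
    projection of \<open>dz f\<close>. By \<open>key\<close>, the pairings of \<open>dz f\<close>
    and of \<open>P\<close> itself with \<open>P\<close> have the common value pi S, so |dz f - P|^2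
    integrates to \<open>disc_sq (dz f) - pi * S\<close>.\<close>
  define P where "P z = (\<Sum>n\<in>A. n * c n * z ^ (n - 1))" for z
  define p where "p z = (\<Sum>n\<in>A. c n * z ^ n)" for z
  have "C_k 1 (\<lambda>z. \<Sum>n\<in>A. c n * z ^ n)"
    using A(1) by induction (simp_all add: C_k_const C_k_add C_k_cmult C_k_power C_k_ident del: One_nat_def)
  then have p: "C_k 1 p" by (simp add: p_def[abs_def])
  have dp: "dz p z = P z" for z
    by (rule dz_holomorphic) (auto simp: p_def[abs_def] P_def intro!: derivative_eq_intros sum.cong)
  have cp: "fcoeff (\<lambda>t. p (cis t)) (int n) = c n" if "n \<in> A" for n
  proof -
    have "(\<lambda>t. p (cis t)) = trig (int ` A) (\<lambda>k. c (nat k))"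
      by (simp add: fun_eq_iff p_def trig_def sum.reindex inj_on_def circle_char_def Complex.DeMoivre)
    then show ?thesis using fcoeff_trig[of "int ` A" "int n" "\<lambda>k. c (nat k)"] A that by simp
  qed
  have cdf: "continuous_on UNIV (dz f)" "continuous_on UNIV P"
    unfolding P_def by (intro continuous_intros f)+
  have key: "(LINT z|lebesgue_on disc. dz g z * cnj (P z)) = pi * (\<Sum>n\<in>A. n * cnj (c n) * fcoeff (\<lambda>t. g (cis t)) (int n))"
    if g: "C_k 1 g" for g
  proof -
    have i: "integrable (lebesgue_on disc) (\<lambda>z. n * cnj (c n) * (dz g z * cnj (z ^ (n - 1))))" for n :: nat
      by (rule disc_integrable_continuous) (intro continuous_intros g)
    have "(LINT z|lebesgue_on disc. dz g z * cnj (P z)) = (LINT z|lebesgue_on disc. (\<Sum>n\<in>A. n * cnj (c n) * (dz g z * cnj (z ^ (n - 1)))))"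
      by (simp add: P_def sum_distrib_left algebra_simps)
    also have "\<dots> = (\<Sum>n\<in>A. (LINT z|lebesgue_on disc. n * cnj (c n) * (dz g z * cnj (z ^ (n - 1)))))"
      by (rule Bochner_Integration.integral_sum[OF i])
    also have "\<dots> = (\<Sum>n\<in>A. n * cnj (c n) * (pi * fcoeff (\<lambda>t. g (cis t)) (int n)))"
      by (intro sum.cong refl) (simp only: integral_mult_right_zero disc_integral_dz_power[OF g A(2)])
    finally show ?thesis by (simp add: sum_distrib_left algebra_simps)
  qed
  have S: "(\<Sum>n\<in>A. n * cnj (c n) * c n) = of_real S"
    by (simp add: S_def complex_norm_square mult.assoc mult.commute[of "cnj _"] del: of_real_power)
  have k1: "(LINT z|lebesgue_on disc. dz f z * cnj (P z)) = of_real (pi * S)"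
    using key[OF f] by (simp add: c_def[symmetric] S)
  have "(LINT z|lebesgue_on disc. P z * cnj (P z)) = pi * (\<Sum>n\<in>A. n * cnj (c n) * fcoeff (\<lambda>t. p (cis t)) (int n))"
    using key[OF p] by (simp add: dp)
  also have "(\<Sum>n\<in>A. n * cnj (c n) * fcoeff (\<lambda>t. p (cis t)) (int n)) = of_real S"
    by (subst S[symmetric]) (intro sum.cong refl, simp add: cp)
  finally have k2: "(LINT z|lebesgue_on disc. P z * cnj (P z)) = of_real (pi * S)" by simp
  have i: "integrable (lebesgue_on disc) (\<lambda>z. dz f z * cnj (dz f z))" "integrable (lebesgue_on disc) (\<lambda>z. dz f z * cnj (P z))"
     "integrable (lebesgue_on disc) (\<lambda>z. cnj (dz f z * cnj (P z)))" "integrable (lebesgue_on disc) (\<lambda>z. P z * cnj (P z))"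
    by (rule disc_integrable_continuous, intro continuous_intros cdf)+
  have "complex_of_real (disc_sq (\<lambda>z. dz f z - P z)) = (LINT z|lebesgue_on disc. (dz f z - P z) * cnj (dz f z - P z))"
    by (rule disc_integral_mult_cnj[symmetric])
  also have "\<dots> = (LINT z|lebesgue_on disc. dz f z * cnj (dz f z) - dz f z * cnj (P z) - cnj (dz f z * cnj (P z)) + P z * cnj (P z))"
    by (simp add: algebra_simps)
  also have "\<dots> = (LINT z|lebesgue_on disc. dz f z * cnj (dz f z)) - (LINT z|lebesgue_on disc. dz f z * cnj (P z))
      - (LINT z|lebesgue_on disc. cnj (dz f z * cnj (P z))) + (LINT z|lebesgue_on disc. P z * cnj (P z))"
    using i by (simp only: Bochner_Integration.integral_add Bochner_Integration.integral_diff
        Bochner_Integration.integrable_diff)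
  also have "\<dots> = of_real (disc_sq (dz f) - pi * S)"
    by (simp only: k1 k2 Bochner_Integration.integral_cnj disc_integral_mult_cnj) simp
  finally have "disc_sq (\<lambda>z. dz f z - P z) = disc_sq (dz f) - pi * S" by (simp only: of_real_eq_iff)
  then show ?thesis using disc_sq_nonneg[of "\<lambda>z. dz f z - P z"] by (simp add: S_def c_def)
qed

lemma fcoeff_cnj: "fcoeff (\<lambda>t. cnj (f t)) n = cnj (fcoeff f (- n))"
proof -
  have "(\<lambda>t. cnj (f t) * circle_char (- n) t) = (\<lambda>t. cnj (f t * circle_char (- (- n)) t))"
    by (simp add: cnj_char)
  then show ?thesis by (simp only: fcoeff_def Bochner_Integration.integral_cnj) simp
qed

text \<open>Positive frequencies are controlled by \<open>dz f\<close>. Conjugation reverses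
  frequencies and exchanges the two Wirtinger derivatives, so the negative ones are controlled by
  \<open>dzbar f\<close>; frequency 0 has weight 0.\<close>

lemma sum_fourier_le_dz:
  assumes f: "C_k 1 f" and A: "finite A"
  shows "pi * (\<Sum>n\<in>A. \<bar>of_int n\<bar> * (cmod (fcoeff (\<lambda>t. f (cis t)) n))\<^sup>2) \<le> disc_sq (dz f) + disc_sq (dzbar f)"
proof -
  define T where "T n = \<bar>of_int n\<bar> * (cmod (fcoeff (\<lambda>t. f (cis t)) n))\<^sup>2" for n :: int
  let ?P = "nat ` (A \<inter> {1..})" and ?N = "(\<lambda>n. nat (- n)) ` (A \<inter> {..-1})"
  have dc: "disc_sq (dz (\<lambda>z. cnj (f z))) = disc_sq (dzbar f)"
    using f by (simp add: disc_sq_def dz_cnj)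
  have p: "pi * sum T (A \<inter> {1..}) \<le> disc_sq (dz f)"
  proof -
    have "sum T (A \<inter> {1..}) = (\<Sum>n\<in>?P. n * (cmod (fcoeff (\<lambda>t. f (cis t)) (int n)))\<^sup>2)"
      by (subst sum.reindex) (auto simp: inj_on_def T_def intro!: sum.cong)
    moreover have le: "1 \<le> n" if "n \<in> ?P" for n using that by auto
    ultimately show ?thesis using sum_pos_fourier_le_dz[OF f _ le] A by simp
  qed
  have n: "pi * sum T (A \<inter> {..-1}) \<le> disc_sq (dzbar f)"
  proof -
    have "sum T (A \<inter> {..-1}) = (\<Sum>n\<in>?N. n * (cmod (fcoeff (\<lambda>t. cnj (f (cis t))) (int n)))\<^sup>2)"
      by (subst sum.reindex) (auto simp: inj_on_def T_def fcoeff_cnj intro!: sum.cong)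
    moreover have le: "1 \<le> n" if "n \<in> ?N" for n using that by auto
    ultimately show ?thesis using sum_pos_fourier_le_dz[OF C_k_cnj[OF f] _ le] A by (simp add: dc)
  qed
  have "sum T A = sum T (A \<inter> {1..}) + sum T (A \<inter> {..-1})"
  proof -
    have "sum T A = sum T ((A \<inter> {1..}) \<union> (A \<inter> {..-1}))"
      using A by (intro sum.mono_neutral_right) (auto simp: T_def not_le)
    also have "\<dots> = sum T (A \<inter> {1..}) + sum T (A \<inter> {..-1})"
      using A by (intro sum.union_disjoint) auto
    finally show ?thesis .
  qed
  then have "pi * sum T A \<le> disc_sq (dz f) + disc_sq (dzbar f)"
    using p n by (simp add: algebra_simps)
  then show ?thesis by (simp add: T_def)
qed

text \<open>Integration by parts, where periodicity removes the boundary terms. The derivative is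
  written with the factor i split off so that the multiplier is the integer n.\<close>

lemma fcoeff_derivative:
  assumes f: "\<And>t. (f has_vector_derivative \<i> * h t) (at t)" and h: "continuous_on UNIV h"
    and per: "f (2 * pi) = f 0"
  shows "fcoeff h n = n * fcoeff f n"
proof -
  have cf: "continuous_on UNIV f"
    using f by (meson continuous_at_imp_continuous_on has_vector_derivative_continuous)
  have i: "integrable circle_measure (\<lambda>t. f t * (\<i> * of_int (- n) * circle_char (- n) t))"
     "integrable circle_measure (\<lambda>t. \<i> * h t * circle_char (- n) t)"
    by (rule circle_integrable_continuous, intro continuous_intros cf h)+
  have d: "((\<lambda>t. f t * circle_char (- n) t) has_vector_derivative f t * (\<i> * of_int (- n) * circle_char (- n) t) + \<i> * h t * circle_char (- n) t) (at t)" for t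
    by (rule has_vector_derivative_mult[OF f circle_char_has_vector_derivative])
  have "(LINT t|circle_measure. f t * (\<i> * of_int (- n) * circle_char (- n) t) + \<i> * h t * circle_char (- n) t) =
      f (2 * pi) * circle_char (- n) (2 * pi) - f 0 * circle_char (- n) 0"
    by (rule circle_integral_derivative[OF d]) (intro continuous_intros cf h)
  also have "\<dots> = 0" using per by (simp add: circle_char_def[of _ 0])
  finally have "(LINT t|circle_measure. f t * (\<i> * of_int (- n) * circle_char (- n) t)) + (LINT t|circle_measure. \<i> * h t * circle_char (- n) t) = 0"
    using i by simp
  moreover have "(\<lambda>t. f t * (\<i> * of_int (- n) * circle_char (- n) t)) = (\<lambda>t. (\<i> * of_int (- n)) * (f t * circle_char (- n) t))"
    "(\<lambda>t. \<i> * h t * circle_char (- n) t) = (\<lambda>t. \<i> * (h t * circle_char (- n) t))"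
    by (simp_all add: fun_eq_iff)
  ultimately have "(\<i> * of_int (- n)) * (LINT t|circle_measure. f t * circle_char (- n) t) + \<i> * (LINT t|circle_measure. h t * circle_char (- n) t) = 0"
    by (simp only: integral_mult_right_zero)
  then show ?thesis by (simp add: fcoeff_def)
qed

text \<open>The tangent at \<open>cis t\<close> is i \<open>cis t\<close>. The combination in
  brackets is the same that Stokes' theorem produces in \<open>dz_minus_dzbar_boundary\<close>; this
  coincidence makes the boundary term a Fourier sum with weights n.\<close>

lemma circle_tangential_derivative:
  assumes "f differentiable (at (cis t))"
  shows "((\<lambda>t. f (cis t)) has_vector_derivative \<i> * (circle_char 1 t * dz f (cis t) - circle_char (- 1) t * dzbar f (cis t))) (at t)"
proof -
  have "(cis has_vector_derivative Complex (- sin t) (cos t)) (at t)"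
  proof -
    have "circle_char 1 = cis" by (simp add: circle_char_def fun_eq_iff)
    moreover have "\<i> * cis t = Complex (- sin t) (cos t)" by (simp add: complex_eq_iff)
    ultimately show ?thesis using circle_char_has_vector_derivative[of 1 t] by simp
  qed
  moreover have "dir_deriv (Complex (- sin t) (cos t)) f (cis t) =
     \<i> * (circle_char 1 t * dz f (cis t) - circle_char (- 1) t * dzbar f (cis t))"
    unfolding dir_deriv_Complex[OF assms]
    by (simp add: dz_def dzbar_def circle_char_def complex_eq_iff field_simps)
  ultimately show ?thesis using has_vector_derivative_dir_deriv[where g=cis, OF assms] by metis
qed

text \<open>With g the conjugate of f, the difference of the two energy densities is dz(f dzbar g) -
  dzbar(f dz g): the terms with second derivatives cancel because \<open>dz\<close> and
  \<open>dzbar\<close> commute. Stokes' theorem is then applied to each part.\<close>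

lemma dz_minus_dzbar_boundary:
  assumes f: "C_k 2 f"
  defines "h \<equiv> \<lambda>t. circle_char 1 t * dz f (cis t) - circle_char (- 1) t * dzbar f (cis t)"
  shows "of_real (disc_sq (dz f) - disc_sq (dzbar f)) = (LINT t|circle_measure. f (cis t) * cnj (h t)) / 2"
proof -
  have f1: "C_k 1 f" using f by (rule C_k_mono) simp
  let ?g = "\<lambda>z. cnj (f z)"
  have g: "C_k (Suc 1) ?g" using C_k_cnj[OF f] by (simp only: Suc_1)
  note g1 = C_k_dz[OF g]
  have df: "f differentiable (at z)" for z using f1 by simp
  have dg: "dz ?g differentiable (at z)" "dzbar ?g differentiable (at z)" for z using g1 by simp_all
  have e1: "dz (\<lambda>z. f z * dzbar ?g z) z = f z * dz (dzbar ?g) z + dz f z * cnj (dz f z)" for z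
    using dz_mult(1)[OF df dg(2)] by (simp add: dz_cnj[OF df])
  have e2: "dzbar (\<lambda>z. f z * dz ?g z) z = f z * dz (dzbar ?g) z + dzbar f z * cnj (dzbar f z)" for z
    using dz_mult(2)[OF df dg(1)] dz_dzbar_commute[of ?g z] C_k_cnj[OF f] by (simp add: dz_cnj[OF df])
  have c: "C_k 1 (\<lambda>z. f z * dzbar ?g z)" "C_k 1 (\<lambda>z. f z * dz ?g z)"
    using C_k_mult[OF f1 g1(2)] C_k_mult[OF f1 g1(1)] by auto
  have i: "integrable (lebesgue_on disc) (dz (\<lambda>z. f z * dzbar ?g z))" "integrable (lebesgue_on disc) (dzbar (\<lambda>z. f z * dz ?g z))"
    "integrable (lebesgue_on disc) (\<lambda>z. dz f z * cnj (dz f z))" "integrable (lebesgue_on disc) (\<lambda>z. dzbar f z * cnj (dzbar f z))"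
    by (rule disc_integrable_continuous, intro continuous_intros c f1)+
  have cc: "continuous_on UNIV (\<lambda>t. f (cis t))" "continuous_on UNIV (\<lambda>t. dz f (cis t))" "continuous_on UNIV (\<lambda>t. dzbar f (cis t))"
    by (rule continuous_on_compose2[of UNIV], intro continuous_intros f1 C_k_continuous[OF f1], intro continuous_intros, simp)+
  have j: "integrable circle_measure (\<lambda>t. f (cis t) * cnj (dz f (cis t)) * circle_char (- 1) t)"
     "integrable circle_measure (\<lambda>t. f (cis t) * cnj (dzbar f (cis t)) * circle_char 1 t)"
    by (rule circle_integrable_continuous, intro continuous_intros cc)+
  have "of_real (disc_sq (dz f) - disc_sq (dzbar f)) =
      (LINT z|lebesgue_on disc. dz f z * cnj (dz f z) - dzbar f z * cnj (dzbar f z))"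
    using i by (simp add: disc_integral_mult_cnj)
  also have "\<dots> = (LINT z|lebesgue_on disc. dz (\<lambda>z. f z * dzbar ?g z) z - dzbar (\<lambda>z. f z * dz ?g z) z)"
    by (simp add: e1 e2)
  also have "\<dots> = (LINT z|lebesgue_on disc. dz (\<lambda>z. f z * dzbar ?g z) z) - (LINT z|lebesgue_on disc. dzbar (\<lambda>z. f z * dz ?g z) z)"
    by (rule Bochner_Integration.integral_diff[OF i(1,2)])
  also have "\<dots> = ((LINT t|circle_measure. f (cis t) * cnj (dz f (cis t)) * circle_char (- 1) t)
      - (LINT t|circle_measure. f (cis t) * cnj (dzbar f (cis t)) * circle_char 1 t)) / 2"
    unfolding stokes(1)[OF c(1)] stokes(2)[OF c(2)] by (simp add: dz_cnj[OF df] diff_divide_distrib)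
  also have "\<dots> = (LINT t|circle_measure. f (cis t) * cnj (h t)) / 2"
    using j by (subst Bochner_Integration.integral_diff[symmetric]) (auto simp: h_def cnj_char algebra_simps)
  finally show ?thesis .
qed

text \<open>In the boundary integral f is replaced by a Fourier sum \<open>T\<close>, against which
  the tangential derivative \<open>h\<close> integrates to a finite sum with weights n. The
  replacement costs only the L^2 distance of f and \<open>T\<close>, as \<open>h\<close> is a fixed
  L^2 function; its Fourier series need not be summed.\<close>

lemma disc_sq_dz_le:
  assumes f: "C_k 2 f" and e: "0 < e"
  obtains A where "finite A"
    "disc_sq (dz f) \<le> disc_sq (dzbar f) + pi * (\<Sum>n\<in>A. \<bar>of_int n\<bar> * (cmod (fcoeff (\<lambda>t. f (cis t)) n))\<^sup>2) + e"
proof -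
  have f1: "C_k 1 f" using f by (rule C_k_mono) simp
  have df: "f differentiable (at z)" for z using f1 by simp
  define F where "F t = f (cis t)" for t
  define h where "h t = circle_char 1 t * dz f (cis t) - circle_char (- 1) t * dzbar f (cis t)" for t
  have cF: "continuous_on UNIV F" and ch: "continuous_on UNIV h"
  proof -
    have cc: "continuous_on UNIV (\<lambda>t. f (cis t))" "continuous_on UNIV (\<lambda>t. dz f (cis t))" "continuous_on UNIV (\<lambda>t. dzbar f (cis t))"
      by (rule continuous_on_compose2[of UNIV], intro continuous_intros f1 C_k_continuous[OF f1], intro continuous_intros, simp)+
    then show "continuous_on UNIV F" "continuous_on UNIV h"
      unfolding F_def[abs_def] h_def[abs_def] by (intro continuous_intros cc)+
  qed
  have hc: "fcoeff h n = n * fcoeff F n" for n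
    by (rule fcoeff_derivative)
      (use circle_tangential_derivative[OF df] ch in \<open>auto simp: F_def[abs_def] h_def\<close>)
  define K where "K = (LINT t|circle_measure. (cmod (h t))\<^sup>2)"
  \<comment> \<open>With this \<open>d\<close> as Young parameter and F approximated to within d e,
    each of the two error terms is at most e/2. The summand 1 keeps the denominator positive when h
    vanishes.\<close>
  define d where "d = e / (K + 1)"
  have K: "0 \<le> K" by (simp add: K_def)
  have d: "0 < d" "d * K \<le> e" using e K by (auto simp: d_def field_simps)
  obtain A where A: "finite A" and S: "(LINT t|circle_measure. (cmod (F t - trig A (fcoeff F) t))\<^sup>2) \<le> d * e"
    using fourier_sum_converges[OF C_k_continuous[OF f1], of "d * e"] d e
    unfolding F_def[symmetric] by (metis mult_pos_pos)
  define T where "T = trig A (fcoeff F)"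
  have cT: "continuous_on UNIV T" unfolding T_def by (intro continuous_intros)
  have i: "integrable circle_measure (\<lambda>t. (F t - T t) * cnj (h t))" "integrable circle_measure (\<lambda>t. cnj (h t * cnj (T t)))"
    by (rule circle_integrable_continuous, intro continuous_intros cF cT ch)+
  have j: "integrable circle_measure (\<lambda>t. cmod ((F t - T t) * cnj (h t)))"
    "integrable circle_measure (\<lambda>t. (cmod (F t - T t))\<^sup>2 / (2 * d))" "integrable circle_measure (\<lambda>t. d / 2 * (cmod (h t))\<^sup>2)"
    using d by (intro circle_integrable_continuous continuous_intros cF cT ch; simp)+
  have "2 * complex_of_real (disc_sq (dz f) - disc_sq (dzbar f)) = (LINT t|circle_measure. F t * cnj (h t))"
    unfolding dz_minus_dzbar_boundary[OF f] F_def h_def by simp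
  also have "\<dots> = (LINT t|circle_measure. (F t - T t) * cnj (h t) + cnj (h t * cnj (T t)))"
    by (simp add: algebra_simps)
  also have "\<dots> = (LINT t|circle_measure. (F t - T t) * cnj (h t)) + (LINT t|circle_measure. cnj (h t * cnj (T t)))"
    by (rule Bochner_Integration.integral_add[OF i])
  also have "(LINT t|circle_measure. cnj (h t * cnj (T t))) = cnj (2 * pi * (\<Sum>n\<in>A. fcoeff h n * cnj (fcoeff F n)))"
    unfolding Bochner_Integration.integral_cnj T_def by (subst integral_mult_cnj_trig[OF ch A]) (rule refl)
  also have "(\<Sum>n\<in>A. fcoeff h n * cnj (fcoeff F n)) = of_real (\<Sum>n\<in>A. n * (cmod (fcoeff F n))\<^sup>2)"
    by (simp add: hc complex_norm_square mult.assoc del: of_real_power)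
  finally have main: "2 * complex_of_real (disc_sq (dz f) - disc_sq (dzbar f)) =
      (LINT t|circle_measure. (F t - T t) * cnj (h t)) + of_real (2 * pi * (\<Sum>n\<in>A. n * (cmod (fcoeff F n))\<^sup>2))"
    by simp
  have "cmod (LINT t|circle_measure. (F t - T t) * cnj (h t)) \<le> (LINT t|circle_measure. (cmod (F t - T t))\<^sup>2 / (2 * d) + d / 2 * (cmod (h t))\<^sup>2)"
  proof (rule order_trans[OF integral_norm_bound integral_mono])
    fix t
    have "a * b \<le> a\<^sup>2 / (2 * d) + d / 2 * b\<^sup>2" for a b :: real
    proof -
      have "0 \<le> (a - d * b)\<^sup>2 / (2 * d)" using d by simp
      also have "\<dots> = a\<^sup>2 / (2 * d) + d / 2 * b\<^sup>2 - a * b"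
        using d by (simp add: power2_eq_square field_simps)
      finally show ?thesis by simp
    qed
    then show "cmod ((F t - T t) * cnj (h t)) \<le> (cmod (F t - T t))\<^sup>2 / (2 * d) + d / 2 * (cmod (h t))\<^sup>2"
      by (simp add: norm_mult)
  qed (use j in auto)
  also have "\<dots> = (LINT t|circle_measure. (cmod (F t - T t))\<^sup>2) / (2 * d) + d / 2 * K"
    using j(2,3) by (simp add: K_def)
  also have "\<dots> \<le> (d * e) / (2 * d) + e / 2"
    using S d by (intro add_mono divide_right_mono) (auto simp: T_def)
  also have "\<dots> = e" using d by simp
  finally have small: "cmod (LINT t|circle_measure. (F t - T t) * cnj (h t)) \<le> e" .
  have "2 * (disc_sq (dz f) - disc_sq (dzbar f)) =
      Re (LINT t|circle_measure. (F t - T t) * cnj (h t)) + 2 * pi * (\<Sum>n\<in>A. n * (cmod (fcoeff F n))\<^sup>2)"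
    using arg_cong[OF main, of Re] by simp
  \<comment> \<open>Only an upper bound is wanted, so the terms with n < 0, which are at most 0, may
    be counted with |n|.\<close>
  also have "\<dots> \<le> e + 2 * pi * (\<Sum>n\<in>A. \<bar>of_int n\<bar> * (cmod (fcoeff F n))\<^sup>2)"
    using small complex_Re_le_cmod[of "LINT t|circle_measure. (F t - T t) * cnj (h t)"]
    by (intro add_mono mult_left_mono sum_mono mult_right_mono) auto
  finally have "disc_sq (dz f) \<le> disc_sq (dzbar f) + pi * (\<Sum>n\<in>A. \<bar>of_int n\<bar> * (cmod (fcoeff F n))\<^sup>2) + e"
    using e by (simp add: algebra_simps)
  with A show ?thesis using that by (simp add: F_def[abs_def])
qed

lemma circle_sq_le_fourier:
  assumes f: "continuous_on UNIV f" and e: "0 < e"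
  obtains A where "finite A" "circle_sq f \<le> 2 * pi * (\<Sum>n\<in>A. (cmod (fcoeff (\<lambda>t. f (cis t)) n))\<^sup>2) + e"
proof -
  have c: "continuous_on UNIV (\<lambda>t. f (cis t))"
    by (intro continuous_on_compose2[OF f] continuous_intros) auto
  obtain A where A: "finite A" "(LINT t|circle_measure. (cmod (f (cis t) - trig A (fcoeff (\<lambda>t. f (cis t))) t))\<^sup>2) \<le> e"
    using fourier_sum_converges[OF f e] .
  show ?thesis
    using A by (intro that[OF A(1)]) (simp add: trig_approx_identity[OF c A(1)] circle_sq_def)
qed

section \<open>The smooth estimates in terms of the extended norms\<close>

lemma L2_norm_sq_continuous:
  assumes "continuous_on UNIV f" shows "L2_norm_sq f = ennreal (disc_sq f)"
  unfolding L2_norm_sq_def disc_sq_def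
  by (intro nn_integral_eq_integral disc_integrable_continuous(1) continuous_intros assms) simp

lemma circle_L2_norm_sq_continuous:
  assumes "continuous_on UNIV f" shows "circle_L2_norm_sq f = ennreal (circle_sq f)"
proof -
  have "continuous_on UNIV (\<lambda>t. f (cis t))"
    by (intro continuous_on_compose2[OF assms] continuous_intros) auto
  then show ?thesis
    unfolding circle_L2_norm_sq_def circle_sq_def
    by (intro nn_integral_eq_integral circle_integrable_continuous continuous_intros) auto
qed

text \<open>A finite section of the squared H^(1/2) norm on the circle. Being real, it allows
  ordinary algebra before the supremum over \<open>A\<close> is taken.\<close>

definition weighted_sum :: "int set \<Rightarrow> (complex \<Rightarrow> complex) \<Rightarrow> real" where
  "weighted_sum A g = (\<Sum>n\<in>A. (1 + \<bar>of_int n\<bar>) * (cmod (fourier_coeff g n))\<^sup>2)"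

lemma Hs_half_eq_SUP:
  "Hs_circle_norm_sq (1/2) g = (SUP A\<in>{A. finite A}. ennreal (weighted_sum A g))"
proof -
  have "(\<Sum>n\<in>A. ennreal ((1 + \<bar>real_of_int n\<bar>) powr (2 * (1/2)) * (cmod (fourier_coeff g n))\<^sup>2)) = ennreal (weighted_sum A g)"
    for A
    unfolding weighted_sum_def by (subst sum_ennreal) auto
  then show ?thesis
    unfolding Hs_circle_norm_sq_def by (subst nonneg_infsum_complete) auto
qed

lemma weighted_sum_le_Hs: "finite A \<Longrightarrow> ennreal (weighted_sum A g) \<le> Hs_circle_norm_sq (1/2) g"
  unfolding Hs_half_eq_SUP by (rule SUP_upper) simp

lemma Hs_half_leI: "(\<And>A. finite A \<Longrightarrow> ennreal (weighted_sum A g) \<le> X) \<Longrightarrow> Hs_circle_norm_sq (1/2) g \<le> X"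
  unfolding Hs_half_eq_SUP by (rule SUP_least) simp

lemma weighted_sum_nonneg: "0 \<le> weighted_sum A g"
  unfolding weighted_sum_def by (intro sum_nonneg) simp

text \<open>Finite frequency sets mediate in both directions. A bound by the H^(1/2) norm uses one
  finite set and an arbitrary error e; a bound of that norm is checked on every finite set.\<close>

lemma
  assumes f: "C_k 2 f"
  shows L2_dz_le: "L2_norm_sq (dz f) \<le> L2_norm_sq (dzbar f) + ennreal pi * Hs_circle_norm_sq (1/2) f"
    and L2_le: "L2_norm_sq f \<le> ennreal (2 * pi) * Hs_circle_norm_sq (1/2) f + 2 * (L2_norm_sq (dz f) + L2_norm_sq (dzbar f))"
    and Hs_le: "Hs_circle_norm_sq (1/2) f \<le> L2_norm_sq f + L2_norm_sq (dz f) + L2_norm_sq (dzbar f)"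
    and circle_L2_le: "circle_L2_norm_sq f \<le> 3 * (L2_norm_sq f + L2_norm_sq (dz f) + L2_norm_sq (dzbar f))"
proof -
  have f1: "C_k 1 f" using f by (rule C_k_mono) simp
  note cf = C_k_continuous[OF f]
  have L: "L2_norm_sq f = ennreal (disc_sq f)" "L2_norm_sq (dz f) = ennreal (disc_sq (dz f))"
    "L2_norm_sq (dzbar f) = ennreal (disc_sq (dzbar f))" "circle_L2_norm_sq f = ennreal (circle_sq f)"
    by (intro L2_norm_sq_continuous circle_L2_norm_sq_continuous cf continuous_on_dz f1)+
  have fc: "(\<lambda>n. fcoeff (\<lambda>t. f (cis t)) n) = fourier_coeff f"
    by (simp add: fourier_coeff_eq fun_eq_iff)
  note nn = disc_sq_nonneg[of f] disc_sq_nonneg[of "dz f"] disc_sq_nonneg[of "dzbar f"]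
  show "L2_norm_sq (dz f) \<le> L2_norm_sq (dzbar f) + ennreal pi * Hs_circle_norm_sq (1/2) f"
  proof (rule ennreal_le_epsilon)
    fix e :: real assume e: "0 < e"
    obtain A where A: "finite A" "disc_sq (dz f) \<le> disc_sq (dzbar f) + pi * (\<Sum>n\<in>A. \<bar>of_int n\<bar> * (cmod (fourier_coeff f n))\<^sup>2) + e"
      using disc_sq_dz_le[OF f e] unfolding fourier_coeff_eq by blast
    have "(\<Sum>n\<in>A. \<bar>of_int n\<bar> * (cmod (fourier_coeff f n))\<^sup>2) \<le> weighted_sum A f"
      unfolding weighted_sum_def by (intro sum_mono mult_right_mono) auto
    then have "pi * (\<Sum>n\<in>A. \<bar>of_int n\<bar> * (cmod (fourier_coeff f n))\<^sup>2) \<le> pi * weighted_sum A f"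
      by (rule mult_left_mono) simp
    then have "disc_sq (dz f) \<le> disc_sq (dzbar f) + pi * weighted_sum A f + e"
      using A(2) by linarith
    then have "L2_norm_sq (dz f) \<le> ennreal (disc_sq (dzbar f) + pi * weighted_sum A f + e)"
      unfolding L by (rule ennreal_leI)
    also have "\<dots> = L2_norm_sq (dzbar f) + ennreal pi * ennreal (weighted_sum A f) + ennreal e"
      unfolding L using nn e by (simp add: ennreal_plus ennreal_mult weighted_sum_nonneg)
    also have "\<dots> \<le> L2_norm_sq (dzbar f) + ennreal pi * Hs_circle_norm_sq (1/2) f + ennreal e"
      by (intro add_mono mult_left_mono weighted_sum_le_Hs A) auto
    finally show "L2_norm_sq (dz f) \<le> L2_norm_sq (dzbar f) + ennreal pi * Hs_circle_norm_sq (1/2) f + ennreal e" .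
  qed
  show "L2_norm_sq f \<le> ennreal (2 * pi) * Hs_circle_norm_sq (1/2) f + 2 * (L2_norm_sq (dz f) + L2_norm_sq (dzbar f))"
  proof (rule ennreal_le_epsilon)
    fix e :: real assume e: "0 < e"
    obtain A where A: "finite A" "circle_sq f \<le> 2 * pi * (\<Sum>n\<in>A. (cmod (fourier_coeff f n))\<^sup>2) + e"
      using circle_sq_le_fourier[OF cf e] unfolding fourier_coeff_eq by blast
    have "(\<Sum>n\<in>A. 1 * (cmod (fourier_coeff f n))\<^sup>2) \<le> weighted_sum A f"
      unfolding weighted_sum_def by (intro sum_mono mult_right_mono) auto
    then have "2 * pi * (\<Sum>n\<in>A. (cmod (fourier_coeff f n))\<^sup>2) \<le> 2 * pi * weighted_sum A f" by simp
    then have "disc_sq f \<le> 2 * pi * weighted_sum A f + 2 * (disc_sq (dz f) + disc_sq (dzbar f)) + e"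
      using order_trans[OF A(2) add_right_mono] disc_sq_le[OF f1] by fastforce
    then have "L2_norm_sq f \<le> ennreal (2 * pi * weighted_sum A f + 2 * (disc_sq (dz f) + disc_sq (dzbar f)) + e)"
      unfolding L by (rule ennreal_leI)
    also have "\<dots> = ennreal (2 * pi) * ennreal (weighted_sum A f) + 2 * (L2_norm_sq (dz f) + L2_norm_sq (dzbar f)) + ennreal e"
      unfolding L using nn e by (simp add: ennreal_plus ennreal_mult weighted_sum_nonneg)
    also have "\<dots> \<le> ennreal (2 * pi) * Hs_circle_norm_sq (1/2) f + 2 * (L2_norm_sq (dz f) + L2_norm_sq (dzbar f)) + ennreal e"
      by (intro add_mono mult_left_mono weighted_sum_le_Hs A) auto
    finally show "L2_norm_sq f \<le> ennreal (2 * pi) * Hs_circle_norm_sq (1/2) f + 2 * (L2_norm_sq (dz f) + L2_norm_sq (dzbar f)) + ennreal e" .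
  qed
  show "Hs_circle_norm_sq (1/2) f \<le> L2_norm_sq f + L2_norm_sq (dz f) + L2_norm_sq (dzbar f)"
  proof (rule Hs_half_leI)
    fix A :: "int set" assume A: "finite A"
    have "2 * pi * (\<Sum>n\<in>A. (cmod (fourier_coeff f n))\<^sup>2) \<le> circle_sq f"
      unfolding circle_sq_def fourier_coeff_eq
      by (intro bessel continuous_on_compose2[OF cf] continuous_intros A) auto
    moreover have "pi * (\<Sum>n\<in>A. \<bar>of_int n\<bar> * (cmod (fourier_coeff f n))\<^sup>2) \<le> disc_sq (dz f) + disc_sq (dzbar f)"
      unfolding fourier_coeff_eq by (rule sum_fourier_le_dz[OF f1 A])
    moreover have "weighted_sum A f = (\<Sum>n\<in>A. (cmod (fourier_coeff f n))\<^sup>2) + (\<Sum>n\<in>A. \<bar>of_int n\<bar> * (cmod (fourier_coeff f n))\<^sup>2)"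
      by (simp add: weighted_sum_def sum.distrib algebra_simps)
    ultimately have "2 * pi * weighted_sum A f \<le> circle_sq f + 2 * (disc_sq (dz f) + disc_sq (dzbar f))"
      by (simp add: algebra_simps)
    also have "\<dots> \<le> 4 * (disc_sq f + disc_sq (dz f) + disc_sq (dzbar f))"
      using circle_sq_le[OF f1] nn by (simp add: algebra_simps)
    \<comment> \<open>Since 4 <= 2 pi, dividing by 2 pi leaves the constant 1.\<close>
    also have "\<dots> \<le> (2 * pi) * (disc_sq f + disc_sq (dz f) + disc_sq (dzbar f))"
      using nn pi_ge_two by (intro mult_right_mono) auto
    finally have "weighted_sum A f \<le> disc_sq f + disc_sq (dz f) + disc_sq (dzbar f)"
      by (simp add: mult_le_cancel_left_pos)
    then have "ennreal (weighted_sum A f) \<le> ennreal (disc_sq f + disc_sq (dz f) + disc_sq (dzbar f))"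
      by (rule ennreal_leI)
    then show "ennreal (weighted_sum A f) \<le> L2_norm_sq f + L2_norm_sq (dz f) + L2_norm_sq (dzbar f)"
      unfolding L using nn by (simp add: ennreal_plus)
  qed
  have "circle_sq f \<le> 3 * (disc_sq f + disc_sq (dz f) + disc_sq (dzbar f))"
    using circle_sq_le[OF f1] nn by (simp add: algebra_simps)
  then have "ennreal (circle_sq f) \<le> ennreal (3 * (disc_sq f + disc_sq (dz f) + disc_sq (dzbar f)))"
    by (rule ennreal_leI)
  then show "circle_L2_norm_sq f \<le> 3 * (L2_norm_sq f + L2_norm_sq (dz f) + L2_norm_sq (dzbar f))"
    unfolding L using nn by (simp add: ennreal_plus ennreal_mult)
qed

text \<open>The slack, beyond the triangle inequality, is the square (t |a| - |b|)^2 / t. The factor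
  1 + t can be taken arbitrarily near 1, which both the passage to the limit and the telescoping
  exploit.\<close>

lemma cmod_add_sq_le:
  assumes "0 < t"
  shows "(cmod (a + b))\<^sup>2 \<le> (1 + t) * (cmod a)\<^sup>2 + (1 + 1 / t) * (cmod b)\<^sup>2"
proof -
  have "(cmod (a + b))\<^sup>2 \<le> (cmod a + cmod b)\<^sup>2" by (intro power_mono norm_triangle_ineq) simp
  also have "\<dots> = (1 + t) * (cmod a)\<^sup>2 + (1 + 1 / t) * (cmod b)\<^sup>2 - (t * cmod a - cmod b)\<^sup>2 / t"
    using assms by (simp add: power2_eq_square field_simps)
  also have "\<dots> \<le> (1 + t) * (cmod a)\<^sup>2 + (1 + 1 / t) * (cmod b)\<^sup>2" using assms by simp
  finally show ?thesis .
qed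

lemma nn_integral_cmod_add_sq_le:
  fixes u f g :: "'a \<Rightarrow> complex"
  assumes f: "f \<in> borel_measurable M" and g: "g \<in> borel_measurable M" and t: "0 < t"
    and u: "AE z in M. u z = f z + g z"
  shows "(\<integral>\<^sup>+z. ennreal ((cmod (u z))\<^sup>2) \<partial>M) \<le>
    ennreal (1 + t) * (\<integral>\<^sup>+z. ennreal ((cmod (f z))\<^sup>2) \<partial>M) + ennreal (1 + 1 / t) * (\<integral>\<^sup>+z. ennreal ((cmod (g z))\<^sup>2) \<partial>M)"
proof -
  note [measurable] = f g
  have "(\<integral>\<^sup>+z. ennreal ((cmod (u z))\<^sup>2) \<partial>M) \<le>
      (\<integral>\<^sup>+z. ennreal (1 + t) * ennreal ((cmod (f z))\<^sup>2) + ennreal (1 + 1 / t) * ennreal ((cmod (g z))\<^sup>2) \<partial>M)"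
  proof (rule nn_integral_mono_AE)
    show "AE z in M. ennreal ((cmod (u z))\<^sup>2) \<le> ennreal (1 + t) * ennreal ((cmod (f z))\<^sup>2) + ennreal (1 + 1 / t) * ennreal ((cmod (g z))\<^sup>2)"
      using u
    proof eventually_elim
      case (elim z)
      have "ennreal ((cmod (u z))\<^sup>2) \<le> ennreal ((1 + t) * (cmod (f z))\<^sup>2 + (1 + 1 / t) * (cmod (g z))\<^sup>2)"
        unfolding elim by (rule ennreal_leI[OF cmod_add_sq_le[OF t]])
      also have "\<dots> = ennreal (1 + t) * ennreal ((cmod (f z))\<^sup>2) + ennreal (1 + 1 / t) * ennreal ((cmod (g z))\<^sup>2)"
        using t by (simp add: ennreal_plus ennreal_mult del: ennreal_1)
      finally show ?case .
    qed
  qed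
  also have "\<dots> = ennreal (1 + t) * (\<integral>\<^sup>+z. ennreal ((cmod (f z))\<^sup>2) \<partial>M) + ennreal (1 + 1 / t) * (\<integral>\<^sup>+z. ennreal ((cmod (g z))\<^sup>2) \<partial>M)"
    by (simp add: nn_integral_add nn_integral_cmult)
  finally show ?thesis .
qed

section \<open>Mollification\<close>

text \<open>The powers of t in the denominator make the family closed under differentiation, up to
  linear combinations, so that smoothness follows by induction on the order.\<close>

definition bump :: "nat \<Rightarrow> real \<Rightarrow> real" where
  "bump m t = (if 0 < t then exp (- 1 / t) / t ^ m else 0)"

lemma bump_nonneg: "0 \<le> bump m t"
  by (simp add: bump_def)

text \<open>Any power of 1/t is dominated by exp(1/t), through (1 + x/n)^n <= exp x with n = m + 2.
  The two powers of t beyond t^m give a quadratic bound, and with it the derivative 0 at t =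
  0.\<close>

lemma bump_le:
  assumes "t \<le> 1" shows "bump m t \<le> of_nat (m + 2) ^ (m + 2) * t\<^sup>2"
proof (cases "0 < t")
  case True
  define n where "n = m + 2"
  have n: "0 < n" by (simp add: n_def)
  have "1 / (t * n) ^ n = (1 / t / n) ^ n"
    by (simp add: power_divide power_mult_distrib)
  also have "\<dots> \<le> (1 + 1 / t / n) ^ n"
    using True by (intro power_mono) auto
  also have "\<dots> \<le> exp (1 / t)"
    using True n by (intro exp_ge_one_plus_x_over_n_power_n) (auto intro: order_trans[of _ 0])
  finally have "1 / (t * n) ^ n \<le> exp (1 / t)" .
  then have "inverse (exp (1 / t)) \<le> inverse (1 / (t * n) ^ n)"
    using True n by (intro le_imp_inverse_le) auto
  then have "exp (- 1 / t) \<le> (t * n) ^ n"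
    by (simp add: exp_minus[symmetric])
  then have "exp (- 1 / t) / t ^ m \<le> (t * n) ^ n / t ^ m"
    using True by (intro divide_right_mono) auto
  also have "\<dots> = of_nat n ^ n * t\<^sup>2"
  proof -
    have "t ^ n = t ^ m * t\<^sup>2" by (simp add: n_def power_add power2_eq_square)
    then show ?thesis using True by (simp add: power_mult_distrib)
  qed
  finally show ?thesis using True by (simp add: bump_def n_def)
qed (auto simp: bump_def)

lemma bump_has_derivative:
  "(bump m has_real_derivative bump (m + 2) t - m * bump (m + 1) t) (at t)"
proof (cases t "0 :: real" rule: linorder_cases)
  case less
  have "((\<lambda>_. 0) has_real_derivative 0) (at t)" by simp
  then have "(bump m has_real_derivative 0) (at t)"
    by (rule has_field_derivative_transform_within_open[of _ _ _ "{..<0}"])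
      (use less in \<open>auto simp: bump_def\<close>)
  then show ?thesis using less by (simp add: bump_def)
next
  case equal
  define C where "C = real (m + 2) ^ (m + 2)"
  have "((\<lambda>h. C * \<bar>h\<bar>) \<longlongrightarrow> C * \<bar>0\<bar>) (at 0)" by (intro tendsto_intros)
  then have lim: "((\<lambda>h. C * \<bar>h\<bar>) \<longlongrightarrow> 0) (at 0)" by simp
  have "eventually (\<lambda>h. \<bar>h\<bar> < 1) (at (0 :: real))"
    using eventually_at_ball[of 1 "0 :: real" UNIV] by (auto simp: dist_real_def)
  then have "eventually (\<lambda>h. norm ((bump m h - 0) / (h - 0)) \<le> C * \<bar>h\<bar>) (at 0)"
    using eventually_neq_at_within[of 0 0 UNIV]
  proof eventually_elim
    case (elim h)
    then have "\<bar>bump m h\<bar> \<le> C * h\<^sup>2" using bump_le[of h m] bump_nonneg[of m h] by (simp add: C_def)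
    then have "\<bar>bump m h\<bar> / \<bar>h\<bar> \<le> C * h\<^sup>2 / \<bar>h\<bar>" by (rule divide_right_mono) simp
    also have "\<dots> = C * \<bar>h\<bar>"
      using elim by (cases "0 \<le> h") (auto simp: power2_eq_square)
    finally show ?case by simp
  qed
  from Lim_null_comparison[OF this lim] have "(bump m has_real_derivative 0) (at 0)"
    by (simp add: has_field_derivative_iff bump_def)
  then show ?thesis using equal by (simp add: bump_def)
next
  case greater
  have "((\<lambda>t. exp (- 1 / t) / t ^ m) has_real_derivative bump (m + 2) t - m * bump (m + 1) t) (at t)"
    using greater
    by (auto intro!: derivative_eq_intros simp: bump_def field_simps power2_eq_square)
      (cases m; simp)
  then show ?thesis
    by (rule has_field_derivative_transform_within_open[of _ _ _ "{0<..}"])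
      (use greater in \<open>auto simp: bump_def\<close>)
qed

lemma C_k_inner: "C_k k (\<lambda>z. of_real (z \<bullet> e))"
proof -
  have "bounded_linear (\<lambda>z. complex_of_real (z \<bullet> e))"
    by (intro bounded_linear_compose[OF bounded_linear_of_real] bounded_linear_inner_left)
  then show ?thesis by (rule C_k_bounded_linear) (rule C_k_ident)
qed

text \<open>The smooth factor \<open>p\<close> is carried along to make the induction close:
  differentiating the bump produces a factor z . e, which is absorbed into \<open>p\<close>, while
  the index m is raised.\<close>

lemma C_k_bump:
  assumes "\<And>j. C_k j p"
  shows "C_k k (\<lambda>z. of_real (bump m (1 - z \<bullet> z)) * p z)"
  using assms
proof (induction k arbitrary: m p)
  have D: "((\<lambda>z. of_real (bump m (1 - z \<bullet> z)) * p z) has_derivative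
     (\<lambda>e. of_real (bump m (1 - z \<bullet> z)) * dir_deriv e p z
        + of_real ((bump (m + 2) (1 - z \<bullet> z) - m * bump (m + 1) (1 - z \<bullet> z)) * (- 2 * (z \<bullet> e))) * p z)) (at z)"
    if p: "\<And>j. C_k j p" for m p and z :: complex
  proof -
    have s: "((\<lambda>z::complex. 1 - z \<bullet> z) has_derivative (\<lambda>e. - 2 * (z \<bullet> e))) (at z)"
      by (auto intro!: derivative_eq_intros simp: inner_commute)
    have "((\<lambda>z. bump m (1 - z \<bullet> z)) has_derivative
        (\<lambda>e. (bump (m + 2) (1 - z \<bullet> z) - m * bump (m + 1) (1 - z \<bullet> z)) * (- 2 * (z \<bullet> e)))) (at z)"
      by (rule has_derivative_compose[OF s bump_has_derivative[unfolded has_field_derivative_def]])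
    then show ?thesis
      by (intro has_derivative_mult has_derivative_of_real C_k_has_derivative[OF p])
  qed
  {
    case 0
    show ?case
      unfolding C_k.simps
      by (intro continuous_at_imp_continuous_on ballI has_derivative_continuous[OF D[OF 0]])
  next
    case (Suc k)
    note p = Suc.prems
    have q: "C_k j (\<lambda>z. of_real c * (of_real (z \<bullet> e) * p z))" for j c e
      by (intro C_k_cmult C_k_mult C_k_inner p)
    have eq: "dir_deriv e (\<lambda>z. of_real (bump m (1 - z \<bullet> z)) * p z) = (\<lambda>z. of_real (bump m (1 - z \<bullet> z)) * dir_deriv e p z
        + (of_real (bump (m + 2) (1 - z \<bullet> z)) * (of_real (- 2) * (of_real (z \<bullet> e) * p z))
           + of_real (bump (m + 1) (1 - z \<bullet> z)) * (of_real (2 * real m) * (of_real (z \<bullet> e) * p z))))" for e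
      by (rule ext, subst dir_deriv_eqI[OF D[OF p]]) (simp add: algebra_simps)
    have "C_k k (dir_deriv e (\<lambda>z. of_real (bump m (1 - z \<bullet> z)) * p z))" for e
      unfolding eq by (intro C_k_add Suc.IH q C_k_dir_deriv[OF p])
    moreover have "(\<lambda>z. of_real (bump m (1 - z \<bullet> z)) * p z) differentiable (at z)" for z
      using D[OF p] by (rule differentiableI)
    ultimately show ?case by simp
  }
qed

definition eta_int :: real where
  "eta_int = (LINT z|lborel. bump 0 (1 - z \<bullet> (z :: complex)))"

definition eta :: "complex \<Rightarrow> real" where
  "eta z = bump 0 (1 - z \<bullet> z) / eta_int"

lemma continuous_on_bump: "continuous_on UNIV (bump m)"
  by (intro continuous_at_imp_continuous_on ballI DERIV_isCont[OF bump_has_derivative])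

lemma bump_pos_iff: "0 < bump 0 (1 - z \<bullet> z) \<longleftrightarrow> z \<in> disc" "bump 0 (1 - z \<bullet> z) = 0 \<longleftrightarrow> z \<notin> disc"
  by (auto simp: bump_def dot_square_norm abs_square_less_1 not_less)

lemma continuous_on_bump_inner: "continuous_on A (\<lambda>z::complex. bump m (1 - z \<bullet> z))"
  by (intro continuous_on_compose2[OF continuous_on_bump] continuous_intros) auto

lemma integrable_bump: "integrable lborel (\<lambda>z::complex. bump 0 (1 - z \<bullet> z))"
proof -
  have "(\<lambda>z. indicator disc z *\<^sub>R bump 0 (1 - z \<bullet> z)) = (\<lambda>z::complex. bump 0 (1 - z \<bullet> z))"
    using bump_pos_iff(2) by (fastforce simp: fun_eq_iff indicator_def)
  then show ?thesis using disc_integrable_continuous(2)[OF continuous_on_bump_inner[of UNIV 0]] by simp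
qed

lemma eta_int_pos: "0 < eta_int"
proof -
  have "eta_int \<noteq> 0"
  proof
    assume "eta_int = 0"
    then have "AE z in lborel. bump 0 (1 - z \<bullet> (z :: complex)) = 0"
      unfolding eta_int_def
      by (subst (asm) integral_nonneg_eq_0_iff_AE) (auto simp: integrable_bump bump_nonneg)
    then have "AE z::complex in lborel. z \<notin> disc" by (simp only: bump_pos_iff(2))
    then have "disc \<in> null_sets lborel" by (subst AE_iff_null_sets) auto
    then have "negligible disc"
      by (simp add: negligible_iff_null_sets null_sets_completionI)
    then show False using open_not_negligible[of disc] by auto
  qed
  moreover have "0 \<le> eta_int" unfolding eta_int_def by (simp add: bump_nonneg)
  ultimately show ?thesis by simp
qed

lemma eta_nonneg: "0 \<le> eta z"
  using eta_int_pos by (simp add: eta_def bump_nonneg)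

lemma eta_eq_0_iff: "eta z = 0 \<longleftrightarrow> z \<notin> disc"
  using eta_int_pos bump_pos_iff(2)[of z] by (auto simp: eta_def)

lemma continuous_on_eta: "continuous_on A eta"
  unfolding eta_def[abs_def] using eta_int_pos
  by (intro continuous_intros continuous_on_bump_inner) auto

lemma nn_integral_eta: "(\<integral>\<^sup>+z. ennreal (eta z) \<partial>lborel) = 1"
proof -
  have "(\<integral>\<^sup>+z. ennreal (eta z) \<partial>lborel) = ennreal (LINT z|lborel. eta z)"
    by (rule nn_integral_eq_integral) (simp add: eta_def[abs_def] integrable_bump, simp add: eta_nonneg)
  also have "(LINT z|lborel. eta z) = 1"
    using eta_int_pos by (simp add: eta_def) (simp add: eta_int_def)
  finally show ?thesis by simp
qed

lemma C_k_eta: "C_k k (\<lambda>z. of_real (eta z))"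
  using C_k_cmult[OF C_k_bump[OF C_k_const, of k 0 1], of "of_real (1 / eta_int)"]
  by (simp add: eta_def)

text \<open>For \<open>z\<close> in the disc the mollifier is supported in the ball of radius \<open>\<epsilon>\<close> about
  \<open>(1 - \<epsilon>) z\<close>, hence inside the disc: mollification combined with dilation.\<close>

definition mollifier :: "real \<Rightarrow> complex \<Rightarrow> complex \<Rightarrow> real" where
  "mollifier \<epsilon> z \<zeta> = eta ((\<zeta> - (1 - \<epsilon>) *\<^sub>R z) /\<^sub>R \<epsilon>) / \<epsilon>\<^sup>2"

lemma mollifier_nonneg: "0 \<le> mollifier \<epsilon> z \<zeta>"
  by (simp add: mollifier_def eta_nonneg)

lemma continuous_on_mollifier: "continuous_on UNIV (\<lambda>p. mollifier \<epsilon> (fst p) (snd p))"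
  unfolding mollifier_def divide_inverse
  by (intro continuous_intros continuous_on_compose2[OF continuous_on_eta[of UNIV]]) auto

lemma mollifier_measurable [measurable]:
  "(\<lambda>p. mollifier \<epsilon> (fst p) (snd p)) \<in> borel_measurable (lborel \<Otimes>\<^sub>M lborel)"
  unfolding lborel_prod using borel_measurable_continuous_onI[OF continuous_on_mollifier] by simp

lemma continuous_on_mollifier2: "continuous_on A (mollifier \<epsilon> z)" "continuous_on A (\<lambda>z. mollifier \<epsilon> z \<zeta>)"
  by (intro continuous_on_compose2[OF continuous_on_mollifier, of _ "\<lambda>\<zeta>. (z, \<zeta>)", simplified]
     continuous_on_compose2[OF continuous_on_mollifier, of _ "\<lambda>z. (z, \<zeta>)", simplified] continuous_intros)+

lemma mollifier_eq_0:
  assumes "0 < \<epsilon>" "\<epsilon> \<le> cmod (\<zeta> - (1 - \<epsilon>) *\<^sub>R z)"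
  shows "mollifier \<epsilon> z \<zeta> = 0"
proof -
  have "(\<zeta> - (1 - \<epsilon>) *\<^sub>R z) /\<^sub>R \<epsilon> \<notin> disc" using assms by (simp add: divide_simps)
  then show ?thesis by (simp only: mollifier_def eta_eq_0_iff[symmetric])
qed

lemma nn_integral_affine_complex:
  fixes f :: "complex \<Rightarrow> ennreal"
  assumes [measurable]: "f \<in> borel_measurable borel" and c: "c \<noteq> 0"
  shows "(\<integral>\<^sup>+z. f z \<partial>lborel) = ennreal (c\<^sup>2) * (\<integral>\<^sup>+z. f (t + c *\<^sub>R z) \<partial>lborel)"
  by (subst lborel_affine[OF c, of t])
    (simp add: nn_integral_density nn_integral_distr nn_integral_cmult)

lemma nn_integral_mollifier_right:
  assumes "0 < \<epsilon>" shows "(\<integral>\<^sup>+\<zeta>. ennreal (mollifier \<epsilon> z \<zeta>) \<partial>lborel) = 1"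
proof -
  have [measurable]: "mollifier \<epsilon> z \<in> borel_measurable borel"
    by (rule borel_measurable_continuous_onI[OF continuous_on_mollifier2(1)])
  have [measurable]: "eta \<in> borel_measurable borel"
    by (rule borel_measurable_continuous_onI[OF continuous_on_eta])
  have "(\<integral>\<^sup>+\<zeta>. ennreal (mollifier \<epsilon> z \<zeta>) \<partial>lborel) = ennreal (\<epsilon>\<^sup>2) * (\<integral>\<^sup>+\<zeta>. ennreal (mollifier \<epsilon> z ((1 - \<epsilon>) *\<^sub>R z + \<epsilon> *\<^sub>R \<zeta>)) \<partial>lborel)"
    using assms by (intro nn_integral_affine_complex) auto
  also have "\<dots> = (\<integral>\<^sup>+\<zeta>. ennreal (eta \<zeta>) \<partial>lborel)"
    using assms by (subst nn_integral_cmult[symmetric])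
      (auto simp: mollifier_def ennreal_mult[symmetric] eta_nonneg)
  finally show ?thesis by (simp add: nn_integral_eta)
qed

lemma nn_integral_mollifier_left:
  assumes "0 < \<epsilon>" "\<epsilon> < 1" shows "(\<integral>\<^sup>+z. ennreal (mollifier \<epsilon> z \<zeta>) \<partial>lborel) = ennreal (1 / (1 - \<epsilon>)\<^sup>2)"
proof -
  have [measurable]: "(\<lambda>z. mollifier \<epsilon> z \<zeta>) \<in> borel_measurable borel"
    by (rule borel_measurable_continuous_onI[OF continuous_on_mollifier2(2)])
  have [measurable]: "eta \<in> borel_measurable borel"
    by (rule borel_measurable_continuous_onI[OF continuous_on_eta])
  \<comment> \<open>The substitution solves \<zeta> - (1 - \<epsilon>) z = \<epsilon> z' for z. Its
    squared scale \<epsilon>^2 / (1 - \<epsilon>)^2 is the Jacobian, whose numerator cancels the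
    normalisation of the mollifier.\<close>
  let ?c = "- (\<epsilon> / (1 - \<epsilon>))" and ?t = "(1 / (1 - \<epsilon>)) *\<^sub>R \<zeta>"
  have "\<zeta> - (1 - \<epsilon>) *\<^sub>R (?t + ?c *\<^sub>R z) = \<epsilon> *\<^sub>R z" for z
    using assms by (simp add: scaleR_right_diff_distrib)
  then have e: "mollifier \<epsilon> (?t + ?c *\<^sub>R z) \<zeta> = eta z / \<epsilon>\<^sup>2" for z
    using assms by (simp add: mollifier_def)
  have "(\<integral>\<^sup>+z. ennreal (mollifier \<epsilon> z \<zeta>) \<partial>lborel) = ennreal (?c\<^sup>2) * (\<integral>\<^sup>+z. ennreal (mollifier \<epsilon> (?t + ?c *\<^sub>R z) \<zeta>) \<partial>lborel)"
    using assms by (intro nn_integral_affine_complex) auto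
  also have "\<dots> = (\<integral>\<^sup>+z. ennreal (1 / (1 - \<epsilon>)\<^sup>2) * ennreal (eta z) \<partial>lborel)"
    unfolding e using assms by (subst nn_integral_cmult[symmetric])
      (auto simp: ennreal_mult[symmetric] eta_nonneg power_divide)
  also have "\<dots> = ennreal (1 / (1 - \<epsilon>)\<^sup>2)"
    by (simp add: nn_integral_cmult nn_integral_eta)
  finally show ?thesis .
qed

lemma C_k_mollifier: "C_k k (\<lambda>\<zeta>. of_real (mollifier \<epsilon> z \<zeta>))"
proof -
  have "C_k k (\<lambda>\<zeta>. of_real (1 / \<epsilon>\<^sup>2) * (\<lambda>z. of_real (eta z)) (- ((1 - \<epsilon>) *\<^sub>R z /\<^sub>R \<epsilon>) + of_real (inverse \<epsilon>) * \<zeta>))"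
    by (intro C_k_cmult C_k_affine C_k_eta)
  moreover have "- ((1 - \<epsilon>) *\<^sub>R z /\<^sub>R \<epsilon>) + of_real (inverse \<epsilon>) * \<zeta> = (\<zeta> - (1 - \<epsilon>) *\<^sub>R z) /\<^sub>R \<epsilon>" for \<zeta>
    by (simp add: scaleR_conv_of_real algebra_simps)
  ultimately show ?thesis by (simp add: mollifier_def divide_inverse mult.commute)
qed

lemma mollifier_test_function:
  assumes e: "0 < \<epsilon>" "\<epsilon> < 1" and z: "z \<in> disc"
  shows "test_function (\<lambda>\<zeta>. of_real (mollifier \<epsilon> z \<zeta>))"
proof -
  have "{\<zeta>. complex_of_real (mollifier \<epsilon> z \<zeta>) \<noteq> 0} \<subseteq> cball ((1 - \<epsilon>) *\<^sub>R z) \<epsilon>"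
    using mollifier_eq_0[OF e(1)] by (force simp: dist_norm norm_minus_commute)
  then have c: "closure {\<zeta>. complex_of_real (mollifier \<epsilon> z \<zeta>) \<noteq> 0} \<subseteq> cball ((1 - \<epsilon>) *\<^sub>R z) \<epsilon>"
    by (rule closure_minimal) simp
  have "cball ((1 - \<epsilon>) *\<^sub>R z) \<epsilon> \<subseteq> disc"
  proof
    fix x assume "x \<in> cball ((1 - \<epsilon>) *\<^sub>R z) \<epsilon>"
    then have "cmod x \<le> \<epsilon> + (1 - \<epsilon>) * cmod z"
      using norm_triangle_ineq[of "x - (1 - \<epsilon>) *\<^sub>R z" "(1 - \<epsilon>) *\<^sub>R z"] e
      by (simp add: dist_norm norm_minus_commute)
    also have "\<dots> < \<epsilon> + (1 - \<epsilon>) * 1"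
      using e z by (intro add_strict_left_mono mult_strict_left_mono) auto
    finally show "x \<in> disc" by simp
  qed
  moreover have "compact (closure {\<zeta>. complex_of_real (mollifier \<epsilon> z \<zeta>) \<noteq> 0})"
    using c by (meson bounded_cball bounded_subset compact_closure closure_subset order_trans)
  ultimately show ?thesis
    using c by (auto simp: test_function_def smooth_def C_k_mollifier)
qed

section \<open>Smoothness of convolutions\<close>

lemma bounded_support_bound:
  assumes k: "C_k 0 k" and b: "bounded {z. k z \<noteq> 0}"
  obtains B where "0 \<le> B" "\<And>z. cmod (k z) \<le> B"
proof -
  have "compact (closure {z. k z \<noteq> 0})" using b by simp
  then have "bounded (k ` closure {z. k z \<noteq> 0})"
    using k by (intro compact_imp_bounded compact_continuous_image) (auto intro: continuous_on_subset)
  then obtain B where B: "\<And>z. z \<in> closure {z. k z \<noteq> 0} \<Longrightarrow> cmod (k z) \<le> B"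
    unfolding bounded_iff by blast
  have "cmod (k z) \<le> max 0 B" for z
    using B[of z] closure_subset[of "{z. k z \<noteq> 0}"] by (cases "k z = 0") (auto simp: le_max_iff_disj)
  then show ?thesis by (intro that[of "max 0 B"]) auto
qed

lemma dir_deriv_bounded_support:
  assumes k: "C_k 1 k" and b: "bounded {z. k z \<noteq> 0}"
  shows "bounded {z. dir_deriv e k z \<noteq> 0}"
proof -
  have "{z. dir_deriv e k z \<noteq> 0} \<subseteq> closure {z. k z \<noteq> 0}"
  proof (rule subsetI, rule ccontr)
    fix z assume z: "z \<in> {z. dir_deriv e k z \<noteq> 0}" "z \<notin> closure {z. k z \<noteq> 0}"
    have "((\<lambda>_. 0) has_derivative (\<lambda>_. 0)) (at z)" by simp
    then have "(k has_derivative (\<lambda>_. 0)) (at z)"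
      by (rule has_derivative_transform_within_open[of _ _ _ _ "- closure {z. k z \<noteq> 0}"])
        (use z closure_subset[of "{z. k z \<noteq> 0}"] in auto)
    from dir_deriv_eqI[OF this, of e] z show False by simp
  qed
  then show ?thesis using b bounded_closure bounded_subset by blast
qed

lemma dir_deriv_norm_le:
  assumes "f differentiable (at z)"
  shows "cmod (dir_deriv e f z) \<le> cmod e * (cmod (dir_deriv 1 f z) + cmod (dir_deriv \<i> f z))"
proof -
  have "dir_deriv e f z = Re e * dir_deriv 1 f z + Im e * dir_deriv \<i> f z"
    using dir_deriv_Complex[OF assms, of "Re e" "Im e"] by simp
  then have "cmod (dir_deriv e f z) \<le> \<bar>Re e\<bar> * cmod (dir_deriv 1 f z) + \<bar>Im e\<bar> * cmod (dir_deriv \<i> f z)"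
    using norm_triangle_ineq[of "Re e * dir_deriv 1 f z" "Im e * dir_deriv \<i> f z"] by (simp add: norm_mult)
  also have "\<dots> \<le> cmod e * cmod (dir_deriv 1 f z) + cmod e * cmod (dir_deriv \<i> f z)"
    by (intro add_mono mult_right_mono abs_Re_le_cmod abs_Im_le_cmod) auto
  finally show ?thesis by (simp add: distrib_left)
qed

lemma C_k_lipschitz:
  assumes k: "C_k 1 k" and b: "bounded {z. k z \<noteq> 0}"
  obtains B where "0 \<le> B" "\<And>x y. cmod (k x - k y) \<le> B * cmod (x - y)"
proof -
  have c0: "C_k 0 (dir_deriv e k)" for e using k by auto
  obtain B1 where B1: "0 \<le> B1" "\<And>z. cmod (dir_deriv 1 k z) \<le> B1"
    using bounded_support_bound[OF c0 dir_deriv_bounded_support[OF k b]] by blast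
  obtain B2 where B2: "0 \<le> B2" "\<And>z. cmod (dir_deriv \<i> k z) \<le> B2"
    using bounded_support_bound[OF c0 dir_deriv_bounded_support[OF k b]] by blast
  have dk: "k differentiable (at z)" for z using k by simp
  have "cmod (k x - k y) \<le> (B1 + B2) * cmod (x - y)" for x y
  proof (rule differentiable_bound[of UNIV])
    show "(k has_derivative (\<lambda>e. dir_deriv e k z)) (at z within UNIV)" for z
      by (simp add: has_derivative_dir_deriv[OF dk])
    show "onorm (\<lambda>e. dir_deriv e k z) \<le> B1 + B2" for z
    proof (rule onorm_le)
      fix e
      have "cmod (dir_deriv e k z) \<le> cmod e * (cmod (dir_deriv 1 k z) + cmod (dir_deriv \<i> k z))"
        by (rule dir_deriv_norm_le[OF dk])
      also have "\<dots> \<le> cmod e * (B1 + B2)" by (intro mult_left_mono add_mono B1 B2) auto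
      finally show "cmod (dir_deriv e k z) \<le> (B1 + B2) * cmod e" by (simp add: mult.commute)
    qed
  qed auto
  then show ?thesis using B1(1) B2(1) by (intro that[of "B1 + B2"]) auto
qed

text \<open>The point is the constant, uniform in x: the first derivatives are Lipschitz because the
  second ones are continuous with bounded support.\<close>

lemma C_k_taylor:
  assumes k: "C_k 2 k" and b: "bounded {z. k z \<noteq> 0}"
  obtains B where "0 \<le> B" "\<And>x h. cmod (k (x + h) - k x - dir_deriv h k x) \<le> B * (cmod h)\<^sup>2"
proof -
  have k1: "C_k 1 k" using k by (rule C_k_mono) simp
  have c1: "C_k 1 (dir_deriv e k)" for e using k by (auto simp: numeral_2_eq_2)
  note bd = dir_deriv_bounded_support[OF k1 b]
  obtain B1 where B1: "0 \<le> B1" "\<And>x y. cmod (dir_deriv 1 k x - dir_deriv 1 k y) \<le> B1 * cmod (x - y)"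
    using C_k_lipschitz[OF c1 bd] by blast
  obtain B2 where B2: "0 \<le> B2" "\<And>x y. cmod (dir_deriv \<i> k x - dir_deriv \<i> k y) \<le> B2 * cmod (x - y)"
    using C_k_lipschitz[OF c1 bd] by blast
  have dk: "k differentiable (at z)" for z using k1 by simp
  have lip: "cmod (dir_deriv e k y - dir_deriv e k x) \<le> cmod e * ((B1 + B2) * cmod (y - x))" for e x y
  proof -
    have eq: "dir_deriv e k z = Re e * dir_deriv 1 k z + Im e * dir_deriv \<i> k z" for z
      using dir_deriv_Complex[OF dk, of "Re e" "Im e"] by simp
    have "dir_deriv e k y - dir_deriv e k x = Re e * (dir_deriv 1 k y - dir_deriv 1 k x) + Im e * (dir_deriv \<i> k y - dir_deriv \<i> k x)"
      unfolding eq by (simp add: algebra_simps)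
    also have "cmod \<dots> \<le> \<bar>Re e\<bar> * cmod (dir_deriv 1 k y - dir_deriv 1 k x) + \<bar>Im e\<bar> * cmod (dir_deriv \<i> k y - dir_deriv \<i> k x)"
      by (rule order_trans[OF norm_triangle_ineq]) (simp add: norm_mult)
    also have "\<dots> \<le> cmod e * (B1 * cmod (y - x)) + cmod e * (B2 * cmod (y - x))"
      by (intro add_mono mult_mono abs_Re_le_cmod abs_Im_le_cmod B1 B2) auto
    finally show ?thesis by (simp add: algebra_simps)
  qed
  have "cmod (k (x + h) - k x - dir_deriv h k x) \<le> (B1 + B2) * (cmod h)\<^sup>2" for x h
  proof -
    have "cmod (k (x + h) - k x - dir_deriv (x + h - x) k x) \<le> cmod (x + h - x) * ((B1 + B2) * cmod h)"
    proof (rule differentiable_bound_linearization[of x "x + h" "closed_segment x (x + h)" k "\<lambda>z e. dir_deriv e k z" x])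
      show "(k has_derivative (\<lambda>e. dir_deriv e k z)) (at z within closed_segment x (x + h))" for z
        by (rule has_derivative_at_withinI[OF has_derivative_dir_deriv[OF dk]])
      have "onorm (\<lambda>e. dir_deriv e k (x + t *\<^sub>R h) - dir_deriv e k x) \<le> (B1 + B2) * cmod h" if t: "t \<in> {0..1}" for t
      proof (rule onorm_le)
        fix e
        have "cmod (t *\<^sub>R h) \<le> cmod h" using t by (simp add: mult_left_le_one_le)
        then have "cmod e * ((B1 + B2) * cmod (x + t *\<^sub>R h - x)) \<le> cmod e * ((B1 + B2) * cmod h)"
          using B1 B2 by (intro mult_left_mono) auto
        then show "cmod (dir_deriv e k (x + t *\<^sub>R h) - dir_deriv e k x) \<le> (B1 + B2) * cmod h * cmod e"
          using lip[of e "x + t *\<^sub>R h" x] by (simp add: algebra_simps)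
      qed
      then show "onorm ((\<lambda>e. dir_deriv e k z) - (\<lambda>e. dir_deriv e k x)) \<le> (B1 + B2) * cmod h" if "z \<in> closed_segment x (x + h)" for z
        using that by (auto simp: closed_segment_def fun_diff_def algebra_simps)
    qed (auto simp: closed_segment_def algebra_simps)
    then show ?thesis by (simp add: power2_eq_square algebra_simps)
  qed
  then show ?thesis using B1(1) B2(1) by (intro that[of "B1 + B2"]) auto
qed

text \<open>Differentiation under the integral sign for f that is merely integrable: the Taylor
  remainder of the kernel is quadratic uniformly in \<zeta>, so integrated against |f| it is still
  O(|y - z|^2). The constant \<open>c\<close> will be the dilation factor, and the chain rule moves
  it into the direction.\<close>

lemma convolution_has_derivative:
  assumes k: "C_k 2 k" "bounded {z. k z \<noteq> 0}" and f: "integrable (lebesgue_on disc) f"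
  shows "((\<lambda>z. LINT \<zeta>|lebesgue_on disc. k (\<zeta> - c * z) * f \<zeta>) has_derivative
    (\<lambda>e. - (LINT \<zeta>|lebesgue_on disc. dir_deriv (c * e) k (\<zeta> - c * z) * f \<zeta>))) (at z)"
proof -
  have k1: "C_k 1 k" using k(1) by (rule C_k_mono) simp
  have c0: "C_k 0 k" "C_k 0 (dir_deriv e k)" for e using k1 C_k_SucD[of 0 k] by auto
  have dk: "k differentiable (at z)" for z using k1 by simp
  have [measurable]: "f \<in> borel_measurable (lebesgue_on disc)" using f by auto
  have int: "integrable (lebesgue_on disc) (\<lambda>\<zeta>. g (\<zeta> - c * z) * f \<zeta>)"
    if g: "C_k 0 g" "bounded {z. g z \<noteq> 0}" for g z
  proof -
    obtain B where B: "0 \<le> B" "\<And>z. cmod (g z) \<le> B" by (rule bounded_support_bound[OF g], rule that)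
    have "continuous_on UNIV (\<lambda>\<zeta>. g (\<zeta> - c * z))"
      using g by (intro continuous_on_compose2[of UNIV g UNIV "\<lambda>\<zeta>. \<zeta> - c * z"] continuous_intros) auto
    then have [measurable]: "(\<lambda>\<zeta>. g (\<zeta> - c * z)) \<in> borel_measurable (lebesgue_on disc)"
      using borel_measurable_integrable disc_integrable_continuous(1) by blast
    show ?thesis
    proof (rule Bochner_Integration.integrable_bound)
      show "integrable (lebesgue_on disc) (\<lambda>\<zeta>. B * cmod (f \<zeta>))" using f by simp
      show "AE \<zeta> in lebesgue_on disc. cmod (g (\<zeta> - c * z) * f \<zeta>) \<le> norm (B * cmod (f \<zeta>))"
        using B by (intro AE_I2) (auto simp: norm_mult intro!: mult_right_mono)
    qed simp
  qed
  note bd = dir_deriv_bounded_support[OF k1 k(2)]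
  obtain B where B: "0 \<le> B" "\<And>x h. cmod (k (x + h) - k x - dir_deriv h k x) \<le> B * (cmod h)\<^sup>2"
    using C_k_taylor[OF k] by blast
  define L where "L e = - (LINT \<zeta>|lebesgue_on disc. dir_deriv (c * e) k (\<zeta> - c * z) * f \<zeta>)" for e
  define F where "F z = (LINT \<zeta>|lebesgue_on disc. k (\<zeta> - c * z) * f \<zeta>)" for z
  define I where "I = (LINT \<zeta>|lebesgue_on disc. cmod (f \<zeta>))"
  have lin: "linear (\<lambda>e. dir_deriv e k w)" for w by (rule dir_deriv_linear[OF dk])
  have "linear L"
  proof (rule linearI)
    show "L (a + b) = L a + L b" for a b
      unfolding L_def distrib_left linear_add[OF lin] distrib_right
      by (subst Bochner_Integration.integral_add[OF int[OF c0(2) bd] int[OF c0(2) bd]]) simp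
    show "L (r *\<^sub>R b) = r *\<^sub>R L b" for r b
      unfolding L_def mult_scaleR_right linear_scale[OF lin] mult_scaleR_left by simp
  qed
  then have bl: "bounded_linear L" by (simp add: linear_conv_bounded_linear)
  have est: "cmod (F y - F z - L (y - z)) \<le> B * (cmod c)\<^sup>2 * I * (cmod (y - z))\<^sup>2" for y
  proof -
    have h: "\<zeta> - c * y = (\<zeta> - c * z) + (- (c * (y - z)))" for \<zeta> by (simp add: algebra_simps)
    have neg: "dir_deriv (- e) k w = - dir_deriv e k w" for e w by (rule linear_neg[OF lin])
    have "F y - F z - L (y - z) = (LINT \<zeta>|lebesgue_on disc. k (\<zeta> - c * y) * f \<zeta> - k (\<zeta> - c * z) * f \<zeta> + dir_deriv (c * (y - z)) k (\<zeta> - c * z) * f \<zeta>)"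
      unfolding F_def L_def using int[OF c0(1) k(2)] int[OF c0(2) bd] by simp
    also have "\<dots> = (LINT \<zeta>|lebesgue_on disc. (k ((\<zeta> - c * z) + (- (c * (y - z)))) - k (\<zeta> - c * z) - dir_deriv (- (c * (y - z))) k (\<zeta> - c * z)) * f \<zeta>)"
      unfolding neg h[symmetric] by (simp add: algebra_simps)
    finally have eq: "F y - F z - L (y - z) = \<dots>" .
    have "cmod (F y - F z - L (y - z)) \<le> (LINT \<zeta>|lebesgue_on disc. B * (cmod (- (c * (y - z))))\<^sup>2 * cmod (f \<zeta>))"
      unfolding eq
    proof (rule Bochner_Integration.integral_norm_bound_integral)
      show "integrable (lebesgue_on disc) (\<lambda>\<zeta>. (k (\<zeta> - c * z + - (c * (y - z))) - k (\<zeta> - c * z) - dir_deriv (- (c * (y - z))) k (\<zeta> - c * z)) * f \<zeta>)"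
        unfolding h[symmetric] left_diff_distrib
        by (intro Bochner_Integration.integrable_diff int c0 k bd)
      show "integrable (lebesgue_on disc) (\<lambda>\<zeta>. B * (cmod (- (c * (y - z))))\<^sup>2 * cmod (f \<zeta>))"
        using f by simp
      fix \<zeta>
      show "cmod ((k (\<zeta> - c * z + - (c * (y - z))) - k (\<zeta> - c * z) - dir_deriv (- (c * (y - z))) k (\<zeta> - c * z)) * f \<zeta>)
         \<le> B * (cmod (- (c * (y - z))))\<^sup>2 * cmod (f \<zeta>)"
        unfolding norm_mult[of "_ - _"] by (intro mult_right_mono B) auto
    qed
    also have "\<dots> = B * (cmod c)\<^sup>2 * I * (cmod (y - z))\<^sup>2"
      unfolding norm_minus_cancel norm_mult power_mult_distrib I_def integral_mult_right_zero
      by (simp only: mult_ac)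
    finally show ?thesis .
  qed
  have "(F has_derivative L) (at z)"
  proof (rule has_derivativeI_sandwich[of 1])
    show "cmod (F y - F z - L (y - z)) / cmod (y - z) \<le> B * (cmod c)\<^sup>2 * I * cmod (y - z)" if "y \<noteq> z" for y
      using est[of y] that by (simp add: divide_le_eq power2_eq_square mult.assoc)
    have "((\<lambda>y. B * (cmod c)\<^sup>2 * I * cmod (y - z)) \<longlongrightarrow> B * (cmod c)\<^sup>2 * I * cmod (z - z)) (at z)"
      by (intro tendsto_intros)
    then show "((\<lambda>y. B * (cmod c)\<^sup>2 * I * cmod (y - z)) \<longlongrightarrow> 0) (at z)" by simp
  qed (use bl in auto)
  then show ?thesis by (simp add: F_def[abs_def] L_def[abs_def])
qed

lemma C_k_convolution:
  assumes k: "\<And>j. C_k j k" "bounded {z. k z \<noteq> 0}" and f: "integrable (lebesgue_on disc) f"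
  shows "C_k n (\<lambda>z. LINT \<zeta>|lebesgue_on disc. k (\<zeta> - c * z) * f \<zeta>)"
  using k
proof (induction n arbitrary: k)
  case 0
  show ?case
    unfolding C_k.simps
    by (intro continuous_at_imp_continuous_on ballI has_derivative_continuous[OF convolution_has_derivative[OF 0 f]])
next
  case (Suc n)
  note D = convolution_has_derivative[OF Suc.prems f]
  have ds: "C_k j (dir_deriv e k)" for j e using C_k_dir_deriv[OF Suc.prems(1)] .
  have "dir_deriv e (\<lambda>z. LINT \<zeta>|lebesgue_on disc. k (\<zeta> - c * z) * f \<zeta>) =
     (\<lambda>z. - 1 * (LINT \<zeta>|lebesgue_on disc. dir_deriv (c * e) k (\<zeta> - c * z) * f \<zeta>))" for e
    by (rule ext, subst dir_deriv_eqI[OF D]) simp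
  moreover have "C_k n (\<lambda>z. - 1 * (LINT \<zeta>|lebesgue_on disc. dir_deriv (c * e) k (\<zeta> - c * z) * f \<zeta>))" for e
    by (intro C_k_cmult Suc.IH ds dir_deriv_bounded_support[OF Suc.prems])
  moreover have "(\<lambda>z. LINT \<zeta>|lebesgue_on disc. k (\<zeta> - c * z) * f \<zeta>) differentiable (at z)" for z
    by (rule differentiableI[OF D])
  ultimately show ?case by simp
qed

section \<open>Mollification of functions on the disc\<close>

definition mollify :: "real \<Rightarrow> (complex \<Rightarrow> complex) \<Rightarrow> complex \<Rightarrow> complex" where
  "mollify \<epsilon> f z = (LINT \<zeta>|lebesgue_on disc. of_real (mollifier \<epsilon> z \<zeta>) * f \<zeta>)"

lemma mollifier_shift: "mollifier \<epsilon> z \<zeta> = mollifier \<epsilon> 0 (\<zeta> - of_real (1 - \<epsilon>) * z)"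
  by (simp add: mollifier_def scaleR_conv_of_real)

lemma mollifier_bounded_support:
  assumes "0 < \<epsilon>" shows "bounded {z. complex_of_real (mollifier \<epsilon> 0 z) \<noteq> 0}"
proof (rule bounded_subset[OF bounded_cball])
  show "{z. complex_of_real (mollifier \<epsilon> 0 z) \<noteq> 0} \<subseteq> cball 0 \<epsilon>"
    using mollifier_eq_0[OF assms, of _ 0] by force
qed

text \<open>The dependence on z is a dilation followed by a translation of one fixed kernel, so
  \<open>C_k_convolution\<close> applies. Smoothness holds on the whole plane, as the approximants
  in \<open>has_bdry_trace\<close> require.\<close>

lemma C_k_mollify:
  assumes "0 < \<epsilon>" "integrable (lebesgue_on disc) f"
  shows "C_k n (mollify \<epsilon> f)"
  unfolding mollify_def[abs_def]
  by (subst mollifier_shift) (rule C_k_convolution[OF C_k_mollifier mollifier_bounded_support[OF assms(1)] assms(2)])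

lemma dir_deriv_mollifier:
  "dir_deriv e (\<lambda>\<zeta>. of_real (mollifier \<epsilon> z \<zeta>)) \<zeta> = dir_deriv e (\<lambda>\<zeta>. of_real (mollifier \<epsilon> 0 \<zeta>)) (\<zeta> - of_real (1 - \<epsilon>) * z)"
proof (rule dir_deriv_eqI)
  have "((\<lambda>\<zeta>. complex_of_real (mollifier \<epsilon> 0 (\<zeta> - of_real (1 - \<epsilon>) * z))) has_derivative
    (\<lambda>e. dir_deriv e (\<lambda>\<zeta>. of_real (mollifier \<epsilon> 0 \<zeta>)) (\<zeta> - of_real (1 - \<epsilon>) * z))) (at \<zeta>)"
    by (rule has_derivative_compose[where f="\<lambda>\<zeta>. \<zeta> - of_real (1 - \<epsilon>) * z" and f'="\<lambda>e. e" and g="\<lambda>\<zeta>. of_real (mollifier \<epsilon> 0 \<zeta>)"])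
      (auto intro!: derivative_eq_intros has_derivative_dir_deriv C_k_differentiable[OF C_k_mollifier])
  then show "((\<lambda>\<zeta>. complex_of_real (mollifier \<epsilon> z \<zeta>)) has_derivative
    (\<lambda>e. dir_deriv e (\<lambda>\<zeta>. of_real (mollifier \<epsilon> 0 \<zeta>)) (\<zeta> - of_real (1 - \<epsilon>) * z))) (at \<zeta>)"
    by (subst mollifier_shift)
qed

lemma L2_space_integrable:
  assumes "f \<in> L2_space" shows "integrable (lebesgue_on disc) f"
proof (rule integrableI_bounded)
  have [measurable]: "f \<in> borel_measurable (lebesgue_on disc)" and fin: "L2_norm_sq f < \<infinity>"
    using assms by (auto simp: L2_space_def)
  show "f \<in> borel_measurable (lebesgue_on disc)" by fact
  have "(\<integral>\<^sup>+z. ennreal (cmod (f z)) \<partial>lebesgue_on disc) \<le> (\<integral>\<^sup>+z. 1 + ennreal ((cmod (f z))\<^sup>2) \<partial>lebesgue_on disc)"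
  proof (rule nn_integral_mono)
    fix z
    have "a \<le> 1 + a\<^sup>2" for a :: real
      using zero_le_power2[of "a - 1 / 2"] by (simp add: power2_eq_square algebra_simps)
    then have "ennreal (cmod (f z)) \<le> ennreal (1 + (cmod (f z))\<^sup>2)" by (rule ennreal_leI)
    then show "ennreal (cmod (f z)) \<le> 1 + ennreal ((cmod (f z))\<^sup>2)" by (simp add: ennreal_plus)
  qed
  also have "\<dots> = emeasure (lebesgue_on disc) disc + L2_norm_sq f"
    by (simp add: nn_integral_add L2_norm_sq_def)
  also have "\<dots> < \<infinity>"
    using fin emeasure_bounded_finite[of disc] by (simp add: emeasure_restrict_space)
  finally show "(\<integral>\<^sup>+z. ennreal (cmod (f z)) \<partial>lebesgue_on disc) < \<infinity>" .
qed

text \<open>The derivative in z falls on the kernel, with a factor 1 - \<epsilon> from the dilation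
  and a sign. For z in the disc the kernel is a test function in \<zeta>, so the definition of the
  weak derivative moves it over to u and removes the sign.\<close>

lemma dir_deriv_mollify:
  assumes e: "0 < \<epsilon>" "\<epsilon> < 1" and z: "z \<in> disc" and u: "has_weak_deriv e u g"
  shows "dir_deriv e (mollify \<epsilon> u) z = of_real (1 - \<epsilon>) * mollify \<epsilon> g z"
proof -
  let ?k = "\<lambda>\<zeta>. complex_of_real (mollifier \<epsilon> 0 \<zeta>)" and ?c = "complex_of_real (1 - \<epsilon>)"
  have iu: "integrable (lebesgue_on disc) u"
    using u L2_space_integrable by (auto simp: has_weak_deriv_def)
  have dk: "?k differentiable (at w)" for w using C_k_differentiable[OF C_k_mollifier] .
  have sc: "dir_deriv (?c * e) ?k w = ?c * dir_deriv e ?k w" for w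
    using linear_scale[OF dir_deriv_linear[OF dk[of w]], of "1 - \<epsilon>" e] by (simp only: scaleR_conv_of_real)
  have "dir_deriv e (mollify \<epsilon> u) z = - (LINT \<zeta>|lebesgue_on disc. dir_deriv (?c * e) ?k (\<zeta> - ?c * z) * u \<zeta>)"
    unfolding mollify_def[abs_def]
    by (rule dir_deriv_eqI, subst mollifier_shift)
      (rule convolution_has_derivative[OF C_k_mollifier mollifier_bounded_support[OF e(1)] iu])
  also have "(LINT \<zeta>|lebesgue_on disc. dir_deriv (?c * e) ?k (\<zeta> - ?c * z) * u \<zeta>) =
      ?c * (LINT \<zeta>|lebesgue_on disc. u \<zeta> * dir_deriv e (\<lambda>\<zeta>. of_real (mollifier \<epsilon> z \<zeta>)) \<zeta>)"
    unfolding sc dir_deriv_mollifier[of e \<epsilon> z] by (simp add: mult.assoc mult.commute[of "u _"])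
  also have "(LINT \<zeta>|lebesgue_on disc. u \<zeta> * dir_deriv e (\<lambda>\<zeta>. of_real (mollifier \<epsilon> z \<zeta>)) \<zeta>) =
      - (LINT \<zeta>|lebesgue_on disc. g \<zeta> * of_real (mollifier \<epsilon> z \<zeta>))"
    using u mollifier_test_function[OF e z] by (simp add: has_weak_deriv_def)
  finally show ?thesis by (simp add: mollify_def[of _ g] mult.commute)
qed

text \<open>The values of f are first truncated by the nearest-point projection onto a large ball.
  The truncated function is an almost everywhere limit of continuous functions, and truncating these
  as well supplies the constant majorant for dominated convergence.\<close>

lemma L2_bounded_continuous_approx:
  assumes f: "f \<in> L2_space" and d: "0 < (\<delta>::real)"
  obtains g where "continuous_on UNIV g" "L2_norm_sq (\<lambda>z. f z - g z) \<le> ennreal \<delta>"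
proof -
  have fm [measurable]: "f \<in> borel_measurable (lebesgue_on disc)" and fin: "L2_norm_sq f < \<infinity>"
    using f by (auto simp: L2_space_def)
  define cl where "cl M z = closest_point (cball 0 (real M)) z" for M and z :: complex
  have ccl: "continuous_on A (cl M)" for M A
    unfolding cl_def by (rule continuous_on_closest_point) auto
  have [measurable]: "cl M \<in> borel_measurable borel" for M
    by (rule borel_measurable_continuous_onI[OF ccl])
  have clM: "cmod (cl M z) \<le> M" for M z
    using closest_point_in_set[of "cball 0 (real M)" z] by (simp add: cl_def)
  have cl_id: "cl M z = z" if "cmod z \<le> M" for M z
    using that by (simp add: cl_def closest_point_self)
  have cl_dist: "cmod (z - cl M z) \<le> cmod z" for M z
    using closest_point_le[of "cball 0 (real M)" 0 z] by (simp add: cl_def dist_norm)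
  have "(\<lambda>M. \<integral>\<^sup>+z. ennreal ((cmod (f z - cl M (f z)))\<^sup>2) \<partial>lebesgue_on disc) \<longlonglongrightarrow> (\<integral>\<^sup>+z. 0 \<partial>lebesgue_on disc)"
  proof (rule nn_integral_dominated_convergence[where w="\<lambda>z. ennreal ((cmod (f z))\<^sup>2)"])
    show "AE z in lebesgue_on disc. ennreal ((cmod (f z - cl M (f z)))\<^sup>2) \<le> ennreal ((cmod (f z))\<^sup>2)" for M
      by (intro AE_I2 ennreal_leI power_mono cl_dist) auto
    show "(\<integral>\<^sup>+z. ennreal ((cmod (f z))\<^sup>2) \<partial>lebesgue_on disc) < \<infinity>" using fin by (simp add: L2_norm_sq_def)
    show "AE z in lebesgue_on disc. (\<lambda>M. ennreal ((cmod (f z - cl M (f z)))\<^sup>2)) \<longlonglongrightarrow> 0"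
    proof (rule AE_I2)
      fix z
      obtain N :: nat where N: "cmod (f z) \<le> N" using real_arch_simple by blast
      have "eventually (\<lambda>M. ennreal ((cmod (f z - cl M (f z)))\<^sup>2) = 0) sequentially"
        using eventually_ge_at_top[of N]
      proof eventually_elim
        case (elim M)
        then have "cmod (f z) \<le> M" using N by linarith
        then show ?case by (simp add: cl_id)
      qed
      then show "(\<lambda>M. ennreal ((cmod (f z - cl M (f z)))\<^sup>2)) \<longlonglongrightarrow> 0" by (rule tendsto_eventually)
    qed
  qed measurable
  then have "eventually (\<lambda>M. L2_norm_sq (\<lambda>z. f z - cl M (f z)) < ennreal (\<delta> / 4)) sequentially"
    unfolding L2_norm_sq_def using d by (intro order_tendstoD) auto
  then obtain M where M: "L2_norm_sq (\<lambda>z. f z - cl M (f z)) < ennreal (\<delta> / 4)"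
    by (auto simp: eventually_sequentially)
  \<comment> \<open>\<open>measurable_on\<close> is defined by almost everywhere approximation with
    continuous functions, which is the form wanted here.\<close>
  have "f measurable_on disc" using fm by (simp add: measurable_on_iff_borel_measurable)
  then obtain N g where N: "negligible N" and g: "\<And>n. continuous_on UNIV (g n)"
    and lim: "\<And>x. x \<notin> N \<Longrightarrow> (\<lambda>n. g n x) \<longlonglongrightarrow> (if x \<in> disc then f x else 0)"
    unfolding measurable_on_def by blast
  have cg: "continuous_on UNIV (\<lambda>z. cl M (g n z))" for n
    by (rule continuous_on_compose2[OF ccl g]) auto
  then have [measurable]: "(\<lambda>z. cl M (g n z)) \<in> borel_measurable (lebesgue_on disc)" for n
    using borel_measurable_integrable disc_integrable_continuous(1) by blast
  have "(\<lambda>n. \<integral>\<^sup>+z. ennreal ((cmod (cl M (f z) - cl M (g n z)))\<^sup>2) \<partial>lebesgue_on disc) \<longlonglongrightarrow> (\<integral>\<^sup>+z. 0 \<partial>lebesgue_on disc)"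
  proof (rule nn_integral_dominated_convergence[where w="\<lambda>z. ennreal ((2 * real M)\<^sup>2)"])
    show "AE z in lebesgue_on disc. ennreal ((cmod (cl M (f z) - cl M (g n z)))\<^sup>2) \<le> ennreal ((2 * real M)\<^sup>2)" for n
    proof (intro AE_I2 ennreal_leI power_mono)
      show "cmod (cl M (f z) - cl M (g n z)) \<le> 2 * real M" for z
        using norm_triangle_ineq4[of "cl M (f z)" "cl M (g n z)"] clM[of M "f z"] clM[of M "g n z"] by simp
    qed auto
    show "(\<integral>\<^sup>+z. ennreal ((2 * real M)\<^sup>2) \<partial>lebesgue_on disc) < \<infinity>"
      using emeasure_bounded_finite[of disc] by (simp add: emeasure_restrict_space ennreal_mult_less_top)
    have "AE z in lebesgue. z \<notin> N" using N by (simp add: negligible_iff_null_sets AE_not_in)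
    then have "AE z in lebesgue_on disc. z \<notin> N" by (auto simp: AE_restrict_space_iff elim: eventually_mono)
    then show "AE z in lebesgue_on disc. (\<lambda>n. ennreal ((cmod (cl M (f z) - cl M (g n z)))\<^sup>2)) \<longlonglongrightarrow> 0"
      using AE_space
    proof eventually_elim
      case (elim z)
      then have "(\<lambda>n. g n z) \<longlonglongrightarrow> f z" using lim[of z] by simp
      then have "(\<lambda>n. cl M (g n z)) \<longlonglongrightarrow> cl M (f z)"
        by (rule continuous_on_tendsto_compose[OF ccl[of UNIV]]) auto
      then have "(\<lambda>n. ennreal ((cmod (cl M (f z) - cl M (g n z)))\<^sup>2)) \<longlonglongrightarrow> ennreal ((cmod (cl M (f z) - cl M (f z)))\<^sup>2)"
        by (intro tendsto_intros)
      then show ?case by simp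
    qed
  qed measurable
  then have "eventually (\<lambda>n. L2_norm_sq (\<lambda>z. cl M (f z) - cl M (g n z)) < ennreal (\<delta> / 4)) sequentially"
    unfolding L2_norm_sq_def using d by (intro order_tendstoD) auto
  then obtain n where n: "L2_norm_sq (\<lambda>z. cl M (f z) - cl M (g n z)) < ennreal (\<delta> / 4)"
    by (auto simp: eventually_sequentially)
  have "L2_norm_sq (\<lambda>z. f z - cl M (g n z)) \<le> ennreal (1 + 1) * L2_norm_sq (\<lambda>z. f z - cl M (f z)) + ennreal (1 + 1 / 1) * L2_norm_sq (\<lambda>z. cl M (f z) - cl M (g n z))"
    unfolding L2_norm_sq_def by (rule nn_integral_cmod_add_sq_le) auto
  also have "\<dots> \<le> ennreal (1 + 1) * ennreal (\<delta> / 4) + ennreal (1 + 1 / 1) * ennreal (\<delta> / 4)"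
    using M n by (intro add_mono mult_left_mono less_imp_le) auto
  also have "\<dots> = ennreal \<delta>"
  proof -
    have "2 * ennreal (\<delta> / 4) = ennreal (\<delta> / 2)" using ennreal_mult[of 2 "\<delta> / 4"] d by simp
    moreover have "ennreal (\<delta> / 2) + ennreal (\<delta> / 2) = ennreal \<delta>"
      using d ennreal_plus[of "\<delta> / 2" "\<delta> / 2"] by simp
    ultimately show ?thesis by simp
  qed
  finally show ?thesis using cg by (intro that)
qed

text \<open>Elements of \<open>L2_space\<close> are only Lebesgue measurable, while Fubini's theorem
  for \<open>lborel\<close> asks for Borel functions; a representative bridges the two.\<close>

lemma disc_borel_representative:
  fixes f :: "complex \<Rightarrow> complex"
  assumes f: "f \<in> borel_measurable (lebesgue_on disc)"
  obtains f' where "f' \<in> borel_measurable borel" "AE z in lebesgue_on disc. f z = f' z"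
proof -
  let ?F = "\<lambda>z. if z \<in> disc then f z else 0"
  have F: "?F \<in> borel_measurable lebesgue" using f by (subst borel_measurable_if) auto
  have "(\<lambda>z. Re (?F z)) \<in> borel_measurable lebesgue" "(\<lambda>z. Im (?F z)) \<in> borel_measurable lebesgue"
    using F borel_measurable_complex_iff[of ?F lebesgue] by auto
  then obtain a b where ab: "a \<in> borel_measurable lborel" "b \<in> borel_measurable lborel"
    "AE z in lborel. Re (?F z) = a z" "AE z in lborel. Im (?F z) = b z"
    using completion_ex_borel_measurable_real[of "\<lambda>z. Re (?F z)" lborel]
      completion_ex_borel_measurable_real[of "\<lambda>z. Im (?F z)" lborel] by blast
  from ab(3,4) have "AE z in lborel. ?F z = Complex (a z) (b z)"
    by eventually_elim (simp add: complex_eq_iff)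
  then have "AE z in lebesgue. ?F z = Complex (a z) (b z)" by (rule AE_completion)
  then have "AE z in lebesgue_on disc. f z = Complex (a z) (b z)"
    by (subst AE_restrict_space_iff) auto
  moreover have "(\<lambda>z. Complex (a z) (b z)) \<in> borel_measurable borel"
    using ab(1,2) by (simp add: borel_measurable_complex_iff)
  ultimately show ?thesis using that by blast
qed

lemma mollify_cong_AE:
  assumes f: "f \<in> borel_measurable (lebesgue_on disc)" "f' \<in> borel_measurable (lebesgue_on disc)" and e: "AE z in lebesgue_on disc. f z = f' z"
  shows "mollify \<epsilon> f = mollify \<epsilon> f'"
proof
  fix z
  have "(\<lambda>\<zeta>. complex_of_real (mollifier \<epsilon> z \<zeta>)) \<in> borel_measurable (lebesgue_on disc)"
    using borel_measurable_integrable[OF disc_integrable_continuous(1)[OF C_k_continuous[OF C_k_mollifier]]] .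
  then show "mollify \<epsilon> f z = mollify \<epsilon> f' z"
    unfolding mollify_def using f e
    by (intro integral_cong_AE) (auto elim!: eventually_mono)
qed

text \<open>Schur's test: both marginals of the kernel are bounded.\<close>

lemma L2_norm_sq_mollify_le:
  assumes e: "0 < \<epsilon>" "\<epsilon> < 1" and f: "f \<in> L2_space"
  shows "L2_norm_sq (mollify \<epsilon> f) \<le> ennreal (1 / (1 - \<epsilon>)\<^sup>2) * L2_norm_sq f"
proof -
  have fm: "f \<in> borel_measurable (lebesgue_on disc)" using f by (auto simp: L2_space_def)
  obtain g where g [measurable]: "g \<in> borel_measurable borel" and fg: "AE z in lebesgue_on disc. f z = g z"
    using disc_borel_representative[OF fm] .
  have gm: "g \<in> borel_measurable (lebesgue_on disc)"
    using g by (auto intro!: measurable_restrict_space1 measurable_completion)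
  have mfg: "mollify \<epsilon> f = mollify \<epsilon> g" by (rule mollify_cong_AE[OF fm gm fg])
  have Lfg: "L2_norm_sq f = L2_norm_sq g"
    unfolding L2_norm_sq_def by (rule nn_integral_cong_AE) (use fg in \<open>auto elim!: eventually_mono\<close>)
  define G where "G z = indicator disc z * ennreal ((cmod (g z))\<^sup>2)" for z
  have [measurable]: "(\<lambda>z. ennreal ((cmod (g z))\<^sup>2)) \<in> borel_measurable borel" by measurable
  have [measurable]: "G \<in> borel_measurable borel"
    unfolding G_def[abs_def] by (intro borel_measurable_times_ennreal borel_measurable_indicator) simp_all
  have [measurable]: "(\<lambda>\<zeta>. mollifier \<epsilon> z \<zeta>) \<in> borel_measurable borel" "(\<lambda>z. mollifier \<epsilon> z \<zeta>) \<in> borel_measurable borel" for z \<zeta>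
    by (rule borel_measurable_continuous_onI[OF continuous_on_mollifier2(1)], rule borel_measurable_continuous_onI[OF continuous_on_mollifier2(2)])
  have pt: "ennreal ((cmod (mollify \<epsilon> g z))\<^sup>2) \<le> (\<integral>\<^sup>+\<zeta>. ennreal (mollifier \<epsilon> z \<zeta>) * G \<zeta> \<partial>lborel)" for z
  proof -
    \<comment> \<open>Writing the kernel as a product of two square roots, Cauchy-Schwarz separates
      the total mass of the kernel, which is 1, from the average of |g|^2.\<close>
    let ?K = "\<lambda>\<zeta>. ennreal (sqrt (mollifier \<epsilon> z \<zeta>))"
    let ?H = "\<lambda>\<zeta>. indicator disc \<zeta> * ennreal (cmod (g \<zeta>))"
    have "ennreal (cmod (mollify \<epsilon> g z)) \<le> (\<integral>\<^sup>+\<zeta>. ennreal (cmod (of_real (mollifier \<epsilon> z \<zeta>) * g \<zeta>)) \<partial>lebesgue_on disc)"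
      \<comment> \<open>If the integrand is not integrable, the Bochner integral is 0 by convention
        and the bound is trivial.\<close>
      unfolding mollify_def by (cases "integrable (lebesgue_on disc) (\<lambda>\<zeta>. of_real (mollifier \<epsilon> z \<zeta>) * g \<zeta>)")
        (auto intro: integral_norm_bound_ennreal simp: not_integrable_integral_eq)
    also have "\<dots> = (\<integral>\<^sup>+\<zeta>. ?K \<zeta> * (?K \<zeta> * ?H \<zeta>) \<partial>lborel)"
      unfolding disc_nn_integral_lborel
      by (intro nn_integral_cong)
        (auto simp: norm_mult mollifier_nonneg ennreal_mult[symmetric] mult.assoc[symmetric] indicator_def)
    finally have "(ennreal (cmod (mollify \<epsilon> g z)))\<^sup>2 \<le> (\<integral>\<^sup>+\<zeta>. ?K \<zeta> * (?K \<zeta> * ?H \<zeta>) \<partial>lborel)\<^sup>2"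
      by (rule power_mono) simp
    also have "\<dots> \<le> (\<integral>\<^sup>+\<zeta>. (?K \<zeta>)\<^sup>2 \<partial>lborel) * (\<integral>\<^sup>+\<zeta>. (?K \<zeta> * ?H \<zeta>)\<^sup>2 \<partial>lborel)"
    proof (rule Cauchy_Schwarz_nn_integral)
      show K: "?K \<in> borel_measurable lborel" by measurable
      have H: "?H \<in> borel_measurable lborel"
        unfolding measurable_lborel1
        by (intro borel_measurable_times_ennreal borel_measurable_indicator) (simp, measurable)
      show "(\<lambda>\<zeta>. ?K \<zeta> * ?H \<zeta>) \<in> borel_measurable lborel"
        by (rule borel_measurable_times_ennreal[OF K H])
    qed
    also have "(\<lambda>\<zeta>. (?K \<zeta>)\<^sup>2) = (\<lambda>\<zeta>. ennreal (mollifier \<epsilon> z \<zeta>))"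
      by (simp add: ennreal_power mollifier_nonneg)
    also have "(\<lambda>\<zeta>. (?K \<zeta> * ?H \<zeta>)\<^sup>2) = (\<lambda>\<zeta>. ennreal (mollifier \<epsilon> z \<zeta>) * G \<zeta>)"
      by (auto simp: fun_eq_iff G_def power_mult_distrib ennreal_power mollifier_nonneg indicator_def)
    finally show ?thesis
      by (simp add: nn_integral_mollifier_right[OF e(1)] ennreal_power)
  qed
  have "L2_norm_sq (mollify \<epsilon> g) \<le> (\<integral>\<^sup>+z. (\<integral>\<^sup>+\<zeta>. ennreal (mollifier \<epsilon> z \<zeta>) * G \<zeta> \<partial>lborel) \<partial>lborel)"
    unfolding L2_norm_sq_def disc_nn_integral_lborel
    by (intro nn_integral_mono) (auto simp: indicator_def intro: pt)
  also have "\<dots> = (\<integral>\<^sup>+\<zeta>. (\<integral>\<^sup>+z. ennreal (mollifier \<epsilon> z \<zeta>) * G \<zeta> \<partial>lborel) \<partial>lborel)"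
  proof (rule lborel_pair.Fubini'[symmetric])
    have "(\<lambda>p. G (snd p)) \<in> borel_measurable (lborel \<Otimes>\<^sub>M (lborel :: complex measure))"
      by (rule measurable_compose[OF measurable_snd]) simp
    moreover have "(\<lambda>p. ennreal (mollifier \<epsilon> (fst p) (snd p))) \<in> borel_measurable (lborel \<Otimes>\<^sub>M lborel)"
      by (rule measurable_compose[OF mollifier_measurable]) simp
    ultimately show "(\<lambda>(z, \<zeta>). ennreal (mollifier \<epsilon> z \<zeta>) * G \<zeta>) \<in> borel_measurable (lborel \<Otimes>\<^sub>M lborel)"
      unfolding case_prod_beta by (intro borel_measurable_times_ennreal)
  qed
  also have "\<dots> = (\<integral>\<^sup>+\<zeta>. ennreal (1 / (1 - \<epsilon>)\<^sup>2) * G \<zeta> \<partial>lborel)"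
    by (intro nn_integral_cong) (simp add: nn_integral_multc nn_integral_mollifier_left[OF e])
  also have "\<dots> = ennreal (1 / (1 - \<epsilon>)\<^sup>2) * L2_norm_sq g"
  proof (subst nn_integral_cmult)
    have "integral\<^sup>N lborel G = L2_norm_sq g"
      by (simp add: L2_norm_sq_def disc_nn_integral_lborel G_def[abs_def] mult.commute)
    then show "ennreal (1 / (1 - \<epsilon>)\<^sup>2) * integral\<^sup>N lborel G = ennreal (1 / (1 - \<epsilon>)\<^sup>2) * L2_norm_sq g"
      by simp
  qed simp
  finally show ?thesis by (simp only: mfg Lfg)
qed

lemma mollify_continuous_uniform:
  assumes g: "continuous_on UNIV g" and d: "0 < (\<eta>::real)"
  obtains \<epsilon>0 where "0 < \<epsilon>0" "\<And>\<epsilon> z. 0 < \<epsilon> \<Longrightarrow> \<epsilon> < \<epsilon>0 \<Longrightarrow> \<epsilon> < 1 \<Longrightarrow> z \<in> disc \<Longrightarrow> cmod (mollify \<epsilon> g z - g z) \<le> \<eta>"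
proof -
  have "uniformly_continuous_on (cball 0 1) g"
    by (rule compact_uniformly_continuous) (auto intro: continuous_on_subset[OF g])
  then obtain r where r: "0 < r" "\<And>x y. x \<in> cball 0 1 \<Longrightarrow> y \<in> cball 0 1 \<Longrightarrow> dist y x < r \<Longrightarrow> dist (g y) (g x) < \<eta>"
    unfolding uniformly_continuous_on_def using d by metis
  \<comment> \<open>On the support of the kernel |\<zeta> - z| < 2 \<epsilon>: one \<epsilon> from
    the radius and one from moving the centre from z to (1 - \<epsilon>) z. Hence r/2.\<close>
  have "cmod (mollify \<epsilon> g z - g z) \<le> \<eta>" if e: "0 < \<epsilon>" "\<epsilon> < r / 2" "\<epsilon> < 1" and z: "z \<in> disc" for \<epsilon> z
  proof -
    let ?K = "\<lambda>\<zeta>. complex_of_real (mollifier \<epsilon> z \<zeta>)"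
    have cK: "continuous_on UNIV ?K" by (rule C_k_continuous[OF C_k_mollifier])
    have i: "integrable (lebesgue_on disc) (\<lambda>\<zeta>. ?K \<zeta> * g \<zeta>)" "integrable (lebesgue_on disc) (\<lambda>\<zeta>. ?K \<zeta> * g z)"
       "integrable (lebesgue_on disc) (mollifier \<epsilon> z)"
      by (rule disc_integrable_continuous, intro continuous_intros cK g continuous_on_mollifier2)+
    have supp: "{\<zeta>. mollifier \<epsilon> z \<zeta> \<noteq> 0} \<subseteq> disc"
    proof -
      have "closure {\<zeta>. ?K \<zeta> \<noteq> 0} \<subseteq> disc"
        using mollifier_test_function[OF e(1,3) z] by (simp add: test_function_def)
      then show ?thesis using closure_subset[of "{\<zeta>. ?K \<zeta> \<noteq> 0}"] by auto
    qed
    have "(\<integral>\<^sup>+\<zeta>. ennreal (mollifier \<epsilon> z \<zeta>) \<partial>lebesgue_on disc) = (\<integral>\<^sup>+\<zeta>. ennreal (mollifier \<epsilon> z \<zeta>) \<partial>lborel)"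
    proof -
      have "mollifier \<epsilon> z \<zeta> = 0" if "\<zeta> \<notin> disc" for \<zeta> using that supp by blast
      then show ?thesis
        unfolding disc_nn_integral_lborel by (intro nn_integral_cong) (simp add: indicator_def)
    qed
    then have one: "(LINT \<zeta>|lebesgue_on disc. mollifier \<epsilon> z \<zeta>) = 1"
      using nn_integral_eq_integral[OF i(3)] mollifier_nonneg[of \<epsilon> z] nn_integral_mollifier_right[OF e(1), of z]
      by (simp add: integral_nonneg_AE)
    have "mollify \<epsilon> g z - g z = (LINT \<zeta>|lebesgue_on disc. ?K \<zeta> * g \<zeta>) - (LINT \<zeta>|lebesgue_on disc. ?K \<zeta> * g z)"
      by (simp add: mollify_def integral_complex_of_real one)
    also have "\<dots> = (LINT \<zeta>|lebesgue_on disc. ?K \<zeta> * (g \<zeta> - g z))"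
      using i by (simp add: right_diff_distrib)
    finally have eq: "mollify \<epsilon> g z - g z = (LINT \<zeta>|lebesgue_on disc. ?K \<zeta> * (g \<zeta> - g z))" .
    have "cmod (mollify \<epsilon> g z - g z) \<le> (LINT \<zeta>|lebesgue_on disc. mollifier \<epsilon> z \<zeta> * \<eta>)"
      unfolding eq
    proof (rule Bochner_Integration.integral_norm_bound_integral)
      show "integrable (lebesgue_on disc) (\<lambda>\<zeta>. ?K \<zeta> * (g \<zeta> - g z))"
        by (rule disc_integrable_continuous, intro continuous_intros cK g)
      show "integrable (lebesgue_on disc) (\<lambda>\<zeta>. mollifier \<epsilon> z \<zeta> * \<eta>)" using i(3) by simp
      fix \<zeta> assume zz: "\<zeta> \<in> space (lebesgue_on disc)"
      have "mollifier \<epsilon> z \<zeta> * cmod (g \<zeta> - g z) \<le> mollifier \<epsilon> z \<zeta> * \<eta>"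
      proof (cases "mollifier \<epsilon> z \<zeta> = 0")
        case False
        then have "cmod (\<zeta> - (1 - \<epsilon>) *\<^sub>R z) < \<epsilon>" using mollifier_eq_0[OF e(1)] not_le by blast
        moreover have "\<zeta> - z = (\<zeta> - (1 - \<epsilon>) *\<^sub>R z) - \<epsilon> *\<^sub>R z" by (simp add: algebra_simps)
        then have "cmod (\<zeta> - z) \<le> cmod (\<zeta> - (1 - \<epsilon>) *\<^sub>R z) + cmod (\<epsilon> *\<^sub>R z)" by (metis norm_triangle_ineq4)
        moreover have "cmod (\<epsilon> *\<^sub>R z) \<le> \<epsilon>" using e z by (simp add: mult_left_le)
        ultimately have "cmod (\<zeta> - z) < r" using e(2) by linarith
        then have "dist \<zeta> z < r" by (simp add: dist_norm)
        then have "dist (g \<zeta>) (g z) < \<eta>" using r(2)[of z \<zeta>] z zz by auto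
        then show ?thesis by (intro mult_left_mono mollifier_nonneg) (simp add: dist_norm)
      qed simp
      then show "cmod (?K \<zeta> * (g \<zeta> - g z)) \<le> mollifier \<epsilon> z \<zeta> * \<eta>"
        by (simp add: norm_mult mollifier_nonneg)
    qed
    then show ?thesis by (simp add: one)
  qed
  then show ?thesis using r(1) by (intro that[of "r / 2"]) auto
qed

lemma L2_space_diff:
  assumes f: "f \<in> L2_space" and g: "g \<in> L2_space"
  shows "(\<lambda>z. f z - g z) \<in> L2_space"
proof -
  have [measurable]: "f \<in> borel_measurable (lebesgue_on disc)" "g \<in> borel_measurable (lebesgue_on disc)"
    and fin: "L2_norm_sq f < \<infinity>" "L2_norm_sq g < \<infinity>"
    using f g by (auto simp: L2_space_def)
  have "L2_norm_sq (\<lambda>z. f z - g z) \<le> ennreal (1 + 1) * L2_norm_sq f + ennreal (1 + 1 / 1) * L2_norm_sq (\<lambda>z. - g z)"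
    unfolding L2_norm_sq_def by (rule nn_integral_cmod_add_sq_le) auto
  also have "L2_norm_sq (\<lambda>z. - g z) = L2_norm_sq g" by (simp add: L2_norm_sq_def)
  also have "ennreal (1 + 1) * L2_norm_sq f + ennreal (1 + 1 / 1) * L2_norm_sq g < \<infinity>"
    using fin by (simp add: ennreal_mult_less_top)
  finally show ?thesis by (simp add: L2_space_def)
qed

lemma continuous_L2_space: "continuous_on UNIV f \<Longrightarrow> f \<in> L2_space"
  using borel_measurable_integrable[OF disc_integrable_continuous(1)[of f]] L2_norm_sq_continuous[of f]
  by (auto simp: L2_space_def)

lemma L2_space_cmult:
  assumes "f \<in> L2_space" shows "(\<lambda>z. c * f z) \<in> L2_space" "L2_norm_sq (\<lambda>z. c * f z) = ennreal ((cmod c)\<^sup>2) * L2_norm_sq f"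
proof -
  have [measurable]: "f \<in> borel_measurable (lebesgue_on disc)" and fin: "L2_norm_sq f < \<infinity>"
    using assms by (auto simp: L2_space_def)
  show n: "L2_norm_sq (\<lambda>z. c * f z) = ennreal ((cmod c)\<^sup>2) * L2_norm_sq f"
    by (simp add: L2_norm_sq_def norm_mult power_mult_distrib ennreal_mult nn_integral_cmult)
  show "(\<lambda>z. c * f z) \<in> L2_space"
    using fin n by (simp add: L2_space_def ennreal_mult_less_top)
qed

lemma L2_norm_sq_add_le:
  assumes f: "f \<in> L2_space" and g: "g \<in> L2_space" and u: "AE z in lebesgue_on disc. u z = f z + g z" and t: "0 < t"
  shows "L2_norm_sq u \<le> ennreal (1 + t) * L2_norm_sq f + ennreal (1 + 1 / t) * L2_norm_sq g"
  unfolding L2_norm_sq_def using assms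
  by (intro nn_integral_cmod_add_sq_le) (auto simp: L2_space_def)

lemma L2_norm_sq_diff_commute: "L2_norm_sq (\<lambda>z. f z - g z) = L2_norm_sq (\<lambda>z. g z - f z)"
  by (simp add: L2_norm_sq_def norm_minus_commute)

lemma mollify_L2_space:
  assumes "0 < \<epsilon>" "f \<in> L2_space" shows "mollify \<epsilon> f \<in> L2_space"
  by (rule continuous_L2_space[OF C_k_continuous[OF C_k_mollify[OF assms(1) L2_space_integrable[OF assms(2)]]]])

lemma integrable_mult_continuous:
  assumes h: "continuous_on UNIV (h :: complex \<Rightarrow> complex)" and f: "integrable (lebesgue_on disc) f"
  shows "integrable (lebesgue_on disc) (\<lambda>z. h z * f z)"
proof -
  have "compact (h ` cball 0 1)"
    by (intro compact_continuous_image continuous_on_subset[OF h]) auto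
  then have "bounded (h ` cball 0 1)" by (rule compact_imp_bounded)
  then obtain B where "\<forall>y\<in>h ` cball 0 1. cmod y \<le> B"
    unfolding bounded_iff by (elim exE)
  then have B: "cmod (h z) \<le> B" if "z \<in> cball 0 1" for z using that by blast
  show ?thesis
  proof (rule Bochner_Integration.integrable_bound)
    show "integrable (lebesgue_on disc) (\<lambda>z. B * cmod (f z))" using f by simp
    show "(\<lambda>z. h z * f z) \<in> borel_measurable (lebesgue_on disc)"
      using borel_measurable_integrable[OF disc_integrable_continuous(1)[OF h]] borel_measurable_integrable[OF f]
      by (rule borel_measurable_times)
    show "AE z in lebesgue_on disc. cmod (h z * f z) \<le> norm (B * cmod (f z))"
    proof (rule AE_I2)
      fix z assume "z \<in> space (lebesgue_on disc)"
      then have "cmod (h z) \<le> B" by (intro B) auto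
      moreover from this have "0 \<le> B" using norm_ge_zero order_trans by blast
      ultimately show "cmod (h z * f z) \<le> norm (B * cmod (f z))" by (simp add: norm_mult mult_right_mono)
    qed
  qed
qed

lemma mollify_tendsto:
  assumes f: "f \<in> L2_space" and d: "0 < (\<delta>::real)"
  obtains \<epsilon>0 where "0 < \<epsilon>0" "\<epsilon>0 \<le> 1 / 2"
    "\<And>\<epsilon>. 0 < \<epsilon> \<Longrightarrow> \<epsilon> < \<epsilon>0 \<Longrightarrow> L2_norm_sq (\<lambda>z. mollify \<epsilon> f z - f z) \<le> ennreal \<delta>"
proof -
  \<comment> \<open>The errors are 4 \<delta>' for the mollified difference f - g (as \<epsilon> <
    1/2), \<delta>' for mollifying g, and \<delta>' for g - f. Adding squares doubles them, the last
    two twice: 8 + 4 + 4 = 16.\<close>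
  define \<delta>' where "\<delta>' = \<delta> / 16"
  have d': "0 < \<delta>'" using d by (simp add: \<delta>'_def)
  obtain g where g: "continuous_on UNIV g" and fg: "L2_norm_sq (\<lambda>z. f z - g z) \<le> ennreal \<delta>'"
    using L2_bounded_continuous_approx[OF f d'] .
  have gL: "g \<in> L2_space" by (rule continuous_L2_space[OF g])
  define m where "m = measure lborel disc"
  have m: "emeasure (lebesgue_on disc) disc = ennreal m" "0 \<le> m"
  proof -
    have "emeasure (lebesgue_on disc) disc = emeasure lborel disc" by (simp add: emeasure_restrict_space)
    also have "\<dots> = ennreal m"
      unfolding m_def using emeasure_bounded_finite[of disc] by (intro emeasure_eq_ennreal_measure) auto
    finally show "emeasure (lebesgue_on disc) disc = ennreal m" .
  qed (simp add: m_def)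
  define \<eta> where "\<eta> = sqrt (\<delta>' / (m + 1))"
  have \<eta>: "0 < \<eta>" "\<eta>\<^sup>2 * m \<le> \<delta>'" using d' m(2) by (auto simp: \<eta>_def field_simps)
  obtain \<epsilon>0 where e0: "0 < \<epsilon>0" "\<And>\<epsilon> z. 0 < \<epsilon> \<Longrightarrow> \<epsilon> < \<epsilon>0 \<Longrightarrow> \<epsilon> < 1 \<Longrightarrow> z \<in> disc \<Longrightarrow> cmod (mollify \<epsilon> g z - g z) \<le> \<eta>"
    by (rule mollify_continuous_uniform[OF g \<eta>(1)], rule that)
  have "L2_norm_sq (\<lambda>z. mollify \<epsilon> f z - f z) \<le> ennreal \<delta>" if e: "0 < \<epsilon>" "\<epsilon> < min \<epsilon>0 (1/2)" for \<epsilon>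
  proof -
    have e1: "\<epsilon> < 1" using e by simp
    let ?h = "\<lambda>z. f z - g z"
    have h: "?h \<in> L2_space" by (rule L2_space_diff[OF f gL])
    have sub: "mollify \<epsilon> ?h z = mollify \<epsilon> f z - mollify \<epsilon> g z" for z
    proof -
      have "integrable (lebesgue_on disc) (\<lambda>\<zeta>. complex_of_real (mollifier \<epsilon> z \<zeta>) * q \<zeta>)" if "q \<in> L2_space" for q
        by (rule integrable_mult_continuous[OF C_k_continuous[OF C_k_mollifier] L2_space_integrable[OF that]])
      from this[OF f] this[OF gL] show ?thesis
        unfolding mollify_def right_diff_distrib by (rule Bochner_Integration.integral_diff)
    qed
    have mh: "L2_norm_sq (mollify \<epsilon> ?h) \<le> 4 * ennreal \<delta>'"
    proof -
      have "1 / (1 - \<epsilon>)\<^sup>2 \<le> 1 / (1 / 2)\<^sup>2"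
        using e by (intro divide_left_mono power_mono) auto
      then have "ennreal (1 / (1 - \<epsilon>)\<^sup>2) \<le> ennreal 4" by (intro ennreal_leI) (simp add: power2_eq_square)
      then have "ennreal (1 / (1 - \<epsilon>)\<^sup>2) * L2_norm_sq ?h \<le> 4 * ennreal \<delta>'"
        using fg by (intro mult_mono) auto
      then show ?thesis using L2_norm_sq_mollify_le[OF e(1) e1 h] by (rule order_trans[rotated])
    qed
    have mg: "L2_norm_sq (\<lambda>z. mollify \<epsilon> g z - g z) \<le> ennreal \<delta>'"
    proof -
      have "L2_norm_sq (\<lambda>z. mollify \<epsilon> g z - g z) \<le> (\<integral>\<^sup>+z. ennreal (\<eta>\<^sup>2) \<partial>lebesgue_on disc)"
        unfolding L2_norm_sq_def using e e1
        by (intro nn_integral_mono ennreal_leI power_mono e0) auto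
      also have "\<dots> = ennreal (\<eta>\<^sup>2 * m)" using m by (simp add: ennreal_mult)
      also have "\<dots> \<le> ennreal \<delta>'" by (rule ennreal_leI[OF \<eta>(2)])
      finally show ?thesis .
    qed
    have Mg: "(\<lambda>z. mollify \<epsilon> g z - g z) \<in> L2_space" "(\<lambda>z. g z - f z) \<in> L2_space"
      by (intro L2_space_diff mollify_L2_space e gL f)+
    have "L2_norm_sq (\<lambda>z. mollify \<epsilon> g z - f z) \<le> ennreal (1 + 1) * L2_norm_sq (\<lambda>z. mollify \<epsilon> g z - g z) + ennreal (1 + 1 / 1) * L2_norm_sq (\<lambda>z. g z - f z)"
      by (rule L2_norm_sq_add_le[OF Mg]) auto
    also have "\<dots> \<le> ennreal (1 + 1) * ennreal \<delta>' + ennreal (1 + 1 / 1) * ennreal \<delta>'"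
      using mg fg by (intro add_mono mult_left_mono) (auto simp: L2_norm_sq_diff_commute[of g])
    also have "\<dots> = 4 * ennreal \<delta>'" by (simp add: distrib_right[symmetric])
    finally have mgf: "L2_norm_sq (\<lambda>z. mollify \<epsilon> g z - f z) \<le> 4 * ennreal \<delta>'" .
    have "L2_norm_sq (\<lambda>z. mollify \<epsilon> f z - f z) \<le> ennreal (1 + 1) * L2_norm_sq (mollify \<epsilon> ?h) + ennreal (1 + 1 / 1) * L2_norm_sq (\<lambda>z. mollify \<epsilon> g z - f z)"
      by (rule L2_norm_sq_add_le) (auto simp: sub intro!: mollify_L2_space L2_space_diff e h gL f)
    also have "\<dots> \<le> ennreal (1 + 1) * (4 * ennreal \<delta>') + ennreal (1 + 1 / 1) * (4 * ennreal \<delta>')"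
      using mh mgf by (intro add_mono mult_left_mono) auto
    also have "\<dots> = ennreal (16 * \<delta>')"
      using d' by (simp add: ennreal_mult mult.assoc[symmetric] distrib_right[symmetric])
    also have "\<dots> = ennreal \<delta>" by (simp add: \<delta>'_def)
    finally show ?thesis .
  qed
  then show ?thesis using e0(1) by (intro that[of "min \<epsilon>0 (1/2)"]) auto
qed

section \<open>Weak derivatives and density of smooth functions\<close>

text \<open>By \<open>dir_deriv_mollify\<close>, both candidates have the same mollifications on the
  disc, namely the derivative of the mollified u divided by 1 - \<epsilon>. Their difference is thus
  an L^2 limit of functions vanishing on the disc.\<close>

lemma weak_deriv_unique:
  assumes g: "has_weak_deriv e u g" and h: "has_weak_deriv e u h"
  shows "AE z in lebesgue_on disc. g z = h z"
proof -
  let ?d = "\<lambda>z. g z - h z"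
  have gL: "g \<in> L2_space" and hL: "h \<in> L2_space" using g h by (auto simp: has_weak_deriv_def)
  have dL: "?d \<in> L2_space" by (rule L2_space_diff[OF gL hL])
  have "L2_norm_sq ?d \<le> 0 + ennreal \<delta>" if d: "0 < \<delta>" for \<delta>
  proof -
    obtain \<epsilon>0 where e0: "0 < \<epsilon>0" "\<epsilon>0 \<le> 1 / 2"
      "\<And>\<epsilon>. 0 < \<epsilon> \<Longrightarrow> \<epsilon> < \<epsilon>0 \<Longrightarrow> L2_norm_sq (\<lambda>z. mollify \<epsilon> ?d z - ?d z) \<le> ennreal \<delta>"
      by (rule mollify_tendsto[OF dL d], rule that)
    define \<epsilon> where "\<epsilon> = \<epsilon>0 / 2"
    have e: "0 < \<epsilon>" "\<epsilon> < \<epsilon>0" "\<epsilon> < 1" using e0(1,2) by (auto simp: \<epsilon>_def)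
    have "mollify \<epsilon> ?d z = 0" if z: "z \<in> disc" for z
    proof -
      have "mollify \<epsilon> g z = mollify \<epsilon> h z"
        using dir_deriv_mollify[OF e(1,3) z g] dir_deriv_mollify[OF e(1,3) z h] e(3) by simp
      moreover have "mollify \<epsilon> ?d z = mollify \<epsilon> g z - mollify \<epsilon> h z"
        unfolding mollify_def right_diff_distrib
        by (intro Bochner_Integration.integral_diff integrable_mult_continuous[OF C_k_continuous[OF C_k_mollifier]] L2_space_integrable gL hL)
      ultimately show ?thesis by simp
    qed
    then have "L2_norm_sq (\<lambda>z. mollify \<epsilon> ?d z - ?d z) = L2_norm_sq ?d"
      unfolding L2_norm_sq_def by (intro nn_integral_cong) (simp add: norm_minus_commute)
    then show ?thesis using e0(3)[OF e(1,2)] by simp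
  qed
  then have "L2_norm_sq ?d \<le> 0" by (rule ennreal_le_epsilon)
  then have "L2_norm_sq ?d = 0" by simp
  moreover have "(\<lambda>z. ennreal ((cmod (?d z))\<^sup>2)) \<in> borel_measurable (lebesgue_on disc)"
  proof -
    have [measurable]: "?d \<in> borel_measurable (lebesgue_on disc)" using dL by (simp add: L2_space_def)
    show ?thesis by measurable
  qed
  ultimately have "AE z in lebesgue_on disc. ennreal ((cmod (?d z))\<^sup>2) = 0"
    by (simp add: L2_norm_sq_def nn_integral_0_iff_AE)
  then show ?thesis by eventually_elim simp
qed

lemma test_functionD:
  assumes "test_function \<phi>"
  shows "C_k k \<phi>" "continuous_on UNIV (dir_deriv e \<phi>)" "\<phi> (cis t) = 0"
proof -
  show c: "C_k k \<phi>" for k using assms by (simp add: test_function_def smooth_def)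
  show "continuous_on UNIV (dir_deriv e \<phi>)" using c[of 1] by simp
  have "cis t \<notin> closure {z. \<phi> z \<noteq> 0}" using assms by (auto simp: test_function_def)
  then show "\<phi> (cis t) = 0" using closure_subset[of "{z. \<phi> z \<noteq> 0}"] by auto
qed

lemma has_weak_deriv_diff:
  assumes u: "has_weak_deriv e u g" and v: "has_weak_deriv e v h"
  shows "has_weak_deriv e (\<lambda>z. u z - v z) (\<lambda>z. g z - h z)"
proof -
  have L: "u \<in> L2_space" "v \<in> L2_space" "g \<in> L2_space" "h \<in> L2_space"
    using u v by (auto simp: has_weak_deriv_def)
  have "(LINT z|lebesgue_on disc. (u z - v z) * dir_deriv e \<phi> z) = - (LINT z|lebesgue_on disc. (g z - h z) * \<phi> z)"
    if t: "test_function \<phi>" for \<phi>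
  proof -
    note c = test_functionD(2)[OF t] C_k_continuous[OF test_functionD(1)[OF t]]
    have i: "integrable (lebesgue_on disc) (\<lambda>z. f z * dir_deriv e \<phi> z)" "integrable (lebesgue_on disc) (\<lambda>z. f z * \<phi> z)"
      if "f \<in> L2_space" for f
      using integrable_mult_continuous[OF c(1) L2_space_integrable[OF that]]
        integrable_mult_continuous[OF c(2) L2_space_integrable[OF that]]
      by (simp_all add: mult.commute)
    show ?thesis
      using u v t i L by (simp add: left_diff_distrib has_weak_deriv_def)
  qed
  then show ?thesis using L by (simp add: has_weak_deriv_def L2_space_diff)
qed

text \<open>Stokes' theorem for f \<phi>, whose boundary integral vanishes because a test function
  is 0 on the circle.\<close>

lemma has_weak_deriv_C_k:
  assumes f: "C_k 1 f" and e: "e \<in> {1, \<i>}"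
  shows "has_weak_deriv e f (dir_deriv e f)"
proof -
  have cf: "continuous_on UNIV f" "continuous_on UNIV (dir_deriv e f)"
    using C_k_continuous[OF f] f by auto
  have df: "f differentiable (at z)" for z using f by simp
  have "(LINT z|lebesgue_on disc. f z * dir_deriv e \<phi> z) = - (LINT z|lebesgue_on disc. dir_deriv e f z * \<phi> z)"
    if t: "test_function \<phi>" for \<phi>
  proof -
    note c = test_functionD(2)[OF t] C_k_continuous[OF test_functionD(1)[OF t]]
    have d\<phi>: "\<phi> differentiable (at z)" for z using test_functionD(1)[OF t, of 1] by simp
    have p: "C_k 1 (\<lambda>z. f z * \<phi> z)" by (intro C_k_mult f test_functionD(1)[OF t])
    have "(LINT z|lebesgue_on disc. dir_deriv e (\<lambda>z. f z * \<phi> z) z) = 0"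
      using e stokes_x[OF p] stokes_y[OF p] by (auto simp: test_functionD(3)[OF t])
    then have "(LINT z|lebesgue_on disc. f z * dir_deriv e \<phi> z + dir_deriv e f z * \<phi> z) = 0"
      by (simp add: dir_deriv_mult[OF df d\<phi>])
    moreover have "integrable (lebesgue_on disc) (\<lambda>z. f z * dir_deriv e \<phi> z)" "integrable (lebesgue_on disc) (\<lambda>z. dir_deriv e f z * \<phi> z)"
      by (rule disc_integrable_continuous, intro continuous_intros cf c)+
    ultimately show ?thesis by (simp add: add_eq_0_iff)
  qed
  then show ?thesis using cf by (simp add: has_weak_deriv_def continuous_L2_space)
qed

lemma has_weak_deriv_weak_deriv:
  assumes "u \<in> H1_space" "e \<in> {1, \<i>}"
  shows "has_weak_deriv e u (weak_deriv e u)"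
proof -
  have "\<exists>g. has_weak_deriv e u g" using assms by (auto simp: H1_space_def)
  then show ?thesis unfolding weak_deriv_def by (rule someI_ex)
qed

lemma weak_deriv_L2_space: "u \<in> H1_space \<Longrightarrow> e \<in> {1, \<i>} \<Longrightarrow> weak_deriv e u \<in> L2_space"
  using has_weak_deriv_weak_deriv by (auto simp: has_weak_deriv_def)

lemma H1_space_C_k: "C_k 1 f \<Longrightarrow> f \<in> H1_space"
  using has_weak_deriv_C_k[of f] by (auto simp: H1_space_def has_weak_deriv_def)

lemma H1_space_diff: "u \<in> H1_space \<Longrightarrow> v \<in> H1_space \<Longrightarrow> (\<lambda>z. u z - v z) \<in> H1_space"
  using has_weak_deriv_diff by (auto simp: H1_space_def intro!: L2_space_diff) blast+

lemma weak_deriv_diff: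
  assumes u: "u \<in> H1_space" and v: "v \<in> H1_space" and e: "e \<in> {1, \<i>}"
  shows "AE z in lebesgue_on disc. weak_deriv e (\<lambda>z. u z - v z) z = weak_deriv e u z - weak_deriv e v z"
  by (rule weak_deriv_unique[OF has_weak_deriv_weak_deriv[OF H1_space_diff[OF u v] e]
       has_weak_deriv_diff[OF has_weak_deriv_weak_deriv[OF u e] has_weak_deriv_weak_deriv[OF v e]]])

lemma weak_deriv_C_k:
  assumes f: "C_k 1 f" and e: "e \<in> {1, \<i>}"
  shows "AE z in lebesgue_on disc. weak_deriv e f z = dir_deriv e f z"
  by (rule weak_deriv_unique[OF has_weak_deriv_weak_deriv[OF H1_space_C_k[OF f] e] has_weak_deriv_C_k[OF f e]])

lemma L2_norm_sq_cong_AE: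
  "AE z in lebesgue_on disc. f z = g z \<Longrightarrow> L2_norm_sq f = L2_norm_sq g"
  unfolding L2_norm_sq_def by (rule nn_integral_cong_AE) (auto elim: eventually_mono)

lemma L2_norm_sq_weak_deriv_diff:
  assumes f: "C_k 1 f" and u: "u \<in> H1_space" and e: "e \<in> {1, \<i>}"
  shows "L2_norm_sq (weak_deriv e (\<lambda>z. f z - u z)) = L2_norm_sq (\<lambda>z. dir_deriv e f z - weak_deriv e u z)"
proof (rule L2_norm_sq_cong_AE)
  show "AE z in lebesgue_on disc. weak_deriv e (\<lambda>z. f z - u z) z = dir_deriv e f z - weak_deriv e u z"
    using weak_deriv_diff[OF H1_space_C_k[OF f] u e] weak_deriv_C_k[OF f e] by eventually_elim simp
qed

text \<open>The dilation factor adds an error: (1 - \<epsilon>) Mg - g = (1 - \<epsilon>)(Mg - g) -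
  \<epsilon> g, where Mg is the mollification of g. Both terms are small in L^2.\<close>

lemma dir_deriv_mollify_approx:
  assumes u: "has_weak_deriv e u g" and d: "0 < (\<delta>::real)"
  obtains \<epsilon>0 where "0 < \<epsilon>0" "\<epsilon>0 \<le> 1 / 2"
    "\<And>\<epsilon>. 0 < \<epsilon> \<Longrightarrow> \<epsilon> < \<epsilon>0 \<Longrightarrow> L2_norm_sq (\<lambda>z. dir_deriv e (mollify \<epsilon> u) z - g z) \<le> ennreal \<delta>"
proof -
  have gL: "g \<in> L2_space" using u by (simp add: has_weak_deriv_def)
  define a where "a = enn2real (L2_norm_sq g)"
  have a: "L2_norm_sq g = ennreal a" "0 \<le> a"
    using gL by (auto simp: a_def L2_space_def)
  have d4: "0 < \<delta> / 4" using d by simp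
  obtain \<epsilon>1 where e1: "0 < \<epsilon>1" "\<epsilon>1 \<le> 1 / 2"
    "\<And>\<epsilon>. 0 < \<epsilon> \<Longrightarrow> \<epsilon> < \<epsilon>1 \<Longrightarrow> L2_norm_sq (\<lambda>z. mollify \<epsilon> g z - g z) \<le> ennreal (\<delta> / 4)"
    by (rule mollify_tendsto[OF gL d4], rule that)
  \<comment> \<open>The second bound makes \<epsilon>^2 a <= \<delta>/4, which controls the term
    \<epsilon> g; a + 1 avoids division by 0.\<close>
  define \<epsilon>0 where "\<epsilon>0 = min \<epsilon>1 (\<delta> / 4 / (a + 1))"
  have "\<epsilon>0 \<le> \<epsilon>1" by (simp add: \<epsilon>0_def)
  then have e0: "0 < \<epsilon>0" "\<epsilon>0 \<le> 1 / 2" using e1(1,2) d a(2) by (simp add: \<epsilon>0_def, linarith)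
  have "L2_norm_sq (\<lambda>z. dir_deriv e (mollify \<epsilon> u) z - g z) \<le> ennreal \<delta>" if e: "0 < \<epsilon>" "\<epsilon> < \<epsilon>0" for \<epsilon>
  proof -
    have e': "\<epsilon> < 1" "\<epsilon> < \<epsilon>1" using e e0 \<open>\<epsilon>0 \<le> \<epsilon>1\<close> by linarith+
    let ?f = "\<lambda>z. of_real (1 - \<epsilon>) * (mollify \<epsilon> g z - g z)" and ?h = "\<lambda>z. of_real (- \<epsilon>) * g z"
    have M: "(\<lambda>z. mollify \<epsilon> g z - g z) \<in> L2_space" by (intro L2_space_diff mollify_L2_space e gL)
    have fh: "?f \<in> L2_space" "?h \<in> L2_space" by (intro L2_space_cmult M gL)+
    have A: "L2_norm_sq ?f \<le> ennreal (\<delta> / 4)"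
    proof -
      have "cmod (of_real (1 - \<epsilon>)) = 1 - \<epsilon>" using e' by (simp only: norm_of_real)
      then have "(cmod (of_real (1 - \<epsilon>)))\<^sup>2 \<le> 1" using e e' by (simp add: abs_square_le_1)
      then have "ennreal ((cmod (of_real (1 - \<epsilon>)))\<^sup>2) \<le> 1"
        using ennreal_leI by fastforce
      then have "ennreal ((cmod (of_real (1 - \<epsilon>)))\<^sup>2) * L2_norm_sq (\<lambda>z. mollify \<epsilon> g z - g z) \<le> 1 * ennreal (\<delta> / 4)"
        using e1(3)[OF e(1) e'(2)] by (intro mult_mono) auto
      then show ?thesis unfolding L2_space_cmult(2)[OF M] by simp
    qed
    have B: "L2_norm_sq ?h \<le> ennreal (\<delta> / 4)"
    proof -
      have "\<epsilon>\<^sup>2 * a \<le> \<epsilon> * (a + 1)" using e e' a(2) by (intro mult_mono) (auto simp: power2_eq_square mult_left_le)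
      also have "\<dots> \<le> (\<delta> / 4 / (a + 1)) * (a + 1)" using e a(2) by (intro mult_right_mono) (auto simp: \<epsilon>0_def)
      also have "\<dots> = \<delta> / 4" using a(2) nonzero_eq_divide_eq[of "a + 1" "\<delta> / 4 / (a + 1)" "\<delta> / 4"] by simp
      finally have "ennreal (\<epsilon>\<^sup>2 * a) \<le> ennreal (\<delta> / 4)" by (rule ennreal_leI)
      then show ?thesis unfolding L2_space_cmult(2)[OF gL] a(1) using a(2) by (simp add: ennreal_mult)
    qed
    have "L2_norm_sq (\<lambda>z. dir_deriv e (mollify \<epsilon> u) z - g z) \<le> ennreal (1 + 1) * L2_norm_sq ?f + ennreal (1 + 1 / 1) * L2_norm_sq ?h"
    proof (rule L2_norm_sq_add_le[OF fh AE_I2])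
      fix z assume "z \<in> space (lebesgue_on disc)"
      then have z: "z \<in> disc" by simp
      show "dir_deriv e (mollify \<epsilon> u) z - g z = ?f z + ?h z"
        unfolding dir_deriv_mollify[OF e(1) e'(1) z u] by (simp add: algebra_simps)
    qed simp
    also have "\<dots> \<le> ennreal (1 + 1) * ennreal (\<delta> / 4) + ennreal (1 + 1 / 1) * ennreal (\<delta> / 4)"
      by (intro add_mono mult_left_mono A B) auto
    also have "\<dots> = ennreal \<delta>"
    proof -
      have "2 * ennreal (\<delta> / 4) = ennreal (\<delta> / 2)" using ennreal_mult[of 2 "\<delta> / 4"] d by simp
      moreover have "ennreal (\<delta> / 2) + ennreal (\<delta> / 2) = ennreal \<delta>"
        using d ennreal_plus[of "\<delta> / 2" "\<delta> / 2"] by simp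
      ultimately show ?thesis by simp
    qed
    finally show ?thesis .
  qed
  then show ?thesis using e0 that by blast
qed

lemma smooth_dense_H1:
  assumes u: "u \<in> H1_space" and d: "0 < (\<delta>::real)"
  obtains \<phi> where "smooth \<phi>" "H1_norm_sq (\<lambda>z. \<phi> z - u z) \<le> ennreal \<delta>"
proof -
  have uL: "u \<in> L2_space" using u by (simp add: H1_space_def)
  have d3: "0 < \<delta> / 3" using d by simp
  have w: "has_weak_deriv 1 u (weak_deriv 1 u)" "has_weak_deriv \<i> u (weak_deriv \<i> u)"
    by (rule has_weak_deriv_weak_deriv[OF u], simp)+
  obtain e1 where e1: "0 < e1" "e1 \<le> 1 / 2" "\<And>\<epsilon>. 0 < \<epsilon> \<Longrightarrow> \<epsilon> < e1 \<Longrightarrow> L2_norm_sq (\<lambda>z. mollify \<epsilon> u z - u z) \<le> ennreal (\<delta> / 3)"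
    by (rule mollify_tendsto[OF uL d3], rule that)
  obtain e2 where e2: "0 < e2" "e2 \<le> 1 / 2" "\<And>\<epsilon>. 0 < \<epsilon> \<Longrightarrow> \<epsilon> < e2 \<Longrightarrow> L2_norm_sq (\<lambda>z. dir_deriv 1 (mollify \<epsilon> u) z - weak_deriv 1 u z) \<le> ennreal (\<delta> / 3)"
    by (rule dir_deriv_mollify_approx[OF w(1) d3], rule that)
  obtain e3 where e3: "0 < e3" "e3 \<le> 1 / 2" "\<And>\<epsilon>. 0 < \<epsilon> \<Longrightarrow> \<epsilon> < e3 \<Longrightarrow> L2_norm_sq (\<lambda>z. dir_deriv \<i> (mollify \<epsilon> u) z - weak_deriv \<i> u z) \<le> ennreal (\<delta> / 3)"
    by (rule dir_deriv_mollify_approx[OF w(2) d3], rule that)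
  define \<epsilon> where "\<epsilon> = min e1 (min e2 e3) / 2"
  have e: "0 < \<epsilon>" "\<epsilon> < e1" "\<epsilon> < e2" "\<epsilon> < e3" using e1(1) e2(1) e3(1) by (auto simp: \<epsilon>_def min_def)
  have C: "C_k k (mollify \<epsilon> u)" for k by (rule C_k_mollify[OF e(1) L2_space_integrable[OF uL]])
  have "H1_norm_sq (\<lambda>z. mollify \<epsilon> u z - u z) \<le> ennreal (\<delta> / 3) + ennreal (\<delta> / 3) + ennreal (\<delta> / 3)"
    unfolding H1_norm_sq_def using e1(3) e2(3) e3(3) e
    by (intro add_mono) (simp_all add: L2_norm_sq_weak_deriv_diff[OF C u])
  also have "\<dots> = ennreal \<delta>" using d by (simp add: ennreal_plus[symmetric] del: ennreal_plus)
  finally show ?thesis using C by (intro that[of "mollify \<epsilon> u"]) (auto simp: smooth_def)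
qed

section \<open>Boundary traces\<close>

text \<open>The parallelogram identity. It expresses the H^1 norm by \<open>weak_d\<close> and
  \<open>weak_dbar\<close> without loss.\<close>

lemma L2_norm_sq_wirtinger:
  assumes a: "a \<in> L2_space" and b: "b \<in> L2_space"
  shows "2 * (L2_norm_sq (\<lambda>z. (a z - \<i> * b z) / 2) + L2_norm_sq (\<lambda>z. (a z + \<i> * b z) / 2)) = L2_norm_sq a + L2_norm_sq b"
proof -
  have [measurable]: "a \<in> borel_measurable (lebesgue_on disc)" "b \<in> borel_measurable (lebesgue_on disc)"
    using a b by (auto simp: L2_space_def)
  have pt: "2 * ((cmod ((x - \<i> * y) / 2))\<^sup>2 + (cmod ((x + \<i> * y) / 2))\<^sup>2) = (cmod x)\<^sup>2 + (cmod y)\<^sup>2" for x y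
    unfolding cmod_power2 by (simp add: power2_eq_square field_simps)
  have "2 * (L2_norm_sq (\<lambda>z. (a z - \<i> * b z) / 2) + L2_norm_sq (\<lambda>z. (a z + \<i> * b z) / 2)) =
     (\<integral>\<^sup>+z. ennreal 2 * (ennreal ((cmod ((a z - \<i> * b z) / 2))\<^sup>2) + ennreal ((cmod ((a z + \<i> * b z) / 2))\<^sup>2)) \<partial>lebesgue_on disc)"
    by (simp add: L2_norm_sq_def nn_integral_add nn_integral_cmult)
  also have "\<dots> = (\<integral>\<^sup>+z. ennreal ((cmod (a z))\<^sup>2) + ennreal ((cmod (b z))\<^sup>2) \<partial>lebesgue_on disc)"
    by (intro nn_integral_cong) (subst ennreal_plus[symmetric] ennreal_mult[symmetric] | simp only: pt | simp)+
  also have "\<dots> = L2_norm_sq a + L2_norm_sq b"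
    by (simp add: L2_norm_sq_def nn_integral_add)
  finally show ?thesis .
qed

lemma wirtinger_L2_space:
  assumes "a \<in> L2_space" "b \<in> L2_space"
  shows "(\<lambda>z. (a z - \<i> * b z) / 2) \<in> L2_space" "(\<lambda>z. (a z + \<i> * b z) / 2) \<in> L2_space"
proof -
  have "(\<lambda>z. (1/2) * (a z - \<i> * b z)) \<in> L2_space" "(\<lambda>z. (1/2) * (a z - (- \<i>) * b z)) \<in> L2_space"
    by (intro L2_space_cmult L2_space_diff assms)+
  then show "(\<lambda>z. (a z - \<i> * b z) / 2) \<in> L2_space" "(\<lambda>z. (a z + \<i> * b z) / 2) \<in> L2_space"
    by simp_all
qed

lemma weak_d_L2_space:
  assumes "u \<in> H1_space" shows "weak_d u \<in> L2_space" "weak_dbar u \<in> L2_space"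
  unfolding weak_d_def[abs_def] weak_dbar_def[abs_def]
  by (intro wirtinger_L2_space weak_deriv_L2_space assms; simp)+

lemma H1_norm_sq_eq:
  assumes "u \<in> H1_space"
  shows "H1_norm_sq u = L2_norm_sq u + 2 * (L2_norm_sq (weak_d u) + L2_norm_sq (weak_dbar u))"
proof -
  have "weak_deriv 1 u \<in> L2_space" "weak_deriv \<i> u \<in> L2_space"
    by (simp_all add: weak_deriv_L2_space assms)
  from L2_norm_sq_wirtinger[OF this] show ?thesis
    by (simp add: H1_norm_sq_def weak_d_def[abs_def] weak_dbar_def[abs_def] add.assoc)
qed

lemma H1_norm_sq_ge:
  assumes "u \<in> H1_space"
  shows "L2_norm_sq u \<le> H1_norm_sq u" "L2_norm_sq (weak_d u) \<le> H1_norm_sq u" "L2_norm_sq (weak_dbar u) \<le> H1_norm_sq u"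
    "L2_norm_sq u + L2_norm_sq (weak_d u) + L2_norm_sq (weak_dbar u) \<le> H1_norm_sq u"
proof -
  have "x \<le> x + 2 * (y + z)" "y \<le> x + 2 * (y + z)" "z \<le> x + 2 * (y + z)" "x + y + z \<le> x + 2 * (y + z)" for x y z :: ennreal
    unfolding mult_2 by (auto simp: add.assoc intro: add_increasing2 add_increasing add_left_mono)
  then show "L2_norm_sq u \<le> H1_norm_sq u" "L2_norm_sq (weak_d u) \<le> H1_norm_sq u" "L2_norm_sq (weak_dbar u) \<le> H1_norm_sq u"
    "L2_norm_sq u + L2_norm_sq (weak_d u) + L2_norm_sq (weak_dbar u) \<le> H1_norm_sq u"
    unfolding H1_norm_sq_eq[OF assms] by auto
qed

lemma weak_d_diff:
  assumes f: "C_k 1 f" and u: "u \<in> H1_space"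
  shows "AE z in lebesgue_on disc. weak_d (\<lambda>z. f z - u z) z = dz f z - weak_d u z"
    "AE z in lebesgue_on disc. weak_dbar (\<lambda>z. f z - u z) z = dzbar f z - weak_dbar u z"
proof -
  have e: "AE z in lebesgue_on disc. weak_deriv e (\<lambda>z. f z - u z) z = dir_deriv e f z - weak_deriv e u z"
    if "e \<in> {1, \<i>}" for e
    using weak_deriv_diff[OF H1_space_C_k[OF f] u that] weak_deriv_C_k[OF f that] by eventually_elim simp
  have "AE z in lebesgue_on disc. weak_deriv 1 (\<lambda>z. f z - u z) z = dir_deriv 1 f z - weak_deriv 1 u z"
    "AE z in lebesgue_on disc. weak_deriv \<i> (\<lambda>z. f z - u z) z = dir_deriv \<i> f z - weak_deriv \<i> u z"
    by (rule e, simp)+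
  then have "AE z in lebesgue_on disc. weak_d (\<lambda>z. f z - u z) z = dz f z - weak_d u z \<and>
      weak_dbar (\<lambda>z. f z - u z) z = dzbar f z - weak_dbar u z"
    by eventually_elim
      (simp only: weak_d_def weak_dbar_def dz_def dzbar_def, simp add: algebra_simps diff_divide_distrib add_divide_distrib)
  then show "AE z in lebesgue_on disc. weak_d (\<lambda>z. f z - u z) z = dz f z - weak_d u z"
    "AE z in lebesgue_on disc. weak_dbar (\<lambda>z. f z - u z) z = dzbar f z - weak_dbar u z"
    by (auto elim: eventually_mono)
qed

lemma weak_d_C_k:
  assumes f: "C_k 1 f"
  shows "L2_norm_sq (weak_d f) = L2_norm_sq (dz f)" "L2_norm_sq (weak_dbar f) = L2_norm_sq (dzbar f)"
proof -
  have "AE z in lebesgue_on disc. weak_deriv 1 f z = dir_deriv 1 f z" "AE z in lebesgue_on disc. weak_deriv \<i> f z = dir_deriv \<i> f z"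
    by (rule weak_deriv_C_k[OF f], simp)+
  then have "AE z in lebesgue_on disc. weak_d f z = dz f z \<and> weak_dbar f z = dzbar f z"
    by eventually_elim (simp add: weak_d_def weak_dbar_def dz_def dzbar_def)
  then have *: "AE z in lebesgue_on disc. weak_d f z = dz f z" "AE z in lebesgue_on disc. weak_dbar f z = dzbar f z"
    by (auto elim: eventually_mono)
  show "L2_norm_sq (weak_d f) = L2_norm_sq (dz f)" "L2_norm_sq (weak_dbar f) = L2_norm_sq (dzbar f)"
    by (rule L2_norm_sq_cong_AE[OF *(1)], rule L2_norm_sq_cong_AE[OF *(2)])
qed

lemma
  assumes f: "C_k 2 f"
  shows Hs_le_H1: "Hs_circle_norm_sq (1/2) f \<le> H1_norm_sq f"
    and circle_L2_le_H1: "circle_L2_norm_sq f \<le> 3 * H1_norm_sq f"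
proof -
  have f1: "C_k 1 f" using f by (rule C_k_mono) simp
  have *: "L2_norm_sq f + L2_norm_sq (dz f) + L2_norm_sq (dzbar f) \<le> H1_norm_sq f"
    using H1_norm_sq_ge(4)[OF H1_space_C_k[OF f1]] by (simp add: weak_d_C_k[OF f1])
  show "Hs_circle_norm_sq (1/2) f \<le> H1_norm_sq f"
    using Hs_le[OF f] * by (rule order_trans)
  show "circle_L2_norm_sq f \<le> 3 * H1_norm_sq f"
    using circle_L2_le[OF f] mult_left_mono[OF *, of 3] by (meson order_trans zero_le)
qed

lemma L2_norm_sq_diff_le:
  assumes "f \<in> L2_space" "g \<in> L2_space" "AE z in lebesgue_on disc. u z = f z - g z"
  shows "L2_norm_sq u \<le> 2 * L2_norm_sq f + 2 * L2_norm_sq g"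
proof -
  have "L2_norm_sq u \<le> ennreal (1 + 1) * L2_norm_sq f + ennreal (1 + 1 / 1) * L2_norm_sq (\<lambda>z. (- 1) * g z)"
    using assms by (intro L2_norm_sq_add_le L2_space_cmult) auto
  then show ?thesis using L2_space_cmult(2)[OF assms(2), of "- 1"] by simp
qed

lemma H1_norm_sq_diff_le:
  assumes u: "u \<in> H1_space" and v: "v \<in> H1_space"
  shows "H1_norm_sq (\<lambda>z. u z - v z) \<le> 2 * H1_norm_sq u + 2 * H1_norm_sq v"
proof -
  have uv: "u \<in> L2_space" "v \<in> L2_space" using u v by (auto simp: H1_space_def)
  have d: "L2_norm_sq (weak_deriv e (\<lambda>z. u z - v z)) \<le> 2 * L2_norm_sq (weak_deriv e u) + 2 * L2_norm_sq (weak_deriv e v)"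
    if "e \<in> {1, \<i>}" for e
    using that by (intro L2_norm_sq_diff_le weak_deriv_diff weak_deriv_L2_space u v)
  have "H1_norm_sq (\<lambda>z. u z - v z) \<le> (2 * L2_norm_sq u + 2 * L2_norm_sq v)
     + (2 * L2_norm_sq (weak_deriv 1 u) + 2 * L2_norm_sq (weak_deriv 1 v))
     + (2 * L2_norm_sq (weak_deriv \<i> u) + 2 * L2_norm_sq (weak_deriv \<i> v))"
    unfolding H1_norm_sq_def by (intro add_mono L2_norm_sq_diff_le uv d) auto
  then show ?thesis by (simp add: H1_norm_sq_def algebra_simps)
qed

section \<open>Existence of boundary traces\<close>

lemma cis_continuous_measurable:
  fixes f :: "complex \<Rightarrow> complex"
  assumes "continuous_on UNIV f"
  shows "(\<lambda>t. f (cis t)) \<in> borel_measurable circle_measure"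
proof -
  have "continuous_on UNIV (\<lambda>t. f (cis t))"
    by (intro continuous_on_compose2[OF assms] continuous_intros) auto
  from borel_measurable_integrable[OF circle_integrable_continuous[OF this]] show ?thesis .
qed

lemma smooth_C_k: "smooth f \<Longrightarrow> C_k k f"
  by (simp add: smooth_def)

lemma H1_norm_sq_smooth_diff_le:
  assumes f: "smooth f" and g: "smooth g" and u: "u \<in> H1_space"
  shows "H1_norm_sq (\<lambda>z. f z - g z) \<le> 2 * H1_norm_sq (\<lambda>z. f z - u z) + 2 * H1_norm_sq (\<lambda>z. g z - u z)"
  using H1_norm_sq_diff_le[OF H1_space_diff[OF H1_space_C_k[OF smooth_C_k[OF f]] u] H1_space_diff[OF H1_space_C_k[OF smooth_C_k[OF g]] u]]
  by simp

text \<open>\<open>bdry_trace\<close> is a choice, and existence ties it to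
  \<open>has_bdry_trace\<close>. Smooth approximants in H^1 are Cauchy in L^2 of the circle by
  \<open>circle_L2_le_H1\<close>; the limit is constructed pointwise, as in the proof that L^2 is
  complete.\<close>

lemma ex_bdry_trace:
  assumes u: "u \<in> H1_space"
  shows "\<exists>g. has_bdry_trace u g"
proof -
  \<comment> \<open>Squared errors 4^(-k) mean errors 2^(-k), so the increments are summable and the
    sequence itself converges almost everywhere.\<close>
  have "\<exists>\<phi>. smooth \<phi> \<and> H1_norm_sq (\<lambda>z. \<phi> z - u z) \<le> ennreal ((1 / 4) ^ k)" for k :: nat
    using smooth_dense_H1[OF u, of "(1 / 4) ^ k"] by (metis zero_less_divide_1_iff zero_less_numeral zero_less_power)
  then obtain \<phi> where s: "\<And>k. smooth (\<phi> k)" and h: "\<And>k. H1_norm_sq (\<lambda>z. \<phi> k z - u z) \<le> ennreal ((1 / 4) ^ k)"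
    by metis
  have m [measurable]: "(\<lambda>t. \<phi> k (cis t)) \<in> borel_measurable circle_measure" for k
    by (rule cis_continuous_measurable[OF C_k_continuous[OF smooth_C_k[OF s]]])
  have circ: "circle_L2_norm_sq (\<lambda>z. \<phi> k z - \<phi> l z) \<le> ennreal (12 * (1 / 4) ^ k)" if "k \<le> l" for k l
  proof -
    have "circle_L2_norm_sq (\<lambda>z. \<phi> k z - \<phi> l z) \<le> 3 * H1_norm_sq (\<lambda>z. \<phi> k z - \<phi> l z)"
      by (intro circle_L2_le_H1 C_k_diff smooth_C_k s)
    also have "\<dots> \<le> 3 * (2 * H1_norm_sq (\<lambda>z. \<phi> k z - u z) + 2 * H1_norm_sq (\<lambda>z. \<phi> l z - u z))"
      by (intro mult_left_mono H1_norm_sq_smooth_diff_le s u) simp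
    also have "\<dots> \<le> 3 * (2 * ennreal ((1 / 4) ^ k) + 2 * ennreal ((1 / 4) ^ k))"
    proof (intro mult_left_mono add_mono h order_trans[OF h])
      show "ennreal ((1 / 4) ^ l) \<le> ennreal ((1 / 4) ^ k)"
        using that by (intro ennreal_leI power_decreasing) auto
    qed auto
    also have "\<dots> = ennreal (12 * (1 / 4) ^ k)"
      by (simp add: ennreal_mult distrib_right[symmetric] mult.assoc[symmetric])
    finally show ?thesis .
  qed
  define D where "D k t = cmod (\<phi> (Suc k) (cis t) - \<phi> k (cis t))" for k t
  have [measurable]: "D k \<in> borel_measurable circle_measure" for k unfolding D_def[abs_def] by measurable
  have D: "(\<integral>\<^sup>+t. ennreal (D k t) \<partial>circle_measure) \<le> ennreal ((2 * pi + 12) * (1 / 2) ^ k)" for k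
  proof -
    \<comment> \<open>With c = 2^(-k), the pointwise bound D <= c + D^2 / c turns squared increments
      of order 4^(-k) into an L^1 bound of order 2^(-k).\<close>
    define c where "c = (1 / 2 :: real) ^ k"
    have c: "0 < c" "c\<^sup>2 = (1 / 4) ^ k" by (auto simp: c_def power_mult_distrib[symmetric] power2_eq_square)
    have "(\<integral>\<^sup>+t. ennreal (D k t) \<partial>circle_measure) \<le> (\<integral>\<^sup>+t. ennreal c + ennreal (1 / c) * ennreal ((D k t)\<^sup>2) \<partial>circle_measure)"
    proof (rule nn_integral_mono)
      fix t
      have "D k t \<le> c + (D k t)\<^sup>2 / c"
      proof -
        have "0 \<le> (D k t - c / 2)\<^sup>2 / c" using c by simp
        also have "\<dots> = (D k t)\<^sup>2 / c - D k t + c / 4"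
          using c by (simp add: power2_eq_square field_simps)
        finally show ?thesis using c by simp
      qed
      then have "ennreal (D k t) \<le> ennreal (c + 1 / c * (D k t)\<^sup>2)" by (intro ennreal_leI) simp
      also have "\<dots> = ennreal c + ennreal (1 / c) * ennreal ((D k t)\<^sup>2)"
        using c by (subst ennreal_plus) (auto simp: ennreal_mult[symmetric])
      finally show "ennreal (D k t) \<le> ennreal c + ennreal (1 / c) * ennreal ((D k t)\<^sup>2)" .
    qed
    also have "\<dots> = ennreal c * emeasure circle_measure {0..2 * pi} + ennreal (1 / c) * (\<integral>\<^sup>+t. ennreal ((D k t)\<^sup>2) \<partial>circle_measure)"
      by (simp add: nn_integral_add nn_integral_cmult)
    also have "(\<integral>\<^sup>+t. ennreal ((D k t)\<^sup>2) \<partial>circle_measure) = circle_L2_norm_sq (\<lambda>z. \<phi> k z - \<phi> (Suc k) z)"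
      by (simp add: circle_L2_norm_sq_def D_def norm_minus_commute)
    also have "emeasure circle_measure {0..2 * pi} = ennreal (2 * pi)"
      by (simp add: emeasure_restrict_space)
    also have "ennreal c * ennreal (2 * pi) + ennreal (1 / c) * circle_L2_norm_sq (\<lambda>z. \<phi> k z - \<phi> (Suc k) z)
       \<le> ennreal c * ennreal (2 * pi) + ennreal (1 / c) * ennreal (12 * c\<^sup>2)"
      using circ[of k "Suc k"] c by (intro add_left_mono mult_left_mono) auto
    also have "\<dots> = ennreal (c * (2 * pi) + 1 / c * (12 * c\<^sup>2))"
      using c by (subst ennreal_plus) (auto simp: ennreal_mult[symmetric])
    also have "c * (2 * pi) + 1 / c * (12 * c\<^sup>2) = (2 * pi + 12) * c"
      using c by (simp add: power2_eq_square field_simps)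
    finally show ?thesis by (simp only: c_def)
  qed
  have "(\<integral>\<^sup>+t. (\<Sum>k. ennreal (D k t)) \<partial>circle_measure) = (\<Sum>k. \<integral>\<^sup>+t. ennreal (D k t) \<partial>circle_measure)"
    by (rule nn_integral_suminf) measurable
  also have "\<dots> \<le> (\<Sum>k. ennreal ((2 * pi + 12) * (1 / 2) ^ k))"
    by (intro suminf_le D) auto
  also have "\<dots> < \<infinity>"
  proof -
    have "(\<Sum>k. ennreal ((2 * pi + 12) * (1 / 2) ^ k)) = ennreal (\<Sum>k. (2 * pi + 12) * (1 / 2) ^ k)"
      by (intro suminf_ennreal2 summable_mult summable_geometric) (auto intro!: mult_nonneg_nonneg)
    then show ?thesis by simp
  qed
  finally have "AE t in circle_measure. (\<Sum>k. ennreal (D k t)) \<noteq> \<infinity>"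
    by (intro nn_integral_PInf_AE) auto
  \<comment> \<open>Absolute convergence of the telescoping series of increments at almost every
    angle. The function \<open>g\<close> below takes whatever value \<open>lim\<close> has at the
    remaining angles, which form a null set.\<close>
  then have conv: "AE t in circle_measure. convergent (\<lambda>k. \<phi> k (cis t))"
  proof eventually_elim
    case (elim t)
    have "summable (\<lambda>k. D k t)" using elim by (intro summable_suminf_not_top) (auto simp: D_def)
    then have "summable (\<lambda>k. \<phi> (Suc k) (cis t) - \<phi> k (cis t))"
      unfolding D_def by (rule summable_norm_cancel)
    then obtain s where "(\<lambda>n. \<Sum>k<n. \<phi> (Suc k) (cis t) - \<phi> k (cis t)) \<longlonglongrightarrow> s"
      unfolding summable_def sums_def by blast
    then have "(\<lambda>n. \<phi> n (cis t) - \<phi> 0 (cis t)) \<longlonglongrightarrow> s"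
      by (simp only: sum_lessThan_telescope[of "\<lambda>k. \<phi> k (cis t)"])
    then have "(\<lambda>n. (\<phi> n (cis t) - \<phi> 0 (cis t)) + \<phi> 0 (cis t)) \<longlonglongrightarrow> s + \<phi> 0 (cis t)"
      by (intro tendsto_intros)
    then show ?case by (auto simp: convergent_def)
  qed
  define g where "g z = lim (\<lambda>k. \<phi> k z)" for z
  have gm [measurable]: "(\<lambda>t. g (cis t)) \<in> borel_measurable circle_measure"
    unfolding g_def by (rule borel_measurable_lim_metric) (rule m)
  have lim: "AE t in circle_measure. (\<lambda>k. \<phi> k (cis t)) \<longlonglongrightarrow> g (cis t)"
    using conv by eventually_elim (simp add: g_def convergent_LIMSEQ_iff)
  \<comment> \<open>Fatou's lemma in l carries the Cauchy estimate between \<open>\<phi> k\<close>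
    and \<open>\<phi> l\<close> over to the limit \<open>g\<close>.\<close>
  have cg: "circle_L2_norm_sq (\<lambda>z. \<phi> k z - g z) \<le> ennreal (12 * (1 / 4) ^ k)" for k
  proof -
    have "circle_L2_norm_sq (\<lambda>z. \<phi> k z - g z) = (\<integral>\<^sup>+t. liminf (\<lambda>l. ennreal ((cmod (\<phi> k (cis t) - \<phi> l (cis t)))\<^sup>2)) \<partial>circle_measure)"
      unfolding circle_L2_norm_sq_def
    proof (rule nn_integral_cong_AE)
      show "AE t in circle_measure. ennreal ((cmod (\<phi> k (cis t) - g (cis t)))\<^sup>2) = liminf (\<lambda>l. ennreal ((cmod (\<phi> k (cis t) - \<phi> l (cis t)))\<^sup>2))"
        using lim
      proof eventually_elim
        case (elim t)
        then have "(\<lambda>l. ennreal ((cmod (\<phi> k (cis t) - \<phi> l (cis t)))\<^sup>2)) \<longlonglongrightarrow> ennreal ((cmod (\<phi> k (cis t) - g (cis t)))\<^sup>2)"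
          by (intro tendsto_intros)
        then show ?case by (intro lim_imp_Liminf[symmetric]) auto
      qed
    qed
    also have "\<dots> \<le> liminf (\<lambda>l. \<integral>\<^sup>+t. ennreal ((cmod (\<phi> k (cis t) - \<phi> l (cis t)))\<^sup>2) \<partial>circle_measure)"
      by (rule nn_integral_liminf) measurable
    also have "\<dots> \<le> ennreal (12 * (1 / 4) ^ k)"
    proof -
      have "eventually (\<lambda>l. (\<integral>\<^sup>+t. ennreal ((cmod (\<phi> k (cis t) - \<phi> l (cis t)))\<^sup>2) \<partial>circle_measure) \<le> ennreal (12 * (1 / 4) ^ k)) sequentially"
        using eventually_ge_at_top[of k]
        by eventually_elim (use circ in \<open>simp add: circle_L2_norm_sq_def\<close>)
      then have "liminf (\<lambda>l. \<integral>\<^sup>+t. ennreal ((cmod (\<phi> k (cis t) - \<phi> l (cis t)))\<^sup>2) \<partial>circle_measure) \<le> liminf (\<lambda>l. ennreal (12 * (1 / 4) ^ k))"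
        by (rule Liminf_mono)
      then show ?thesis by (simp add: Liminf_const)
    qed
    finally show ?thesis .
  qed
  have "circle_L2_norm_sq g \<le> ennreal (1 + 1) * circle_L2_norm_sq (\<phi> 0) + ennreal (1 + 1 / 1) * circle_L2_norm_sq (\<lambda>z. g z - \<phi> 0 z)"
    unfolding circle_L2_norm_sq_def by (rule nn_integral_cmod_add_sq_le) auto
  also have "circle_L2_norm_sq (\<lambda>z. g z - \<phi> 0 z) = circle_L2_norm_sq (\<lambda>z. \<phi> 0 z - g z)"
    by (simp add: circle_L2_norm_sq_def norm_minus_commute)
  also have "ennreal (1 + 1) * circle_L2_norm_sq (\<phi> 0) + ennreal (1 + 1 / 1) * circle_L2_norm_sq (\<lambda>z. \<phi> 0 z - g z) < \<infinity>"
    using cg[of 0] circle_L2_norm_sq_continuous[OF C_k_continuous[OF smooth_C_k[OF s[of 0]]]]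
    by (auto simp: ennreal_mult_less_top intro: le_less_trans)
  finally have "g \<in> circle_L2_space" by (simp add: circle_L2_space_def gm)
  moreover have "(\<lambda>k. H1_norm_sq (\<lambda>z. \<phi> k z - u z)) \<longlonglongrightarrow> 0"
  proof (rule tendsto_sandwich[OF _ _ tendsto_const])
    show "eventually (\<lambda>k. H1_norm_sq (\<lambda>z. \<phi> k z - u z) \<le> ennreal ((1 / 4) ^ k)) sequentially" using h by simp
    have "(\<lambda>k. ennreal ((1 / 4) ^ k)) \<longlonglongrightarrow> ennreal 0" by (intro tendsto_ennrealI LIMSEQ_power_zero) simp
    then show "(\<lambda>k. ennreal ((1 / 4) ^ k)) \<longlonglongrightarrow> 0" by simp
  qed simp
  moreover have "(\<lambda>k. circle_L2_norm_sq (\<lambda>z. \<phi> k z - g z)) \<longlonglongrightarrow> 0"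
  proof (rule tendsto_sandwich[OF _ _ tendsto_const])
    show "eventually (\<lambda>k. circle_L2_norm_sq (\<lambda>z. \<phi> k z - g z) \<le> ennreal (12 * (1 / 4) ^ k)) sequentially" using cg by simp
    have "(\<lambda>k. ennreal (12 * (1 / 4) ^ k)) \<longlonglongrightarrow> ennreal (12 * 0)" by (intro tendsto_ennrealI tendsto_mult tendsto_const LIMSEQ_power_zero) simp
    then show "(\<lambda>k. ennreal (12 * (1 / 4) ^ k)) \<longlonglongrightarrow> 0" by simp
  qed simp
  ultimately show ?thesis unfolding has_bdry_trace_def using u s by blast
qed

lemma has_bdry_trace_bdry_trace: "u \<in> H1_space \<Longrightarrow> has_bdry_trace u (bdry_trace u)"
  unfolding bdry_trace_def using ex_bdry_trace by (rule someI_ex)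

section \<open>Passing the smooth estimates to the trace\<close>

lemma fourier_coeff_add:
  assumes "integrable circle_measure (\<lambda>t. f (cis t))" "integrable circle_measure (\<lambda>t. g (cis t))"
  shows "fourier_coeff (\<lambda>z. f z + g z) n = fourier_coeff f n + fourier_coeff g n"
proof -
  have i: "integrable circle_measure (\<lambda>t. h (cis t) * circle_char (- n) t)" if "integrable circle_measure (\<lambda>t. h (cis t))" for h
  proof (rule Bochner_Integration.integrable_bound[OF that])
    have "circle_char (- n) \<in> borel_measurable circle_measure"
      by (intro borel_measurable_integrable circle_integrable_continuous continuous_intros)
    then show "(\<lambda>t. h (cis t) * circle_char (- n) t) \<in> borel_measurable circle_measure"
      using that by (intro borel_measurable_times) auto
  qed (simp add: norm_mult)
  show ?thesis
    using i[OF assms(1)] i[OF assms(2)] by (simp add: fourier_coeff_eq fcoeff_def distrib_right distrib_left)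
qed

text \<open>Cauchy-Schwarz on a set of finite measure puts L^2 inside L^1, so Fourier coefficients
  of L^2 functions are genuine integrals. The second bound makes each single coefficient continuous
  in L^2.\<close>

lemma circle_L2_integrable:
  assumes "f \<in> circle_L2_space"
  shows "integrable circle_measure (\<lambda>t. f (cis t))"
    and "ennreal ((cmod (fourier_coeff f n))\<^sup>2) \<le> circle_L2_norm_sq f"
proof -
  have [measurable]: "(\<lambda>t. f (cis t)) \<in> borel_measurable circle_measure" and fin: "circle_L2_norm_sq f < \<infinity>"
    using assms by (auto simp: circle_L2_space_def)
  have m: "emeasure circle_measure {0..2 * pi} = ennreal (2 * pi)"
    by (simp add: emeasure_restrict_space)
  let ?I = "\<integral>\<^sup>+t. ennreal (cmod (f (cis t))) \<partial>circle_measure"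
  have "?I\<^sup>2 = (\<integral>\<^sup>+t. ennreal (cmod (f (cis t))) * 1 \<partial>circle_measure)\<^sup>2" by simp
  also have "\<dots> \<le> (\<integral>\<^sup>+t. (ennreal (cmod (f (cis t))))\<^sup>2 \<partial>circle_measure) * (\<integral>\<^sup>+t. 1\<^sup>2 \<partial>circle_measure)"
    by (rule Cauchy_Schwarz_nn_integral) auto
  also have "\<dots> = circle_L2_norm_sq f * ennreal (2 * pi)"
    by (simp add: circle_L2_norm_sq_def ennreal_power m)
  finally have I2: "?I\<^sup>2 \<le> circle_L2_norm_sq f * ennreal (2 * pi)" .
  also have "\<dots> < \<infinity>" using fin by (simp add: ennreal_mult_less_top)
  finally have "?I < \<infinity>" by (auto simp: power2_eq_square ennreal_mult_less_top)
  then show i: "integrable circle_measure (\<lambda>t. f (cis t))"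
    by (intro integrableI_bounded) auto
  have ch: "circle_char (- n) \<in> borel_measurable circle_measure"
    by (intro borel_measurable_integrable circle_integrable_continuous continuous_intros)
  have "integrable circle_measure (\<lambda>t. f (cis t) * circle_char (- n) t)"
    using i by (rule Bochner_Integration.integrable_bound) (auto simp: norm_mult intro!: borel_measurable_times ch)
  then have "ennreal (cmod (LINT t|circle_measure. f (cis t) * circle_char (- n) t)) \<le> (\<integral>\<^sup>+t. ennreal (cmod (f (cis t) * circle_char (- n) t)) \<partial>circle_measure)"
    by (rule integral_norm_bound_ennreal)
  then have le: "ennreal (cmod (LINT t|circle_measure. f (cis t) * circle_char (- n) t)) \<le> ?I"
    by (simp add: norm_mult)
  let ?L = "LINT t|circle_measure. f (cis t) * circle_char (- n) t"
  have "ennreal ((cmod ?L)\<^sup>2) = (ennreal (cmod ?L))\<^sup>2" by (simp add: ennreal_power)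
  also have "\<dots> \<le> ?I\<^sup>2" by (intro power_mono le) simp
  also note I2
  finally have L: "ennreal ((cmod ?L)\<^sup>2) \<le> circle_L2_norm_sq f * ennreal (2 * pi)" .
  have "cmod (fourier_coeff f n) = cmod ?L / (2 * pi)"
    by (simp add: fourier_coeff_eq fcoeff_def norm_mult norm_divide)
  then have "(cmod (fourier_coeff f n))\<^sup>2 = 1 / (2 * pi)\<^sup>2 * (cmod ?L)\<^sup>2" by (simp add: power_divide)
  then have "ennreal ((cmod (fourier_coeff f n))\<^sup>2) = ennreal (1 / (2 * pi)\<^sup>2) * ennreal ((cmod ?L)\<^sup>2)"
    by (simp only: ennreal_mult zero_le_power2 zero_le_divide_1_iff)
  also have "\<dots> \<le> ennreal (1 / (2 * pi)\<^sup>2) * (circle_L2_norm_sq f * ennreal (2 * pi))"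
    by (intro mult_left_mono L) simp
  also have "\<dots> = ennreal (1 / (2 * pi)\<^sup>2 * (2 * pi)) * circle_L2_norm_sq f"
    by (subst ennreal_mult) (simp_all add: mult_ac)
  also have "\<dots> \<le> 1 * circle_L2_norm_sq f"
  proof (rule mult_right_mono)
    have "1 / (2 * pi)\<^sup>2 * (2 * pi) \<le> 1" using pi_ge_two by (simp add: power2_eq_square divide_le_eq)
    then show "ennreal (1 / (2 * pi)\<^sup>2 * (2 * pi)) \<le> 1" using ennreal_leI by fastforce
  qed simp
  finally show "ennreal ((cmod (fourier_coeff f n))\<^sup>2) \<le> circle_L2_norm_sq f" by simp
qed

lemma weighted_sum_add_le:
  assumes "integrable circle_measure (\<lambda>t. f (cis t))" "integrable circle_measure (\<lambda>t. g (cis t))" and t: "0 < t"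
  shows "ennreal (weighted_sum A (\<lambda>z. f z + g z)) \<le> ennreal (1 + t) * ennreal (weighted_sum A f) + ennreal (1 + 1 / t) * ennreal (weighted_sum A g)"
proof -
  have "weighted_sum A (\<lambda>z. f z + g z) \<le> (\<Sum>n\<in>A. (1 + \<bar>of_int n\<bar>) * ((1 + t) * (cmod (fourier_coeff f n))\<^sup>2 + (1 + 1 / t) * (cmod (fourier_coeff g n))\<^sup>2))"
    unfolding weighted_sum_def fourier_coeff_add[OF assms(1,2)]
    by (intro sum_mono mult_left_mono cmod_add_sq_le t) simp
  also have "\<dots> = (1 + t) * weighted_sum A f + (1 + 1 / t) * weighted_sum A g"
    unfolding weighted_sum_def sum_distrib_left sum.distrib[symmetric]
    by (intro sum.cong refl) (simp add: distrib_left mult.left_commute)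
  finally have "ennreal (weighted_sum A (\<lambda>z. f z + g z)) \<le> ennreal ((1 + t) * weighted_sum A f + (1 + 1 / t) * weighted_sum A g)"
    by (rule ennreal_leI)
  also have "\<dots> = ennreal (1 + t) * ennreal (weighted_sum A f) + ennreal (1 + 1 / t) * ennreal (weighted_sum A g)"
    using t weighted_sum_nonneg[of A f] weighted_sum_nonneg[of A g]
    by (subst ennreal_plus) (auto simp: ennreal_mult simp del: ennreal_plus)
  finally show ?thesis .
qed

lemma continuous_circle_L2_space:
  assumes "continuous_on UNIV f" shows "f \<in> circle_L2_space"
  using cis_continuous_measurable[OF assms] circle_L2_norm_sq_continuous[OF assms]
  by (simp add: circle_L2_space_def)

text \<open>L^2 convergence on the circle does not control the H^(1/2) norm, so an intermediate
  \<open>\<phi> l\<close> is inserted. On a finite set \<open>A\<close>, the difference of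
  \<open>\<phi> k\<close> and \<open>\<phi> l\<close> is bounded by H^1 distances independently of
  \<open>A\<close>, and that of \<open>\<phi> l\<close> and \<open>g\<close> by L^2 with a constant
  depending on \<open>A\<close>. Letting l grow with \<open>A\<close> fixed removes the latter, and
  only then is the supremum over \<open>A\<close> taken.\<close>

lemma Hs_trace_approx:
  assumes \<phi>: "\<And>k. smooth (\<phi> k)" and u: "u \<in> H1_space" and g: "g \<in> circle_L2_space"
    and lim: "(\<lambda>k. H1_norm_sq (\<lambda>z. \<phi> k z - u z)) \<longlonglongrightarrow> 0" "(\<lambda>k. circle_L2_norm_sq (\<lambda>z. \<phi> k z - g z)) \<longlonglongrightarrow> 0"
    and t: "0 < t"
  shows "Hs_circle_norm_sq (1/2) (\<phi> k) \<le> ennreal (1 + t) * Hs_circle_norm_sq (1/2) g + ennreal (1 + 1 / t) * (4 * H1_norm_sq (\<lambda>z. \<phi> k z - u z))"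
proof (rule Hs_half_leI)
  fix A :: "int set" assume A: "finite A"
  let ?\<eta> = "\<lambda>k. H1_norm_sq (\<lambda>z. \<phi> k z - u z)" and ?c = "\<lambda>k. circle_L2_norm_sq (\<lambda>z. \<phi> k z - g z)"
  have \<phi>L: "\<phi> k \<in> circle_L2_space" for k
    by (rule continuous_circle_L2_space[OF C_k_continuous[OF smooth_C_k[OF \<phi>]]])
  have i\<phi>: "integrable circle_measure (\<lambda>t. \<phi> k (cis t))" for k by (rule circle_L2_integrable(1)[OF \<phi>L])
  have ig: "integrable circle_measure (\<lambda>t. g (cis t))" by (rule circle_L2_integrable(1)[OF g])
  have dL: "(\<lambda>z. \<phi> k z - g z) \<in> circle_L2_space" for k
  proof -
    have [measurable]: "(\<lambda>t. \<phi> k (cis t)) \<in> borel_measurable circle_measure" "(\<lambda>t. g (cis t)) \<in> borel_measurable circle_measure"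
      using \<phi>L g by (auto simp: circle_L2_space_def)
    have "circle_L2_norm_sq (\<lambda>z. \<phi> k z - g z) \<le> ennreal (1 + 1) * circle_L2_norm_sq (\<phi> k) + ennreal (1 + 1 / 1) * circle_L2_norm_sq (\<lambda>z. - g z)"
      unfolding circle_L2_norm_sq_def by (rule nn_integral_cmod_add_sq_le) auto
    also have "circle_L2_norm_sq (\<lambda>z. - g z) = circle_L2_norm_sq g" by (simp add: circle_L2_norm_sq_def)
    also have "ennreal (1 + 1) * circle_L2_norm_sq (\<phi> k) + ennreal (1 + 1 / 1) * circle_L2_norm_sq g < \<infinity>"
      using \<phi>L[of k] g by (simp add: circle_L2_space_def ennreal_mult_less_top)
    finally show ?thesis by (simp add: circle_L2_space_def)
  qed
  have id: "integrable circle_measure (\<lambda>t. \<phi> k (cis t) - g (cis t))" for k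
    using i\<phi> ig by (rule Bochner_Integration.integrable_diff)
  \<comment> \<open>The total weight on \<open>A\<close> grows without bound with \<open>A\<close>,
    but it multiplies only a quantity that tends to 0 in l.\<close>
  define M where "M = (\<Sum>n\<in>A. 1 + \<bar>real_of_int n\<bar>)"
  have wsum: "ennreal (weighted_sum A h) \<le> ennreal M * circle_L2_norm_sq h" if "h \<in> circle_L2_space" for h
  proof -
    have "ennreal (weighted_sum A h) = (\<Sum>n\<in>A. ennreal (1 + \<bar>real_of_int n\<bar>) * ennreal ((cmod (fourier_coeff h n))\<^sup>2))"
      unfolding weighted_sum_def by (subst sum_ennreal[symmetric]) (auto simp: ennreal_mult simp del: ennreal_plus)
    also have "\<dots> \<le> (\<Sum>n\<in>A. ennreal (1 + \<bar>real_of_int n\<bar>) * circle_L2_norm_sq h)"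
      by (intro sum_mono mult_left_mono circle_L2_integrable(2) that) simp
    also have "\<dots> = (\<Sum>n\<in>A. ennreal (1 + \<bar>real_of_int n\<bar>)) * circle_L2_norm_sq h"
      by (rule sum_distrib_right[symmetric])
    also have "(\<Sum>n\<in>A. ennreal (1 + \<bar>real_of_int n\<bar>)) = ennreal M"
      unfolding M_def by (rule sum_ennreal) simp
    finally show ?thesis .
  qed
  have step: "ennreal (weighted_sum A (\<lambda>z. \<phi> k z - g z)) \<le> 2 * (2 * ?\<eta> k + 2 * ?\<eta> l) + 2 * (ennreal M * ?c l)" for l
  proof -
    have "ennreal (weighted_sum A (\<lambda>z. (\<phi> k z - \<phi> l z) + (\<phi> l z - g z))) \<le>
      ennreal (1 + 1) * ennreal (weighted_sum A (\<lambda>z. \<phi> k z - \<phi> l z)) + ennreal (1 + 1 / 1) * ennreal (weighted_sum A (\<lambda>z. \<phi> l z - g z))"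
      by (rule weighted_sum_add_le) (use i\<phi> id in auto)
    also have "\<dots> \<le> ennreal (1 + 1) * (2 * ?\<eta> k + 2 * ?\<eta> l) + ennreal (1 + 1 / 1) * (ennreal M * ?c l)"
    proof (intro add_mono mult_left_mono wsum dL)
      have "ennreal (weighted_sum A (\<lambda>z. \<phi> k z - \<phi> l z)) \<le> Hs_circle_norm_sq (1/2) (\<lambda>z. \<phi> k z - \<phi> l z)"
        by (rule weighted_sum_le_Hs[OF A])
      also have "\<dots> \<le> H1_norm_sq (\<lambda>z. \<phi> k z - \<phi> l z)"
        by (intro Hs_le_H1 C_k_diff smooth_C_k \<phi>)
      also have "\<dots> \<le> 2 * ?\<eta> k + 2 * ?\<eta> l" by (intro H1_norm_sq_smooth_diff_le \<phi> u)
      finally show "ennreal (weighted_sum A (\<lambda>z. \<phi> k z - \<phi> l z)) \<le> 2 * ?\<eta> k + 2 * ?\<eta> l" .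
    qed auto
    finally show ?thesis by simp
  qed
  \<comment> \<open>As l grows, both the H^1 error of \<open>\<phi> l\<close> and its L^2 error on
    the circle vanish, which leaves a bound free of \<open>M\<close>.\<close>
  have "(\<lambda>l. 2 * (2 * ?\<eta> k + 2 * ?\<eta> l) + 2 * (ennreal M * ?c l)) \<longlonglongrightarrow> 2 * (2 * ?\<eta> k + 2 * 0) + 2 * (ennreal M * 0)"
    by (intro tendsto_add ennreal_tendsto_cmult tendsto_const lim) auto
  then have "ennreal (weighted_sum A (\<lambda>z. \<phi> k z - g z)) \<le> 2 * (2 * ?\<eta> k + 2 * 0) + 2 * (ennreal M * 0)"
    by (rule LIMSEQ_le_const) (use step in auto)
  then have d: "ennreal (weighted_sum A (\<lambda>z. \<phi> k z - g z)) \<le> 4 * ?\<eta> k"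
    by (simp add: mult.assoc[symmetric])
  have "ennreal (weighted_sum A (\<lambda>z. g z + (\<phi> k z - g z))) \<le> ennreal (1 + t) * ennreal (weighted_sum A g) + ennreal (1 + 1 / t) * ennreal (weighted_sum A (\<lambda>z. \<phi> k z - g z))"
    by (rule weighted_sum_add_le[OF ig id t])
  also have "\<dots> \<le> ennreal (1 + t) * Hs_circle_norm_sq (1/2) g + ennreal (1 + 1 / t) * (4 * ?\<eta> k)"
    by (intro add_mono mult_left_mono weighted_sum_le_Hs A d) auto
  finally show "ennreal (weighted_sum A (\<phi> k)) \<le> ennreal (1 + t) * Hs_circle_norm_sq (1/2) g + ennreal (1 + 1 / t) * (4 * ?\<eta> k)"
    by simp
qed

text \<open>A limit argument without subtraction: at fixed t the errors vanish as k grows, although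
  their factors contain 1/t; what remains is X <= (1+t)^2 Y, and then t tends to 0.\<close>

lemma ennreal_le_of_approx:
  fixes X Y :: ennreal
  assumes \<eta>: "\<eta> \<longlonglongrightarrow> 0"
    and x: "\<And>t k. 0 < t \<Longrightarrow> X \<le> ennreal (1 + t) * x k + ennreal (1 + 1 / t) * \<eta> k"
    and y: "\<And>t k. 0 < t \<Longrightarrow> x k \<le> ennreal (1 + t) * Y + ennreal (1 + 1 / t) * (ennreal C * \<eta> k)"
  shows "X \<le> Y"
proof (cases Y)
  case (real r)
  show ?thesis
  proof (rule ennreal_le_epsilon)
    fix e :: real assume e: "0 < e"
    \<comment> \<open>For t <= 1, (1+t)^2 r <= r + 3 t r, and the second bound on t makes the excess
      at most e. The case of infinite Y is trivial.\<close>
    define t where "t = min 1 (e / (3 * r + 1))"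
    have t: "0 < t" "t \<le> 1" using e real by (auto simp: t_def)
    have "X \<le> ennreal (1 + t) * (ennreal (1 + t) * Y + ennreal (1 + 1 / t) * (ennreal C * \<eta> k)) + ennreal (1 + 1 / t) * \<eta> k" for k
      by (rule order_trans[OF x[OF t(1)]]) (rule add_right_mono[OF mult_left_mono[OF y[OF t(1)]]], simp)
    moreover have "(\<lambda>k. ennreal (1 + t) * (ennreal (1 + t) * Y + ennreal (1 + 1 / t) * (ennreal C * \<eta> k)) + ennreal (1 + 1 / t) * \<eta> k)
      \<longlonglongrightarrow> ennreal (1 + t) * (ennreal (1 + t) * Y + ennreal (1 + 1 / t) * (ennreal C * 0)) + ennreal (1 + 1 / t) * 0"
      by (intro tendsto_add ennreal_tendsto_cmult tendsto_const \<eta>) auto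
    ultimately have "X \<le> ennreal (1 + t) * (ennreal (1 + t) * Y + ennreal (1 + 1 / t) * (ennreal C * 0)) + ennreal (1 + 1 / t) * 0"
      by (intro LIMSEQ_le_const) auto
    then have "X \<le> ennreal (1 + t) * (ennreal (1 + t) * ennreal r)" by (simp add: real)
    also have "\<dots> = ennreal ((1 + t) * ((1 + t) * r))"
      using t real by (simp add: ennreal_mult del: ennreal_plus)
    also have "\<dots> \<le> ennreal (r + e)"
    proof (rule ennreal_leI)
      have "t * t \<le> t" using t by (simp add: mult_left_le)
      then have "t * t * r \<le> t * r" using real by (intro mult_right_mono) auto
      then have "(1 + t) * ((1 + t) * r) \<le> r + t * (3 * r)" by (simp add: algebra_simps)
      also have "t * (3 * r) \<le> t * (3 * r + 1)" using t by (intro mult_left_mono) auto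
      also have "\<dots> \<le> (e / (3 * r + 1)) * (3 * r + 1)" using real by (intro mult_right_mono) (auto simp: t_def)
      also have "\<dots> = e" using real nonzero_eq_divide_eq[of "3 * r + 1" "e / (3 * r + 1)" e] by simp
      finally show "(1 + t) * ((1 + t) * r) \<le> r + e" by simp
    qed
    also have "\<dots> = Y + ennreal e" using real e by (simp add: ennreal_plus)
    finally show "X \<le> Y + ennreal e" .
  qed
qed simp

text \<open>Each term of the smooth inequalities is compared with its limit at the price of a factor
  1 + t and a multiple of the H^1 error. The constant \<open>C\<close> of
  \<open>ennreal_le_of_approx\<close> merely collects these multiples, 1 + 4 pi and 8 pi +
  4.\<close>

lemma
  assumes tr: "has_bdry_trace u g"
  shows L2_weak_d_le: "L2_norm_sq (weak_d u) \<le> L2_norm_sq (weak_dbar u) + ennreal pi * Hs_circle_norm_sq (1/2) g"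
    and L2_le_trace: "L2_norm_sq u \<le> ennreal (2 * pi) * Hs_circle_norm_sq (1/2) g + 2 * (L2_norm_sq (weak_d u) + L2_norm_sq (weak_dbar u))"
proof -
  from tr obtain \<phi> where u: "u \<in> H1_space" and g: "g \<in> circle_L2_space" and \<phi>: "\<And>k. smooth (\<phi> k)"
    and lim: "(\<lambda>k. H1_norm_sq (\<lambda>z. \<phi> k z - u z)) \<longlonglongrightarrow> 0" "(\<lambda>k. circle_L2_norm_sq (\<lambda>z. \<phi> k z - g z)) \<longlonglongrightarrow> 0"
    unfolding has_bdry_trace_def by blast
  let ?\<eta> = "\<lambda>k. H1_norm_sq (\<lambda>z. \<phi> k z - u z)"
  let ?N = "Hs_circle_norm_sq (1/2)"
  note C = smooth_C_k[OF \<phi>]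
  have uL: "u \<in> L2_space" using u by (simp add: H1_space_def)
  note wL = weak_d_L2_space[OF u]
  have \<phi>L: "\<phi> k \<in> L2_space" "dz (\<phi> k) \<in> L2_space" "dzbar (\<phi> k) \<in> L2_space" for k
    by (intro continuous_L2_space C_k_continuous[OF C] continuous_on_dz C)+
  have dH: "(\<lambda>z. \<phi> k z - u z) \<in> H1_space" for k by (intro H1_space_diff H1_space_C_k C u)
  have e1: "L2_norm_sq (\<lambda>z. \<phi> k z - u z) \<le> ?\<eta> k" for k by (rule H1_norm_sq_ge(1)[OF dH])
  have e2: "L2_norm_sq (\<lambda>z. dz (\<phi> k) z - weak_d u z) \<le> ?\<eta> k" for k
    using H1_norm_sq_ge(2)[OF dH] L2_norm_sq_cong_AE[OF weak_d_diff(1)[OF C u]] by simp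
  have e3: "L2_norm_sq (\<lambda>z. dzbar (\<phi> k) z - weak_dbar u z) \<le> ?\<eta> k" for k
    using H1_norm_sq_ge(3)[OF dH] L2_norm_sq_cong_AE[OF weak_d_diff(2)[OF C u]] by simp
  have app: "L2_norm_sq a \<le> ennreal (1 + t) * L2_norm_sq b + ennreal (1 + 1 / t) * E"
    if "a \<in> L2_space" "b \<in> L2_space" "L2_norm_sq (\<lambda>z. a z - b z) \<le> E" "0 < t" for a b E t
  proof -
    have "L2_norm_sq a \<le> ennreal (1 + t) * L2_norm_sq b + ennreal (1 + 1 / t) * L2_norm_sq (\<lambda>z. a z - b z)"
      by (rule L2_norm_sq_add_le) (use that in \<open>auto intro: L2_space_diff\<close>)
    also have "\<dots> \<le> ennreal (1 + t) * L2_norm_sq b + ennreal (1 + 1 / t) * E"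
      by (intro add_left_mono mult_left_mono that) auto
    finally show ?thesis .
  qed
  have hs: "?N (\<phi> k) \<le> ennreal (1 + t) * ?N g + ennreal (1 + 1 / t) * (4 * ?\<eta> k)" if "0 < t" for t k
    by (rule Hs_trace_approx[OF \<phi> u g lim that])
  show "L2_norm_sq (weak_d u) \<le> L2_norm_sq (weak_dbar u) + ennreal pi * ?N g"
  proof (rule ennreal_le_of_approx[OF lim(1)])
    fix t :: real and k assume t: "0 < t"
    show "L2_norm_sq (weak_d u) \<le> ennreal (1 + t) * L2_norm_sq (dz (\<phi> k)) + ennreal (1 + 1 / t) * ?\<eta> k"
      using e2[of k] by (intro app wL \<phi>L t) (simp add: L2_norm_sq_diff_commute)
    have "L2_norm_sq (dz (\<phi> k)) \<le> L2_norm_sq (dzbar (\<phi> k)) + ennreal pi * ?N (\<phi> k)"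
      by (rule L2_dz_le[OF C])
    also have "\<dots> \<le> (ennreal (1 + t) * L2_norm_sq (weak_dbar u) + ennreal (1 + 1 / t) * ?\<eta> k)
        + ennreal pi * (ennreal (1 + t) * ?N g + ennreal (1 + 1 / t) * (4 * ?\<eta> k))"
      by (intro add_mono mult_left_mono hs t app wL \<phi>L e3) auto
    also have "\<dots> = ennreal (1 + t) * (L2_norm_sq (weak_dbar u) + ennreal pi * ?N g) + ennreal (1 + 1 / t) * (ennreal (1 + 4 * pi) * ?\<eta> k)"
      by (simp add: ennreal_plus ennreal_mult distrib_left distrib_right mult_ac add_ac)
    finally show "L2_norm_sq (dz (\<phi> k)) \<le> ennreal (1 + t) * (L2_norm_sq (weak_dbar u) + ennreal pi * ?N g) + ennreal (1 + 1 / t) * (ennreal (1 + 4 * pi) * ?\<eta> k)" .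
  qed
  show "L2_norm_sq u \<le> ennreal (2 * pi) * ?N g + 2 * (L2_norm_sq (weak_d u) + L2_norm_sq (weak_dbar u))"
  proof (rule ennreal_le_of_approx[OF lim(1)])
    fix t :: real and k assume t: "0 < t"
    show "L2_norm_sq u \<le> ennreal (1 + t) * L2_norm_sq (\<phi> k) + ennreal (1 + 1 / t) * ?\<eta> k"
      using e1[of k] by (intro app uL \<phi>L t) (simp add: L2_norm_sq_diff_commute)
    have "L2_norm_sq (\<phi> k) \<le> ennreal (2 * pi) * ?N (\<phi> k) + 2 * (L2_norm_sq (dz (\<phi> k)) + L2_norm_sq (dzbar (\<phi> k)))"
      by (rule L2_le[OF C])
    also have "\<dots> \<le> ennreal (2 * pi) * (ennreal (1 + t) * ?N g + ennreal (1 + 1 / t) * (4 * ?\<eta> k))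
       + 2 * ((ennreal (1 + t) * L2_norm_sq (weak_d u) + ennreal (1 + 1 / t) * ?\<eta> k) + (ennreal (1 + t) * L2_norm_sq (weak_dbar u) + ennreal (1 + 1 / t) * ?\<eta> k))"
      by (intro add_mono mult_left_mono hs t app wL \<phi>L e2 e3) auto
    also have "\<dots> = ennreal (1 + t) * (ennreal (2 * pi) * ?N g + 2 * (L2_norm_sq (weak_d u) + L2_norm_sq (weak_dbar u)))
       + ennreal (1 + 1 / t) * (ennreal (2 * pi * 4 + 4) * ?\<eta> k)"
    proof -
      have c: "ennreal (2 * pi * 4 + 4) = ennreal (2 * pi) * 4 + 4"
        by (subst ennreal_plus) (simp_all add: ennreal_mult mult.commute[of _ 4] mult.assoc[symmetric])
      have four: "(4 :: ennreal) = 2 + 2" by simp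
      show ?thesis unfolding c four by (simp only: distrib_left distrib_right mult_ac add_ac)
    qed
    finally show "L2_norm_sq (\<phi> k) \<le> ennreal (1 + t) * (ennreal (2 * pi) * ?N g + 2 * (L2_norm_sq (weak_d u) + L2_norm_sq (weak_dbar u)))
       + ennreal (1 + 1 / t) * (ennreal (2 * pi * 4 + 4) * ?\<eta> k)" .
  qed
qed

section \<open>The estimate for sequences\<close>

lemma suminf_cmult_ennreal: "(\<Sum>j. c * f j) = c * (\<Sum>j. f j :: ennreal)"
  by simp

lemma suminf_add_ennreal: "(\<Sum>j. f j + g j) = (\<Sum>j. f j) + (\<Sum>j. g j :: ennreal)"
  by (rule suminf_add[symmetric]) auto

lemma suminf_split_two_ennreal: "(\<Sum>j. f j) = f 0 + f 1 + (\<Sum>j. f (j + 2) :: ennreal)"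
  using suminf_offset[of f 2] by (simp add: numeral_2_eq_2 add.commute)

text \<open>The weight \<open>(1 + j)\<^sup>p\<^sup>+\<^sup>1\<close> grows fast enough between \<open>j\<close> and \<open>j + 2\<close> to absorb the factor
  \<open>1 + 1/(1 + j)\<close> lost in Young's inequality, with \<open>(3 + j)\<^sup>p\<close> to spare.\<close>

lemma weight_step:
  "(1 + real j) ^ (p + 1) * (1 + 1 / (1 + real j)) + (1 + real (j + 2)) ^ p \<le> (1 + real (j + 2)) ^ (p + 1)"
proof -
  have "(1 + real j) ^ (p + 1) * (1 + 1 / (1 + real j)) = (1 + real j) ^ p * (2 + real j)"
    by (simp add: field_simps)
  also have "\<dots> \<le> (1 + real (j + 2)) ^ p * (2 + real j)"
    by (intro mult_right_mono power_mono) auto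
  also have "\<dots> + (1 + real (j + 2)) ^ p = (1 + real (j + 2)) ^ (p + 1)"
    by (simp add: algebra_simps)
  finally show ?thesis by simp
qed

text \<open>After summation both sides contain the tail of the weighted sum from index 2 on.
  Cancelling it leaves the spare weights of exponent p and the two initial terms, which together
  dominate the sum on the left.\<close>

lemma telescoping_estimate:
  fixes a \<omega> \<gamma> :: "nat \<Rightarrow> ennreal"
  assumes fin: "(\<Sum>j. ennreal ((1 + real j) ^ (p + 1)) * a j) < \<infinity>"
    and step: "\<And>j t. 0 < t \<Longrightarrow> a j \<le> ennreal (1 + t) * a (j + 2) + ennreal (1 + 1 / t) * \<omega> j + \<gamma> j"
  shows "(\<Sum>j. ennreal ((1 + real j) ^ p) * a j) \<le>
    2 * (\<Sum>j. ennreal ((1 + real j) ^ (p + 2)) * \<omega> j) + (\<Sum>j. ennreal ((1 + real j) ^ (p + 1)) * \<gamma> j)"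
proof -
  define m where "m j = ennreal ((1 + real j) ^ (p + 1))" for j
  define m' where "m' j = ennreal ((1 + real j) ^ p)" for j
  define R where "R = 2 * (\<Sum>j. ennreal ((1 + real j) ^ (p + 2)) * \<omega> j) + (\<Sum>j. m j * \<gamma> j)"
  define T where "T = (\<Sum>j. m (j + 2) * a (j + 2))"
  define P where "P = (\<Sum>j. m' (j + 2) * a (j + 2))"
  have pt: "m j * a j + m' (j + 2) * a (j + 2) \<le> m (j + 2) * a (j + 2) + (2 * (ennreal ((1 + real j) ^ (p + 2)) * \<omega> j) + m j * \<gamma> j)" for j
  proof -
    \<comment> \<open>Then 1 + 1/t = 2 + j <= 2 (1 + j): the forcing term pays one power of the
      weight and a factor 2.\<close>
    let ?t = "1 / (1 + real j)"
    have c: "m j * ennreal (1 + 1 / ?t) \<le> 2 * ennreal ((1 + real j) ^ (p + 2))"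
    proof -
      have "m j * ennreal (1 + 1 / ?t) = ennreal ((1 + real j) ^ (p + 1) * (1 + 1 / ?t))"
        unfolding m_def by (rule ennreal_mult[symmetric]) auto
      also have "\<dots> \<le> ennreal ((1 + real j) ^ (p + 1) * (2 * (1 + real j)))"
        by (intro ennreal_leI mult_left_mono) auto
      also have "(1 + real j) ^ (p + 1) * (2 * (1 + real j)) = 2 * (1 + real j) ^ (p + 2)"
        by (simp add: mult_ac)
      also have "ennreal (2 * (1 + real j) ^ (p + 2)) = 2 * ennreal ((1 + real j) ^ (p + 2))"
        by (subst ennreal_mult) auto
      finally show ?thesis .
    qed
    have "m j * a j \<le> m j * (ennreal (1 + ?t) * a (j + 2) + ennreal (1 + 1 / ?t) * \<omega> j + \<gamma> j)"
      by (intro mult_left_mono step) auto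
    also have "\<dots> = (m j * ennreal (1 + ?t)) * a (j + 2) + (m j * ennreal (1 + 1 / ?t)) * \<omega> j + m j * \<gamma> j"
      by (simp only: distrib_left mult.assoc)
    also have "\<dots> \<le> (m j * ennreal (1 + ?t)) * a (j + 2) + (2 * ennreal ((1 + real j) ^ (p + 2))) * \<omega> j + m j * \<gamma> j"
      by (intro add_mono order_refl mult_right_mono[OF c]) simp
    finally have "m j * a j + m' (j + 2) * a (j + 2) \<le>
        (m j * ennreal (1 + ?t)) * a (j + 2) + (2 * ennreal ((1 + real j) ^ (p + 2))) * \<omega> j + m j * \<gamma> j + m' (j + 2) * a (j + 2)"
      by (rule add_right_mono)
    also have "\<dots> = (m j * ennreal (1 + ?t) + m' (j + 2)) * a (j + 2) + (2 * (ennreal ((1 + real j) ^ (p + 2)) * \<omega> j) + m j * \<gamma> j)"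
      by (simp only: distrib_right mult.assoc add_ac)
    also have "\<dots> \<le> m (j + 2) * a (j + 2) + (2 * (ennreal ((1 + real j) ^ (p + 2)) * \<omega> j) + m j * \<gamma> j)"
    proof (intro add_right_mono mult_right_mono)
      have "m j * ennreal (1 + ?t) + m' (j + 2) = ennreal ((1 + real j) ^ (p + 1) * (1 + ?t) + (1 + real (j + 2)) ^ p)"
        unfolding m_def m'_def by (subst ennreal_plus) (auto simp: ennreal_mult simp del: ennreal_plus power_Suc)
      also have "\<dots> \<le> m (j + 2)" unfolding m_def by (rule ennreal_leI[OF weight_step])
      finally show "m j * ennreal (1 + ?t) + m' (j + 2) \<le> m (j + 2)" .
    qed simp
    finally show ?thesis .
  qed
  have "(\<Sum>j. m j * a j) + P \<le> T + R"
  proof -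
    have "(\<Sum>j. m j * a j) + P = (\<Sum>j. m j * a j + m' (j + 2) * a (j + 2))"
      unfolding P_def by (rule suminf_add_ennreal[symmetric])
    also have "\<dots> \<le> (\<Sum>j. m (j + 2) * a (j + 2) + (2 * (ennreal ((1 + real j) ^ (p + 2)) * \<omega> j) + m j * \<gamma> j))"
      by (intro suminf_le pt) auto
    also have "\<dots> = T + R"
      unfolding T_def R_def by (simp only: suminf_add_ennreal suminf_cmult_ennreal)
    finally show ?thesis .
  qed
  then have "T + (m 0 * a 0 + m 1 * a 1 + P) \<le> T + R"
    unfolding suminf_split_two_ennreal[of "\<lambda>j. m j * a j"] T_def by (simp add: add_ac)
  \<comment> \<open>Cancellation in \<open>ennreal\<close> is legitimate only for a finite summand;
    \<open>fin\<close> provides this.\<close>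
  moreover have "T < \<infinity>"
    using fin unfolding m_def[symmetric] suminf_split_two_ennreal[of "\<lambda>j. m j * a j"] T_def[symmetric] by simp
  ultimately have "m 0 * a 0 + m 1 * a 1 + P \<le> R"
    by (auto simp: ennreal_add_left_cancel_le)
  \<comment> \<open>The shift by two never reaches the indices 0 and 1. Their terms survive with the
    larger weight and are lowered to the weight used in the conclusion.\<close>
  moreover have "m' 0 * a 0 + m' 1 * a 1 \<le> m 0 * a 0 + m 1 * a 1"
    unfolding m_def m'_def by (intro add_mono mult_right_mono ennreal_leI power_increasing) auto
  ultimately have "m' 0 * a 0 + m' 1 * a 1 + P \<le> R"
    by (meson add_right_mono order_trans)
  then have "(\<Sum>j. m' j * a j) \<le> R"
    unfolding suminf_split_two_ennreal[of "\<lambda>j. m' j * a j"] P_def .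
  then show ?thesis by (simp only: m'_def R_def m_def)
qed

lemma weak_dbar_le_beltrami:
  assumes w: "w j \<in> L2_space" and v: "\<And>j. v j \<in> H1_space" and s: "solves_beltrami v w" and t: "0 < t"
  shows "L2_norm_sq (weak_dbar (v j)) \<le> ennreal (1 + t) * L2_norm_sq (weak_d (v (j + 2))) + ennreal (1 + 1 / t) * L2_norm_sq (w j)"
proof -
  have "AE z in lebesgue_on disc. weak_dbar (v j) z + weak_d (v (j + 2)) z = w j z"
    using s unfolding solves_beltrami_def by (simp add: left_shift_def numeral_2_eq_2)
  then have e: "AE z in lebesgue_on disc. weak_dbar (v j) z = (- 1) * weak_d (v (j + 2)) z + w j z"
    by eventually_elim (simp add: algebra_simps eq_diff_eq)
  note dL = weak_d_L2_space(1)[OF v, of "j + 2"]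
  have "L2_norm_sq (weak_dbar (v j)) \<le> ennreal (1 + t) * L2_norm_sq (\<lambda>z. (- 1) * weak_d (v (j + 2)) z) + ennreal (1 + 1 / t) * L2_norm_sq (w j)"
    by (rule L2_norm_sq_add_le[OF L2_space_cmult(1)[OF dL] w e t])
  then show ?thesis using L2_space_cmult(2)[OF dL, of "- 1"] by simp
qed

theorem theorem3p1:
  fixes p :: nat
  shows "\<exists>C::real. C > 0 \<and>
    (\<forall>v w. w \<in> l2_L2 (p + 2) \<longrightarrow> v \<in> l2_H1 (p + 1) \<longrightarrow> solves_beltrami v w \<longrightarrow>
      seq_norm_sq p H1_norm_sq v \<le>
        ennreal C * (seq_norm_sq (p + 2) L2_norm_sq w +
          seq_norm_sq (p + 1) (Hs_circle_norm_sq (1/2)) (\<lambda>j. bdry_trace (v j))))"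
\<comment> \<open>With pi <= 4 and 2 pi <= 8 the final sum is 32 W + 56 G, and 100 is a rounded
  bound. It is independent of \<open>p\<close> as well.\<close>
proof (intro exI[of _ 100] conjI allI impI)
  fix v w assume wl: "w \<in> l2_L2 (p + 2)" and vl: "v \<in> l2_H1 (p + 1)" and s: "solves_beltrami v w"
  have wL: "w j \<in> L2_space" and v: "v j \<in> H1_space" for j
    using wl vl by (auto simp: l2_L2_def l2_H1_def)
  define a where "a j = L2_norm_sq (weak_d (v j))" for j
  define b where "b j = L2_norm_sq (weak_dbar (v j))" for j
  define \<omega> where "\<omega> j = L2_norm_sq (w j)" for j
  define \<gamma> where "\<gamma> j = Hs_circle_norm_sq (1/2) (bdry_trace (v j))" for j
  define W where "W = (\<Sum>j. ennreal ((1 + real j) ^ (p + 2)) * \<omega> j)"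
  define G where "G = (\<Sum>j. ennreal ((1 + real j) ^ (p + 1)) * \<gamma> j)"
  have tr: "has_bdry_trace (v j) (bdry_trace (v j))" for j
    by (rule has_bdry_trace_bdry_trace[OF v])
  have ab: "a j \<le> b j + ennreal pi * \<gamma> j" for j
    unfolding a_def b_def \<gamma>_def by (rule L2_weak_d_le[OF tr])
  have ba: "b j \<le> ennreal (1 + t) * a (j + 2) + ennreal (1 + 1 / t) * \<omega> j" if "0 < t" for j t
    unfolding a_def b_def \<omega>_def by (rule weak_dbar_le_beltrami[OF wL v s that])
  \<comment> \<open>The gradient part of the H^1 norm is 2 (a + b), and the Poincare inequality for
    the function itself contributes the same amount again, hence the 4.\<close>
  have H: "H1_norm_sq (v j) \<le> ennreal (2 * pi) * \<gamma> j + 4 * (a j + b j)" for j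
  proof -
    have "H1_norm_sq (v j) \<le> (ennreal (2 * pi) * \<gamma> j + 2 * (a j + b j)) + 2 * (a j + b j)"
      unfolding H1_norm_sq_eq[OF v] a_def b_def \<gamma>_def by (rule add_right_mono[OF L2_le_trace[OF tr]])
    also have "\<dots> = ennreal (2 * pi) * \<gamma> j + (2 + 2) * (a j + b j)"
      by (simp only: distrib_right add.assoc)
    finally show ?thesis by simp
  qed
  have A: "(\<Sum>j. ennreal ((1 + real j) ^ p) * a j) \<le> 2 * W + ennreal pi * G"
  proof -
    have "(\<Sum>j. ennreal ((1 + real j) ^ p) * a j) \<le> 2 * W + (\<Sum>j. ennreal ((1 + real j) ^ (p + 1)) * (ennreal pi * \<gamma> j))"
      unfolding W_def
    proof (rule telescoping_estimate)
      have "(\<Sum>j. ennreal ((1 + real j) ^ (p + 1)) * a j) \<le> seq_norm_sq (p + 1) H1_norm_sq v"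
        unfolding seq_norm_sq_def a_def
        by (intro suminf_le mult_left_mono H1_norm_sq_ge(2)[OF v]) auto
      also have "\<dots> < \<infinity>" using vl by (simp add: l2_H1_def)
      finally show "(\<Sum>j. ennreal ((1 + real j) ^ (p + 1)) * a j) < \<infinity>" .
      show "a j \<le> ennreal (1 + t) * a (j + 2) + ennreal (1 + 1 / t) * \<omega> j + ennreal pi * \<gamma> j" if "0 < t" for j t
        using order_trans[OF ab add_right_mono[OF ba[OF that]]] .
    qed
    also have "(\<Sum>j. ennreal ((1 + real j) ^ (p + 1)) * (ennreal pi * \<gamma> j)) = ennreal pi * G"
      unfolding G_def suminf_cmult_ennreal[symmetric] by (simp only: mult.left_commute)
    finally show ?thesis .
  qed
  \<comment> \<open>Here no telescoping takes place, so the crude Young parameter 1 suffices: the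
    equation bounds b by the shifted a, and the weight only grows under the shift, so that
    \<open>A\<close> applies.\<close>
  have B: "(\<Sum>j. ennreal ((1 + real j) ^ p) * b j) \<le> 2 * (2 * W + ennreal pi * G) + 2 * W"
  proof -
    have "(\<Sum>j. ennreal ((1 + real j) ^ p) * b j) \<le>
        (\<Sum>j. 2 * (ennreal ((1 + real (j + 2)) ^ p) * a (j + 2)) + 2 * (ennreal ((1 + real j) ^ (p + 2)) * \<omega> j))"
    proof (intro suminf_le)
      fix j
      have "ennreal ((1 + real j) ^ p) * b j \<le> ennreal ((1 + real j) ^ p) * (2 * a (j + 2) + 2 * \<omega> j)"
        using ba[of 1 j] by (intro mult_left_mono) auto
      also have "\<dots> = 2 * (ennreal ((1 + real j) ^ p) * a (j + 2)) + 2 * (ennreal ((1 + real j) ^ p) * \<omega> j)"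
        by (simp only: distrib_left mult.left_commute)
      also have "\<dots> \<le> 2 * (ennreal ((1 + real (j + 2)) ^ p) * a (j + 2)) + 2 * (ennreal ((1 + real j) ^ (p + 2)) * \<omega> j)"
        by (intro add_mono mult_left_mono mult_right_mono ennreal_leI power_mono power_increasing) auto
      finally show "ennreal ((1 + real j) ^ p) * b j \<le> 2 * (ennreal ((1 + real (j + 2)) ^ p) * a (j + 2)) + 2 * (ennreal ((1 + real j) ^ (p + 2)) * \<omega> j)" .
    qed auto
    also have "\<dots> = 2 * (\<Sum>j. ennreal ((1 + real (j + 2)) ^ p) * a (j + 2)) + 2 * W"
      unfolding W_def by (simp only: suminf_add_ennreal suminf_cmult_ennreal)
    also have "\<dots> \<le> 2 * (\<Sum>j. ennreal ((1 + real j) ^ p) * a j) + 2 * W"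
      unfolding suminf_split_two_ennreal[of "\<lambda>j. ennreal ((1 + real j) ^ p) * a j"]
      by (intro add_right_mono mult_left_mono) auto
    also have "\<dots> \<le> 2 * (2 * W + ennreal pi * G) + 2 * W"
      by (intro add_right_mono mult_left_mono A) auto
    finally show ?thesis .
  qed
  have "seq_norm_sq p H1_norm_sq v \<le> (\<Sum>j. ennreal (2 * pi) * (ennreal ((1 + real j) ^ (p + 1)) * \<gamma> j)
     + 4 * (ennreal ((1 + real j) ^ p) * a j + ennreal ((1 + real j) ^ p) * b j))"
    unfolding seq_norm_sq_def
  proof (intro suminf_le)
    fix j
    have "ennreal ((1 + real j) ^ p) * H1_norm_sq (v j) \<le> ennreal ((1 + real j) ^ p) * (ennreal (2 * pi) * \<gamma> j + 4 * (a j + b j))"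
      by (intro mult_left_mono H) simp
    also have "\<dots> = ennreal (2 * pi) * (ennreal ((1 + real j) ^ p) * \<gamma> j)
       + 4 * (ennreal ((1 + real j) ^ p) * a j + ennreal ((1 + real j) ^ p) * b j)"
      by (simp only: distrib_left mult.left_commute)
    also have "\<dots> \<le> ennreal (2 * pi) * (ennreal ((1 + real j) ^ (p + 1)) * \<gamma> j)
       + 4 * (ennreal ((1 + real j) ^ p) * a j + ennreal ((1 + real j) ^ p) * b j)"
      by (intro add_right_mono mult_left_mono mult_right_mono ennreal_leI power_increasing) auto
    finally show "ennreal ((1 + real j) ^ p) * H1_norm_sq (v j) \<le> ennreal (2 * pi) * (ennreal ((1 + real j) ^ (p + 1)) * \<gamma> j)
       + 4 * (ennreal ((1 + real j) ^ p) * a j + ennreal ((1 + real j) ^ p) * b j)" .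
  qed auto
  also have "\<dots> = ennreal (2 * pi) * G + 4 * ((\<Sum>j. ennreal ((1 + real j) ^ p) * a j) + (\<Sum>j. ennreal ((1 + real j) ^ p) * b j))"
    unfolding G_def by (simp only: suminf_add_ennreal suminf_cmult_ennreal)
  also have "\<dots> \<le> ennreal (2 * pi) * G + 4 * ((2 * W + ennreal pi * G) + (2 * (2 * W + ennreal pi * G) + 2 * W))"
    by (intro add_left_mono mult_left_mono add_mono A B) auto
  also have "\<dots> \<le> 8 * G + 4 * ((2 * W + 4 * G) + (2 * (2 * W + 4 * G) + 2 * W))"
  proof -
    have "ennreal pi \<le> ennreal 4" "ennreal (2 * pi) \<le> ennreal 8"
      using pi_less_4 by (intro ennreal_leI; simp)+
    then have "ennreal pi \<le> 4" "ennreal (2 * pi) \<le> 8" by simp_all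
    then show ?thesis by (intro add_mono mult_left_mono mult_right_mono) auto
  qed
  also have "\<dots> = (4 * 2 + 4 * (2 * 2) + 4 * 2) * W + (8 + 4 * 4 + 4 * (2 * 4)) * G"
    by (simp only: distrib_left distrib_right mult.assoc add_ac)
  also have "\<dots> \<le> 100 * W + 100 * G"
    by (intro add_mono mult_right_mono) auto
  also have "\<dots> = ennreal 100 * (W + G)" by (simp add: distrib_left)
  finally show "seq_norm_sq p H1_norm_sq v \<le>
        ennreal 100 * (seq_norm_sq (p + 2) L2_norm_sq w +
          seq_norm_sq (p + 1) (Hs_circle_norm_sq (1/2)) (\<lambda>j. bdry_trace (v j)))"
    by (simp only: seq_norm_sq_def W_def G_def \<omega>_def \<gamma>_def)
qed simp

end
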